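(* For $p\in(0,1]$, let $\gamma_p$ and $\widetilde\gamma_p$ be the almost-sure exponential growth rates of the linear and non-linear random Fibonacci sequences with parameter $p$ (defined in the context), and let $\phi:=(1+\sqrt5)/2$. (Linear case) The function $p\mapsto\gamma_p$ is an increasing function of $p$, satisfying $$\lim_{p\to0}\gamma_p=0,\qquad \gamma_1=\log\phi,\qquad \frac{d\gamma_p}{dp}(1)=\frac{\log5}{2}.$$ (Non-linear case) The function $p\mapsto\widetilde\gamma_p$ is a continuous function of $p$, increasing on $(1/3,1]$, satisfying $$\widetilde\gamma_p=0\ \text{ for } p\le1/3,\qquad \widetilde\gamma_1=\log\phi,\qquad \frac{d\widetilde\gamma_p}{dp}(1)=\frac{\log5}{2}.$$
   Context: For $p\in(0,1]$, the random Fibonacci sequences $(F_n)_{n\ge1}$, $(\widetilde F_n)_{n\ge1}$ are defined by $F_1=F_2=\widetilde F_1=\widetilde F_2=1$ and, for $n\ge1$, $F_{n+2}=F_{n+1}\pm F_n$ (linear case) and $\widetilde F_{n+2}=|\widetilde F_{n+1}\pm\widetilde F_n|$ (non-linear case), where the $\pm$ signs are independent, each being $+$ with probability $p$ and $-$ with probability $1-p$. The growth rates $\gamma_p$ and $\widetilde\gamma_p$ are the almost-sure limits $$\gamma_p:=\lim_{n\to\infty}\frac1n\log|F_n|,\qquad \widetilde\gamma_p:=\lim_{n\to\infty}\frac1n\log\widetilde F_n,$$ which are constants depending only on $p$. *)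

theory Defs
  imports "HOL-Probability.Probability"
begin

(* Sequences start at index 1; the value at 0 is irrelevant. The sign used to compute
   the term of index n + 2 from those of index n + 1 and n (n \<ge> 1) is "s n", with True for plus. *)

fun lin_fib :: "(nat \<Rightarrow> bool) \<Rightarrow> nat \<Rightarrow> int" where
  "lin_fib s 0 = 0"
| "lin_fib s (Suc 0) = 1"
| "lin_fib s (Suc (Suc 0)) = 1"
| "lin_fib s (Suc (Suc (Suc n))) =
     (if s (Suc n) then lin_fib s (Suc (Suc n)) + lin_fib s (Suc n)
      else lin_fib s (Suc (Suc n)) - lin_fib s (Suc n))"

fun nonlin_fib :: "(nat \<Rightarrow> bool) \<Rightarrow> nat \<Rightarrow> int" where
  "nonlin_fib s 0 = 0"
| "nonlin_fib s (Suc 0) = 1"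
| "nonlin_fib s (Suc (Suc 0)) = 1"
| "nonlin_fib s (Suc (Suc (Suc n))) =
     (if s (Suc n) then \<bar>nonlin_fib s (Suc (Suc n)) + nonlin_fib s (Suc n)\<bar>
      else \<bar>nonlin_fib s (Suc (Suc n)) - nonlin_fib s (Suc n)\<bar>)"

(* The law of the sign sequence: independent, each True with probability p. *)

definition signs :: "real \<Rightarrow> (nat \<Rightarrow> bool) measure" where
  "signs p = (\<Pi>\<^sub>M n\<in>UNIV. measure_pmf (bernoulli_pmf p))"

(* The sequences can vanish (1, 1, 0, ...), and then the library value ln 0 = 0 is used. This
   matters: for p \<le> 1/3 the non-linear sequence almost surely vanishes infinitely often, so with
   log 0 = -\<infinity> the limit would not exist. *)

definition has_growth_rate ::
    "real \<Rightarrow> ((nat \<Rightarrow> bool) \<Rightarrow> nat \<Rightarrow> int) \<Rightarrow> real \<Rightarrow> bool" where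
  "has_growth_rate p X c \<longleftrightarrow>
     (AE s in signs p. (\<lambda>n. (1 / real n) * ln (real_of_int (X s n))) \<longlonglongrightarrow> c)"

definition lin_growth :: "real \<Rightarrow> real" where
  "lin_growth p = (THE c. has_growth_rate p (\<lambda>s n. \<bar>lin_fib s n\<bar>) c)"

definition nonlin_growth :: "real \<Rightarrow> real" where
  "nonlin_growth p = (THE c. has_growth_rate p nonlin_fib c)"

end

theory Submission
  imports Defs
begin

text \<open>In both cases the growth rate is \<open>G(a) = \<integral> ln x d\<nu>(x)\<close>, where \<open>\<nu>\<close> is stationary under the
  independent choice of \<open>A: x \<mapsto> 1 + 1/x\<close> with probability \<open>a\<close> and \<open>B: x \<mapsto> 1/(1 + x)\<close> with probability
  \<open>1 - a\<close>, for an explicit \<open>a = a(p)\<close>. Two steps contract the distance \<open>\<bar>ln x - ln y\<bar>\<close> on average,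
  uniformly for \<open>1/2 \<le> a \<le> 1\<close>, so it suffices to work with the limit functional \<open>stat a\<close> of the
  iterated transition operator on functions that are Lipschitz in \<open>ln x\<close>.

  If \<open>\<Lambda>(a)\<close> is the Lyapunov exponent of products of the matrices of \<open>A\<close> and \<open>B\<close>, then
  \<open>G(a) = (2 a - 1) \<Lambda>(a) / (1 - a + a\<^sup>2)\<close>, and \<open>\<Lambda>(b) - \<Lambda>(a)\<close> is \<open>b - a\<close> times the mean of
  \<open>ln ((x + y + x y) / (1 + x + y))\<close> under independent \<open>x\<close>, \<open>y\<close> with parameters \<open>a\<close>, \<open>b\<close>. A lower bound of
  this mean gives the monotonicity and its limit for \<open>a \<rightarrow> 1\<close> the derivative.

  For the almost sure convergence, a function of two consecutive terms is built whose mean increment is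
  exactly \<open>G(a)\<close> and which stays within a constant of the logarithm of the size of the terms; bounded
  increments then give a law of large numbers by exponential moments. The identities behind it are
  that, on nonnegative pairs, a plus followed by two minuses is the identity in the non-linear case and flips
  one sign in the linear case. For \<open>p \<le> 1/3\<close> in the non-linear case the length of the Euclidean algorithm
  on two consecutive terms grows sublinearly instead.\<close>

section \<open>Contraction of the transition operator\<close>

definition letter_op :: "real \<Rightarrow> (real \<Rightarrow> real) \<Rightarrow> real \<Rightarrow> real" where
  "letter_op a f x = a * f (1 + 1 / x) + (1 - a) * f (1 / (1 + x))"

definition log_lip :: "real \<Rightarrow> (real \<Rightarrow> real) \<Rightarrow> bool" where
  "log_lip L f \<longleftrightarrow> (\<forall>x>0. \<forall>y>0. \<bar>f x - f y\<bar> \<le> L * \<bar>ln x - ln y\<bar>)"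

text \<open>The limit of the iterated operator stands in for the integral against the stationary
  law. By contraction the starting point 1 is arbitrary; the limit is shown to exist for
  log-Lipschitz \<open>f\<close> and \<open>1/2 \<le> a \<le> 1\<close>.\<close>

definition stat :: "real \<Rightarrow> (real \<Rightarrow> real) \<Rightarrow> real" where
  "stat a f = lim (\<lambda>n. (letter_op a ^^ n) f 1)"

lemma log_lipI:
  assumes "0 \<le> L" and "\<And>x y. 0 < x \<Longrightarrow> x < y \<Longrightarrow> \<bar>f y - f x\<bar> \<le> L * (ln y - ln x)"
  shows "log_lip L f"
  unfolding log_lip_def
proof (intro allI impI)
  fix x y :: real assume xy: "x > 0" "y > 0"
  consider "x < y" | "y < x" | "x = y" by linarith
  then show "\<bar>f x - f y\<bar> \<le> L * \<bar>ln x - ln y\<bar>"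
  proof cases
    case 1
    then have "\<bar>ln x - ln y\<bar> = ln y - ln x" using xy by simp
    then show ?thesis using assms(2)[of x y] xy 1 by (simp add: abs_minus_commute)
  next
    case 2
    then have "\<bar>ln x - ln y\<bar> = ln x - ln y" using xy by simp
    then show ?thesis using assms(2)[of y x] xy 2 by simp
  qed simp
qed

lemma log_lipD: "log_lip L f \<Longrightarrow> 0 < x \<Longrightarrow> 0 < y \<Longrightarrow> \<bar>f x - f y\<bar> \<le> L * \<bar>ln x - ln y\<bar>"
  unfolding log_lip_def by blast

lemma log_lip_nonneg: "log_lip L f \<Longrightarrow> 0 \<le> L"
proof -
  assume "log_lip L f"
  from log_lipD[OF this, of "exp 1" 1] have "\<bar>f (exp 1) - f 1\<bar> \<le> L" by simp
  then show ?thesis by linarith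
qed

lemma log_lip_weaken: "log_lip L f \<Longrightarrow> L \<le> M \<Longrightarrow> log_lip M f"
  unfolding log_lip_def by (meson abs_ge_zero mult_right_mono order_trans)

lemma log_lip_const: "log_lip 0 (\<lambda>x. c)"
  by (simp add: log_lip_def)

lemma log_lip_ln: "log_lip 1 ln"
  by (simp add: log_lip_def)

lemma log_lip_add: "log_lip L f \<Longrightarrow> log_lip M g \<Longrightarrow> log_lip (L + M) (\<lambda>x. f x + g x)"
  unfolding log_lip_def by (fastforce simp: distrib_right)

lemma log_lip_diff: "log_lip L f \<Longrightarrow> log_lip M g \<Longrightarrow> log_lip (L + M) (\<lambda>x. f x - g x)"
  unfolding log_lip_def by (fastforce simp: distrib_right)

lemma log_lip_cmult: "log_lip L f \<Longrightarrow> log_lip (\<bar>c\<bar> * L) (\<lambda>x. c * f x)"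
proof -
  assume *: "log_lip L f"
  have "\<bar>c * f x - c * f y\<bar> \<le> \<bar>c\<bar> * L * \<bar>ln x - ln y\<bar>" if "x > 0" "y > 0" for x y
  proof -
    have "\<bar>c * f x - c * f y\<bar> = \<bar>c\<bar> * \<bar>f x - f y\<bar>"
      by (metis abs_mult right_diff_distrib)
    also have "\<dots> \<le> \<bar>c\<bar> * (L * \<bar>ln x - ln y\<bar>)"
      using log_lipD[OF * that] by (intro mult_left_mono) auto
    finally show ?thesis by simp
  qed
  then show ?thesis by (simp add: log_lip_def)
qed

text \<open>In the variable \<open>ln x\<close> the slope is \<open>b x / (a + b x)\<close>, which
  lies between 0 and 1. The upper bound compares \<open>x (a + b y)\<close> with
  \<open>y (a + b x)\<close>.\<close>

lemma ln_affine_bounds: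
  fixes a b x y :: real
  assumes "0 \<le> a" "0 \<le> b" "0 < a + b" "0 < x" "x < y"
  shows "0 \<le> ln (a + b * y) - ln (a + b * x)" "ln (a + b * y) - ln (a + b * x) \<le> ln y - ln x"
proof -
  have p: "0 < a + b * x"
    using assms by (metis add_nonneg_pos add_pos_nonneg less_add_same_cancel1 linorder_not_less mult_nonneg_nonneg mult_pos_pos order_le_less)
  have le: "a + b * x \<le> a + b * y" using assms by (simp add: mult_left_mono)
  show "0 \<le> ln (a + b * y) - ln (a + b * x)" using p le by simp
  have "x * (a + b * y) \<le> y * (a + b * x)"
    using assms mult_left_mono[of x y a] by (simp add: algebra_simps)
  then have "ln (x * (a + b * y)) \<le> ln (y * (a + b * x))"
    using p le assms by (intro ln_mono) auto
  then show "ln (a + b * y) - ln (a + b * x) \<le> ln y - ln x"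
    using p le assms by (simp add: ln_mult)
qed

lemma log_lip_ln_affine:
  assumes "0 \<le> a" "0 \<le> b" "0 < a + b"
  shows "log_lip 1 (\<lambda>x. ln (a + b * x))"
  using ln_affine_bounds[OF assms] by (intro log_lipI) simp_all

lemma log_lip_comp:
  assumes "log_lip L f" "log_lip M (\<lambda>x. ln (g x))" "\<And>x. 0 < x \<Longrightarrow> 0 < g x"
  shows "log_lip (L * M) (\<lambda>x. f (g x))"
  unfolding log_lip_def
proof (intro allI impI)
  fix x y :: real assume xy: "0 < x" "0 < y"
  have "\<bar>f (g x) - f (g y)\<bar> \<le> L * \<bar>ln (g x) - ln (g y)\<bar>"
    using log_lipD[OF assms(1)] assms(3) xy by simp
  also have "\<dots> \<le> L * (M * \<bar>ln x - ln y\<bar>)"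
    using log_lipD[OF assms(2) xy] log_lip_nonneg[OF assms(1)] by (intro mult_left_mono) auto
  finally show "\<bar>f (g x) - f (g y)\<bar> \<le> L * M * \<bar>ln x - ln y\<bar>" by simp
qed

lemma ln_letters:
  fixes x :: real assumes "0 < x"
  shows "ln (1 + 1 / x) = ln (1 + x) - ln x" "ln (1 / (1 + x)) = - ln (1 + x)"
proof -
  have "1 + 1 / x = (1 + x) / x" using assms by (simp add: field_simps)
  then show "ln (1 + 1 / x) = ln (1 + x) - ln x" using assms by (simp add: ln_div)
  show "ln (1 / (1 + x)) = - ln (1 + x)" using assms by (simp add: ln_div)
qed

text \<open>In the variable \<open>ln x\<close> both letters have slope between -1 and 0. For
  \<open>a\<close> close to 1 a single letter gives no uniform contraction, because the slope of
  \<open>ln (1 + 1/x)\<close> tends to -1 as \<open>x\<close> tends to 0; this is why two letters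
  are taken together below.\<close>

lemma log_lip_letters:
  "log_lip 1 (\<lambda>x. ln (1 + 1 / x))" "log_lip 1 (\<lambda>x. ln (1 / (1 + x)))"
proof -
  note b = ln_affine_bounds[of 1 1, simplified]
  show "log_lip 1 (\<lambda>x. ln (1 + 1 / x))"
  proof (intro log_lipI)
    fix x y :: real assume "0 < x" "x < y"
    with b[of x y] show "\<bar>ln (1 + 1 / y) - ln (1 + 1 / x)\<bar> \<le> 1 * (ln y - ln x)"
      by (simp add: ln_letters abs_le_iff)
  qed simp
  show "log_lip 1 (\<lambda>x. ln (1 / (1 + x)))"
  proof (intro log_lipI)
    fix x y :: real assume "0 < x" "x < y"
    with b[of x y] show "\<bar>ln (1 / (1 + y)) - ln (1 / (1 + x))\<bar> \<le> 1 * (ln y - ln x)"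
      by (simp add: ln_letters abs_if)
  qed simp
qed

lemma log_lip_comp_letters:
  assumes "log_lip L f"
  shows "log_lip L (\<lambda>x. f (1 + 1 / x))" "log_lip L (\<lambda>x. f (1 / (1 + x)))"
  using log_lip_comp[OF assms log_lip_letters(1)] log_lip_comp[OF assms log_lip_letters(2)]
  by (simp_all add: add_pos_pos)

lemma log_lip_letter_op:
  assumes "log_lip L f" "0 \<le> a" "a \<le> 1"
  shows "log_lip L (letter_op a f)"
proof -
  have "log_lip (\<bar>a\<bar> * L + \<bar>1 - a\<bar> * L) (\<lambda>x. a * f (1 + 1 / x) + (1 - a) * f (1 / (1 + x)))"
    by (intro log_lip_add log_lip_cmult log_lip_comp_letters assms)
  moreover have "\<bar>a\<bar> * L + \<bar>1 - a\<bar> * L = L" using assms by (simp add: algebra_simps)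
  ultimately show ?thesis unfolding letter_op_def by simp
qed

text \<open>The word AA sends \<open>x\<close> to \<open>(1 + 2 x) / (1 + x)\<close>. The slope of
  its logarithm in \<open>ln x\<close> is \<open>x / ((1 + x) (1 + 2 x))\<close>, so the bound 1/2
  is generous.\<close>

lemma half_log_contraction:
  fixes x y :: real
  assumes "0 < x" "x < y"
  shows "(ln (1 + 2 * y) - ln (1 + y)) - (ln (1 + 2 * x) - ln (1 + x)) \<le> (ln y - ln x) / 2"
proof -
  let ?g = "\<lambda>z::real. ln z / 2 - ln (1 + 2 * z) + ln (1 + z)"
  have "?g x \<le> ?g y"
  proof (rule DERIV_nonneg_imp_nondecreasing[where f = ?g])
    fix z assume "x \<le> z" "z \<le> y"
    then have z: "z > 0" using assms by simp
    have eq: "(1/z) / 2 - (1/(1+2*z)) * 2 + 1/(1+z) = (2*z^2 + z + 1) / (2*z*(1+2*z)*(1+z))"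
      using z by (simp add: divide_simps) (simp add: algebra_simps power2_eq_square)
    have "(?g has_real_derivative (1/z) / 2 - (1/(1+2*z)) * 2 + 1/(1+z)) (at z)"
      using z by (auto intro!: derivative_eq_intros)
    moreover have "0 \<le> (1/z) / 2 - (1/(1+2*z)) * 2 + 1/(1+z)" unfolding eq using z by simp
    ultimately show "\<exists>D. (?g has_real_derivative D) (at z) \<and> 0 \<le> D" by (intro exI conjI)
  qed (use assms in simp)
  then show ?thesis by (simp add: field_simps)
qed

text \<open>The increments of the logarithm under the four words of length two are
  \<open>w - v\<close>, \<open>u - w\<close>, \<open>z\<close> and \<open>v - z\<close>, all
  nonnegative. In their weighted mean most terms cancel, and what remains is controlled by
  \<open>w - v \<le> u / 2\<close>.\<close>

lemma log_lip_letter_op2: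
  assumes f: "log_lip L f" and a: "1/2 \<le> a" "a \<le> 1"
  shows "log_lip (L / 2) (letter_op a (letter_op a f))"
proof (rule log_lipI)
  have L: "0 \<le> L" by (rule log_lip_nonneg[OF f])
  then show "0 \<le> L / 2" by simp
  fix x y :: real assume xy: "0 < x" "x < y"
  define u v w z where "u = ln y - ln x" and "v = ln (1 + y) - ln (1 + x)"
    and "w = ln (1 + 2 * y) - ln (1 + 2 * x)" and "z = ln (2 + y) - ln (2 + x)"
  have eqs: "letter_op a (letter_op a f) x = a\<^sup>2 * f ((1 + 2*x)/(1 + x)) + a*(1-a) * f (x/(1+2*x))
      + (1-a)*a * f (2 + x) + (1-a)\<^sup>2 * f ((1+x)/(2+x))" if "x > 0" for x
  proof -
    have e: "1 + 1 / (1 + 1/x) = (1 + 2*x)/(1 + x)" "1 / (1 + (1 + 1/x)) = x/(1+2*x)"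
      "1 + 1 / (1/(1+x)) = 2 + x" "1 / (1 + 1/(1+x)) = (1+x)/(2+x)"
      using that by (simp_all add: field_simps)
    show ?thesis
      unfolding letter_op_def e by (simp add: algebra_simps power2_eq_square)
  qed
  have bv: "0 \<le> v" "v \<le> u" using ln_affine_bounds[of 1 1 x y] xy by (auto simp: u_def v_def)
  have bw: "0 \<le> w" "w \<le> u" using ln_affine_bounds[of 1 2 x y] xy by (auto simp: u_def w_def)
  have bz: "0 \<le> z" using ln_affine_bounds[of 2 1 x y] xy by (auto simp: z_def)
  have wv: "w - v \<le> u / 2" using half_log_contraction[OF xy] by (simp add: u_def v_def w_def)
  have vw: "v \<le> w"
  proof -
    have "ln ((1 + 2*x) * (1 + y)) \<le> ln ((1 + x) * (1 + 2*y))"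
      using xy by (intro ln_mono mult_pos_pos add_pos_pos) (auto simp: algebra_simps)
    then show ?thesis using xy by (simp add: ln_mult v_def w_def)
  qed
  have zv: "z \<le> v"
  proof -
    have "ln ((1 + x) * (2 + y)) \<le> ln ((2 + x) * (1 + y))"
      using xy by (intro ln_mono mult_pos_pos add_pos_pos) (auto simp: algebra_simps)
    then show ?thesis using xy by (simp add: ln_mult v_def z_def)
  qed
  have *: "\<bar>f q - f r\<bar> \<le> L * d" if "0 < q" "0 < r" "ln q - ln r = d" "0 \<le> d" for q r d
    using log_lipD[OF f that(1,2)] that(3,4) by simp
  have 1: "\<bar>f ((1 + 2*y)/(1 + y)) - f ((1 + 2*x)/(1 + x))\<bar> \<le> L * (w - v)"
    by (rule *) (use xy vw in \<open>simp_all add: ln_div w_def v_def\<close>)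
  have 2: "\<bar>f (y/(1 + 2*y)) - f (x/(1 + 2*x))\<bar> \<le> L * (u - w)"
    by (rule *) (use xy bw in \<open>simp_all add: ln_div w_def u_def\<close>)
  have 3: "\<bar>f (2 + y) - f (2 + x)\<bar> \<le> L * z"
    by (rule *) (use xy bz in \<open>simp_all add: z_def\<close>)
  have 4: "\<bar>f ((1+y)/(2+y)) - f ((1+x)/(2+x))\<bar> \<le> L * (v - z)"
    by (rule *) (use xy zv in \<open>simp_all add: ln_div z_def v_def\<close>)
  have "\<bar>letter_op a (letter_op a f) y - letter_op a (letter_op a f) x\<bar>
      = \<bar>a\<^sup>2 * (f ((1 + 2*y)/(1 + y)) - f ((1 + 2*x)/(1 + x)))
        + a*(1-a) * (f (y/(1 + 2*y)) - f (x/(1 + 2*x)))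
        + (1-a)*a * (f (2 + y) - f (2 + x)) + (1-a)\<^sup>2 * (f ((1+y)/(2+y)) - f ((1+x)/(2+x)))\<bar>"
    using xy by (simp add: eqs algebra_simps)
  also have "\<dots> \<le> \<bar>a\<^sup>2 * (f ((1 + 2*y)/(1 + y)) - f ((1 + 2*x)/(1 + x)))\<bar>
        + \<bar>a*(1-a) * (f (y/(1 + 2*y)) - f (x/(1 + 2*x)))\<bar>
        + \<bar>(1-a)*a * (f (2 + y) - f (2 + x))\<bar> + \<bar>(1-a)\<^sup>2 * (f ((1+y)/(2+y)) - f ((1+x)/(2+x)))\<bar>"
    by linarith
  also have "\<dots> \<le> a\<^sup>2 * (L * (w - v)) + a*(1-a) * (L * (u - w)) + (1-a)*a * (L * z) + (1-a)\<^sup>2 * (L * (v - z))"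
    unfolding abs_mult using 1 2 3 4 a by (intro add_mono mult_mono) auto
  \<comment> \<open>Collecting terms isolates the nonnegative factor \<open>2 a - 1\<close>.
    Dropping \<open>v - z\<close> and bounding \<open>w - v\<close> by \<open>u / 2\<close> leaves
    \<open>a (1 - a) u + (2 a - 1) a u / 2 = a u / 2\<close>.\<close>
  also have "\<dots> = L * (a * (1-a) * u + (2*a-1) * (a * (w - v) - (1 - a) * (v - z)))"
    by (simp add: algebra_simps power2_eq_square)
  also have "\<dots> \<le> L * (u / 2)"
  proof (rule mult_left_mono[OF _ L])
    have "(2*a-1) * (a * (w - v) - (1 - a) * (v - z)) \<le> (2*a-1) * (a * (u/2) - 0)"
      using a wv zv by (intro mult_left_mono diff_mono) auto
    then have "a * (1-a) * u + (2*a-1) * (a * (w - v) - (1 - a) * (v - z)) \<le> a * u / 2"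
      by (simp add: algebra_simps)
    also have "\<dots> \<le> u / 2" using a bv by (simp add: mult_left_le_one_le)
    finally show "a * (1-a) * u + (2*a-1) * (a * (w - v) - (1 - a) * (v - z)) \<le> u / 2" .
  qed
  finally show "\<bar>letter_op a (letter_op a f) y - letter_op a (letter_op a f) x\<bar> \<le> L / 2 * (ln y - ln x)"
    by (simp add: u_def)
qed

text \<open>Induction in steps of two. The rate 3/4 replaces the square root of 1/2, since 9/16
  exceeds 1/2, and the factor 2 absorbs the odd exponents.\<close>

lemma log_lip_funpow:
  assumes f: "log_lip L f" and a: "1/2 \<le> a" "a \<le> 1"
  shows "log_lip (2 * L * (3/4) ^ n) ((letter_op a ^^ n) f)"
proof (induction n rule: induct_nat_012)
  case 0
  show ?case using f log_lip_nonneg[OF f] by (auto elim: log_lip_weaken)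
next
  case 1
  show ?case using log_lip_letter_op[OF f, of a] a log_lip_nonneg[OF f] by (auto elim: log_lip_weaken)
next
  case (ge2 n)
  have "2 * L * (3/4) ^ n / 2 \<le> 2 * L * (3/4) ^ Suc (Suc n)"
    using mult_right_mono[of "1/2" "9/16" "2 * L * (3/4) ^ n"] log_lip_nonneg[OF f] by simp
  then show ?case
    using log_lip_letter_op2[OF ge2(1) a] by (auto elim: log_lip_weaken)
qed

context
  fixes a :: real
  assumes a: "1/2 \<le> a" "a \<le> 1"
begin

lemma funpow_letter_step:
  assumes f: "log_lip L f"
  shows "\<bar>(letter_op a ^^ Suc n) f 1 - (letter_op a ^^ n) f 1\<bar> \<le> 2 * L * ln 2 * (3/4) ^ n"
proof -
  let ?g = "(letter_op a ^^ n) f"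
  note g = log_lip_funpow[OF f a, of n]
  \<comment> \<open>The points 2 and 1/2 are the images of 1 under the two letters; both lie at
    logarithmic distance \<open>ln 2\<close> from it.\<close>
  have "\<bar>?g 2 - ?g 1\<bar> \<le> 2 * L * (3/4) ^ n * ln 2" "\<bar>?g (1/2) - ?g 1\<bar> \<le> 2 * L * (3/4) ^ n * ln 2"
    using log_lipD[OF g, of 2 1] log_lipD[OF g, of "1/2" 1] by (auto simp: ln_div)
  then have "\<bar>a * (?g 2 - ?g 1)\<bar> + \<bar>(1 - a) * (?g (1/2) - ?g 1)\<bar>
      \<le> a * (2 * L * (3/4) ^ n * ln 2) + (1 - a) * (2 * L * (3/4) ^ n * ln 2)"
    unfolding abs_mult using a by (intro add_mono mult_mono) auto
  moreover have "(letter_op a ^^ Suc n) f 1 - ?g 1 = a * (?g 2 - ?g 1) + (1 - a) * (?g (1/2) - ?g 1)"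
    by (simp add: letter_op_def algebra_simps)
  ultimately show ?thesis by (simp add: algebra_simps)
qed

lemma stat_LIMSEQ:
  assumes f: "log_lip L f"
  shows "(\<lambda>n. (letter_op a ^^ n) f 1) \<longlonglongrightarrow> stat a f"
    and stat_tail: "\<bar>stat a f - (letter_op a ^^ n) f 1\<bar> \<le> 8 * L * ln 2 * (3/4) ^ n"
proof -
  let ?s = "\<lambda>n. (letter_op a ^^ n) f 1"
  have step: "norm (?s (Suc n) - ?s n) \<le> 2 * L * ln 2 * (3/4) ^ n" for n
    using funpow_letter_step[OF f, of n] by simp
  have sumg: "summable (\<lambda>n. 2 * L * ln 2 * (3/4::real) ^ n)"
    by (intro summable_mult summable_geometric) simp
  have "summable (\<lambda>n. ?s (Suc n) - ?s n)"
    by (rule summable_comparison_test'[OF sumg, of 0]) (use step in auto)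
  then have "convergent (\<lambda>n. ?s n - ?s 0)"
    unfolding summable_iff_convergent sum_lessThan_telescope[of ?s] .
  then have "convergent (\<lambda>n. (?s n - ?s 0) + ?s 0)"
    by (intro convergent_add convergent_const)
  then have "convergent ?s" by simp
  then show L: "?s \<longlonglongrightarrow> stat a f" unfolding stat_def convergent_LIMSEQ_iff .
  \<comment> \<open>A geometric series of ratio 3/4 sums to 4 times its first term, which turns 2
    into 8. The subtracted \<open>(3/4) ^ m\<close> makes the induction close.\<close>
  have diff: "\<bar>?s m - ?s n\<bar> \<le> 8 * L * ln 2 * ((3/4) ^ n - (3/4) ^ m)" if "m \<ge> n" for m
    using that
  proof (induction m rule: dec_induct)
    case (step m)
    have "\<bar>?s (Suc m) - ?s n\<bar> \<le> \<bar>?s (Suc m) - ?s m\<bar> + \<bar>?s m - ?s n\<bar>" by linarith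
    also have "\<dots> \<le> 2 * L * ln 2 * (3/4) ^ m + 8 * L * ln 2 * ((3/4) ^ n - (3/4) ^ m)"
      using step.IH funpow_letter_step[OF f, of m] by (intro add_mono) auto
    finally show ?case by (simp add: algebra_simps)
  qed simp
  have "\<bar>?s m - ?s n\<bar> \<le> 8 * L * ln 2 * (3/4) ^ n" if "m \<ge> n" for m
  proof -
    have "8 * L * ln 2 * ((3/4) ^ n - (3/4) ^ m) \<le> 8 * L * ln 2 * (3/4::real) ^ n"
      using log_lip_nonneg[OF f] by (intro mult_left_mono) auto
    then show ?thesis using diff[OF that] by linarith
  qed
  moreover have "(\<lambda>m. \<bar>?s m - ?s n\<bar>) \<longlonglongrightarrow> \<bar>stat a f - ?s n\<bar>"
    by (intro tendsto_intros L)
  ultimately show "\<bar>stat a f - ?s n\<bar> \<le> 8 * L * ln 2 * (3/4) ^ n"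
    by (intro LIMSEQ_le_const2) auto
qed

end

section \<open>The stationary functional\<close>

definition log_lipschitz :: "(real \<Rightarrow> real) \<Rightarrow> bool" where
  "log_lipschitz f \<longleftrightarrow> (\<exists>L. log_lip L f)"

lemma log_lipschitzI: "log_lip L f \<Longrightarrow> log_lipschitz f"
  unfolding log_lipschitz_def by blast

lemma log_lipschitz_intros:
  "log_lipschitz (\<lambda>x. c)"
  "log_lipschitz ln"
  "log_lipschitz f \<Longrightarrow> log_lipschitz g \<Longrightarrow> log_lipschitz (\<lambda>x. f x + g x)"
  "log_lipschitz f \<Longrightarrow> log_lipschitz g \<Longrightarrow> log_lipschitz (\<lambda>x. f x - g x)"
  "log_lipschitz f \<Longrightarrow> log_lipschitz (\<lambda>x. c * f x)"
  "log_lipschitz f \<Longrightarrow> log_lipschitz (\<lambda>x. f (1 + 1 / x))"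
  "log_lipschitz f \<Longrightarrow> log_lipschitz (\<lambda>x. f (1 / (1 + x)))"
  unfolding log_lipschitz_def
  by (blast intro: log_lip_const log_lip_ln log_lip_add log_lip_diff log_lip_cmult log_lip_comp_letters)+

lemma log_lipschitz_ln_affine:
  assumes "0 \<le> a" "0 \<le> b" "0 < a + b"
  shows "log_lipschitz (\<lambda>x. ln (a + b * x))"
  using log_lip_ln_affine[OF assms] by (rule log_lipschitzI)

lemma funpow_letter_op_add:
  "(letter_op a ^^ n) (\<lambda>x. f x + g x) = (\<lambda>x. (letter_op a ^^ n) f x + (letter_op a ^^ n) g x)"
  by (induction n) (auto simp: letter_op_def fun_eq_iff algebra_simps)

lemma funpow_letter_op_cmult:
  "(letter_op a ^^ n) (\<lambda>x. c * f x) = (\<lambda>x. c * (letter_op a ^^ n) f x)"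
  by (induction n) (auto simp: letter_op_def fun_eq_iff algebra_simps)

lemma funpow_letter_op_const: "(letter_op a ^^ n) (\<lambda>x. c) = (\<lambda>x. c)"
  by (induction n) (auto simp: letter_op_def fun_eq_iff algebra_simps)

lemma funpow_letter_op_mono:
  assumes "0 \<le> a" "a \<le> 1" "\<And>x. 0 < x \<Longrightarrow> f x \<le> g x" "0 < x"
  shows "(letter_op a ^^ n) f x \<le> (letter_op a ^^ n) g x"
  using assms(4)
proof (induction n arbitrary: x)
  case (Suc n)
  then have "0 < 1 + 1/x" "0 < 1 / (1 + x)" by (simp_all add: add_pos_pos)
  then show ?case using Suc.IH assms(1,2)
    by (auto simp: letter_op_def intro!: add_mono mult_left_mono)
qed (use assms in simp)

context
  fixes a :: real
  assumes a: "1/2 \<le> a" "a \<le> 1"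
begin

lemma stat_lim: "log_lipschitz f \<Longrightarrow> (\<lambda>n. (letter_op a ^^ n) f 1) \<longlonglongrightarrow> stat a f"
  unfolding log_lipschitz_def using stat_LIMSEQ[OF a] by blast

lemma stat_near_1: "log_lip L f \<Longrightarrow> \<bar>stat a f - f 1\<bar> \<le> 8 * L * ln 2"
  using stat_tail[OF a, of L f 0] by simp

lemma stat_const: "stat a (\<lambda>x. c) = c"
  using stat_lim[of "\<lambda>x. c"] LIMSEQ_unique[OF _ tendsto_const, of "\<lambda>n. c"]
  by (auto simp: funpow_letter_op_const log_lipschitz_intros LIMSEQ_const_iff)

lemma stat_add:
  assumes "log_lipschitz f" "log_lipschitz g"
  shows "stat a (\<lambda>x. f x + g x) = stat a f + stat a g"
proof (rule LIMSEQ_unique)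
  show "(\<lambda>n. (letter_op a ^^ n) (\<lambda>x. f x + g x) 1) \<longlonglongrightarrow> stat a (\<lambda>x. f x + g x)"
    by (intro stat_lim log_lipschitz_intros assms)
  show "(\<lambda>n. (letter_op a ^^ n) (\<lambda>x. f x + g x) 1) \<longlonglongrightarrow> stat a f + stat a g"
    unfolding funpow_letter_op_add by (intro tendsto_add stat_lim assms)
qed

lemma stat_cmult:
  assumes "log_lipschitz f"
  shows "stat a (\<lambda>x. c * f x) = c * stat a f"
proof (rule LIMSEQ_unique)
  show "(\<lambda>n. (letter_op a ^^ n) (\<lambda>x. c * f x) 1) \<longlonglongrightarrow> stat a (\<lambda>x. c * f x)"
    by (intro stat_lim log_lipschitz_intros assms)
  show "(\<lambda>n. (letter_op a ^^ n) (\<lambda>x. c * f x) 1) \<longlonglongrightarrow> c * stat a f"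
    unfolding funpow_letter_op_cmult by (intro tendsto_mult_left stat_lim assms)
qed

lemma stat_diff:
  assumes "log_lipschitz f" "log_lipschitz g"
  shows "stat a (\<lambda>x. f x - g x) = stat a f - stat a g"
proof -
  have "stat a (\<lambda>x. f x + (-1) * g x) = stat a f + (-1) * stat a g"
    using assms by (simp only: stat_add stat_cmult log_lipschitz_intros)
  then show ?thesis by simp
qed

lemma stat_mono:
  assumes "log_lipschitz f" "log_lipschitz g" "\<And>x. 0 < x \<Longrightarrow> f x \<le> g x"
  shows "stat a f \<le> stat a g"
  using stat_lim[OF assms(1)] stat_lim[OF assms(2)]
  by (rule LIMSEQ_le) (use funpow_letter_op_mono[of a f g] a assms(3) in auto)

lemma stat_cong:
  assumes "log_lipschitz f" "log_lipschitz g" "\<And>x. 0 < x \<Longrightarrow> f x = g x"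
  shows "stat a f = stat a g"
  using assms by (intro antisym stat_mono) auto

lemma stat_ge: "log_lipschitz f \<Longrightarrow> (\<And>x. 0 < x \<Longrightarrow> c \<le> f x) \<Longrightarrow> c \<le> stat a f"
  using stat_mono[of "\<lambda>x. c" f] by (simp add: stat_const log_lipschitz_intros)

text \<open>Stationarity: the shifted sequence of iterates has the same limit, and its additional
  operator can be applied to \<open>f\<close> first. The identities between averages below rest on
  this.\<close>

lemma stat_step:
  assumes f: "log_lipschitz f"
  shows "stat a f = a * stat a (\<lambda>x. f (1 + 1 / x)) + (1 - a) * stat a (\<lambda>x. f (1 / (1 + x)))"
proof -
  have T: "letter_op a f = (\<lambda>x. a * f (1 + 1 / x) + (1 - a) * f (1 / (1 + x)))"
    by (simp add: letter_op_def fun_eq_iff)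
  have l: "log_lipschitz (letter_op a f)" unfolding T by (intro log_lipschitz_intros f)
  have "(\<lambda>n. (letter_op a ^^ Suc n) f 1) \<longlonglongrightarrow> stat a f"
    by (rule LIMSEQ_Suc[OF stat_lim[OF f]])
  moreover have "(\<lambda>n. (letter_op a ^^ Suc n) f 1) \<longlonglongrightarrow> stat a (letter_op a f)"
    using stat_lim[OF l] by (simp add: funpow_Suc_right del: funpow.simps)
  ultimately have "stat a f = stat a (letter_op a f)" by (rule LIMSEQ_unique)
  also have "\<dots> = a * stat a (\<lambda>x. f (1 + 1 / x)) + (1 - a) * stat a (\<lambda>x. f (1 / (1 + x)))"
    unfolding T by (simp only: stat_add stat_cmult log_lipschitz_intros f)
  finally show ?thesis .
qed

text \<open>A Lipschitz bound that is uniform in the averaged variable survives averaging. Double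
  averages such as \<open>pair_top\<close> need this, since the outer \<open>stat\<close> is applied
  to the result of the inner one.\<close>

lemma log_lip_stat:
  assumes "\<And>y. 0 < y \<Longrightarrow> log_lip L (\<lambda>x. f x y)" "\<And>x. 0 < x \<Longrightarrow> log_lipschitz (f x)"
  shows "log_lip L (\<lambda>x. stat a (f x))"
proof -
  have *: "stat a (f x) \<le> stat a (f x') + L * \<bar>ln x - ln x'\<bar>" if x: "0 < x" "0 < x'" for x x'
  proof -
    have "stat a (f x) \<le> stat a (\<lambda>y. f x' y + L * \<bar>ln x - ln x'\<bar>)"
    proof (intro stat_mono log_lipschitz_intros assms x)
      fix y :: real assume "0 < y"
      from log_lipD[OF assms(1)[OF this] x] show "f x y \<le> f x' y + L * \<bar>ln x - ln x'\<bar>" by linarith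
    qed
    also have "\<dots> = stat a (f x') + L * \<bar>ln x - ln x'\<bar>"
      using assms(2) x by (simp add: stat_add stat_const log_lipschitz_intros)
    finally show ?thesis .
  qed
  show ?thesis unfolding log_lip_def abs_le_iff
    using * by (fastforce simp: abs_minus_commute)
qed

lemma log_lipschitz_stat:
  assumes "\<And>y. 0 < y \<Longrightarrow> log_lip L (\<lambda>x. f x y)" "\<And>x. 0 < x \<Longrightarrow> log_lipschitz (f x)"
  shows "log_lipschitz (\<lambda>x. stat a (f x))"
  using log_lip_stat[OF assms] by (rule log_lipschitzI)

end

text \<open>Every iterate is a polynomial in \<open>a\<close>, and the geometric tail bound does not
  depend on \<open>a\<close>, so the convergence is uniform.\<close>

lemma continuous_on_stat:
  assumes f: "log_lipschitz f"
  shows "continuous_on {1/2..1} (\<lambda>a. stat a f)"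
proof (rule uniform_limit_theorem)
  have "continuous_on UNIV (\<lambda>a. (letter_op a ^^ n) f x)" for n x
    by (induction n arbitrary: x) (auto simp: letter_op_def intro!: continuous_intros)
  then show "\<forall>\<^sub>F n in sequentially. continuous_on {1/2..1} (\<lambda>a. (letter_op a ^^ n) f 1)"
    by (intro always_eventually allI) (rule continuous_on_subset, auto)
  obtain L where L: "log_lip L f" using f by (auto simp: log_lipschitz_def)
  show "uniform_limit {1/2..1} (\<lambda>n a. (letter_op a ^^ n) f 1) (\<lambda>a. stat a f) sequentially"
  proof (rule uniform_limitI)
    fix e :: real assume "e > 0"
    have "(\<lambda>n. 8 * L * ln 2 * (3/4::real) ^ n) \<longlonglongrightarrow> 8 * L * ln 2 * 0"
      by (intro tendsto_intros) simp
    then have "\<forall>\<^sub>F n in sequentially. 8 * L * ln 2 * (3/4::real) ^ n < e"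
      using \<open>e > 0\<close> by (intro order_tendstoD) auto
    then show "\<forall>\<^sub>F n in sequentially. \<forall>a\<in>{1/2..1}. dist ((letter_op a ^^ n) f 1) (stat a f) < e"
    proof eventually_elim
      case (elim n)
      show ?case
      proof
        fix a :: real assume "a \<in> {1/2..1}"
        then show "dist ((letter_op a ^^ n) f 1) (stat a f) < e"
          using stat_tail[of a, OF _ _ L, of n] elim by (simp add: dist_real_def abs_minus_commute)
      qed
    qed
  qed
qed simp

section \<open>The golden ratio and the parameter \<open>a = 1\<close>\<close>

definition golden :: real where "golden = (1 + sqrt 5) / 2"

lemma golden: "golden > 0" "golden\<^sup>2 = golden + 1" "1 + 1 / golden = golden"
proof -
  show pos: "golden > 0" by (simp add: golden_def add_pos_pos)
  show "golden\<^sup>2 = golden + 1" by (simp add: golden_def power2_eq_square field_simps)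
  then show "1 + 1 / golden = golden" using pos by (simp add: field_simps power2_eq_square)
qed

text \<open>Only the letter A occurs at this parameter, and \<open>golden\<close> is its fixed
  point. The iterates evaluated at 1 and at \<open>golden\<close> merge by contraction.\<close>

lemma stat_one: 
  assumes "log_lipschitz f"
  shows "stat 1 f = f golden"
proof -
  obtain L where L: "log_lip L f" using assms by (auto simp: log_lipschitz_def)
  have gold: "(letter_op 1 ^^ n) f golden = f golden" for n
    by (induction n) (simp_all add: letter_op_def golden(3))
  have "(\<lambda>n. (letter_op 1 ^^ n) f 1 - f golden) \<longlonglongrightarrow> 0"
  proof (rule Lim_null_comparison)
    have "norm ((letter_op 1 ^^ n) f 1 - f golden) \<le> 2 * L * (3/4) ^ n * \<bar>ln 1 - ln golden\<bar>" for n
      using log_lipD[OF log_lip_funpow[OF L, of 1 n], of 1 golden] golden(1) gold[of n] by simp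
    then show "\<forall>\<^sub>F n in sequentially. norm ((letter_op 1 ^^ n) f 1 - f golden)
        \<le> 2 * L * (3/4) ^ n * \<bar>ln 1 - ln golden\<bar>" by simp
    have "(\<lambda>n. 2 * L * (3/4::real) ^ n * \<bar>ln 1 - ln golden\<bar>) \<longlonglongrightarrow> 2 * L * 0 * \<bar>ln 1 - ln golden\<bar>"
      by (intro tendsto_intros) simp
    then show "(\<lambda>n. 2 * L * (3/4::real) ^ n * \<bar>ln 1 - ln golden\<bar>) \<longlonglongrightarrow> 0" by simp
  qed
  then have "(\<lambda>n. (letter_op 1 ^^ n) f 1) \<longlonglongrightarrow> f golden" by (simp add: LIM_zero_iff)
  moreover have "(\<lambda>n. (letter_op 1 ^^ n) f 1) \<longlonglongrightarrow> stat 1 f"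
    using stat_lim[of 1] assms by simp
  ultimately show ?thesis by (rule LIMSEQ_unique[symmetric])
qed

section \<open>The Lyapunov exponent\<close>

definition mean_ln :: "real \<Rightarrow> real" where
  "mean_ln a = stat a ln"

definition mean_ln1 :: "real \<Rightarrow> real" where
  "mean_ln1 a = stat a (\<lambda>x. ln (1 + x))"

text \<open>The letters send the vector \<open>(1, x)\<close> to \<open>(x, 1 + x)\<close> and
  \<open>(1 + x, 1)\<close>. Renormalising the first entry to 1 divides by \<open>x\<close> or by
  \<open>1 + x\<close>; the mean logarithm of this factor is the Lyapunov exponent.\<close>

definition lyap :: "real \<Rightarrow> real" where
  "lyap a = a * mean_ln a + (1 - a) * mean_ln1 a"

lemma log_lipschitz_ln1: "log_lipschitz (\<lambda>x. ln (1 + x))"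
  using log_lipschitz_ln_affine[of 1 1] by simp

lemma denom_pos: "0 < 1 - a + (a::real)\<^sup>2"
proof -
  have "1 - a + a\<^sup>2 = (a - 1/2)\<^sup>2 + 3/4" by (simp add: power2_eq_square algebra_simps)
  also have "0 < \<dots>" by (simp add: add_nonneg_pos)
  finally show ?thesis .
qed

lemma convex_comb_mono:
  fixes c :: real
  assumes "0 \<le> c" "c \<le> 1" "u \<le> p" "v \<le> q"
  shows "c * u + (1 - c) * v \<le> c * p + (1 - c) * q"
  using assms by (intro add_mono mult_left_mono) auto

context
  fixes a :: real
  assumes a: "1/2 \<le> a" "a \<le> 1"
begin

text \<open>Stationarity applied to \<open>ln\<close> itself. By \<open>ln_letters\<close> the
  images involve only \<open>ln x\<close> and \<open>ln (1 + x)\<close>, so the equation closes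
  up.\<close>

lemma mean_ln_mean_ln1: "(1 + a) * mean_ln a = (2 * a - 1) * mean_ln1 a"
proof -
  have "mean_ln a = a * stat a (\<lambda>x. ln (1 + 1 / x)) + (1 - a) * stat a (\<lambda>x. ln (1 / (1 + x)))"
    unfolding mean_ln_def by (intro stat_step a log_lipschitz_intros)
  also have "stat a (\<lambda>x. ln (1 + 1 / x)) = stat a (\<lambda>x. ln (1 + x) - ln x)"
    by (intro stat_cong a log_lipschitz_intros log_lipschitz_ln1 ln_letters)
  also have "\<dots> = mean_ln1 a - mean_ln a"
    unfolding mean_ln_def mean_ln1_def by (intro stat_diff a log_lipschitz_intros log_lipschitz_ln1)
  also have "stat a (\<lambda>x. ln (1 / (1 + x))) = stat a (\<lambda>x. (-1) * ln (1 + x))"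
    by (intro stat_cong a log_lipschitz_intros log_lipschitz_ln1) (simp add: ln_letters)
  also have "\<dots> = (-1) * mean_ln1 a"
    unfolding mean_ln1_def by (intro stat_cmult a log_lipschitz_ln1)
  finally show ?thesis by (simp add: algebra_simps)
qed

lemma lyap_mean_ln1: "(1 + a) * lyap a = (1 - a + a\<^sup>2) * mean_ln1 a"
proof -
  have "(1 + a) * lyap a = a * ((1 + a) * mean_ln a) + (1 - a) * (1 + a) * mean_ln1 a"
    by (simp add: lyap_def algebra_simps)
  then show ?thesis unfolding mean_ln_mean_ln1 by (simp add: algebra_simps power2_eq_square)
qed

lemma mean_ln_lyap: "(1 - a + a\<^sup>2) * mean_ln a = (2 * a - 1) * lyap a"
proof -
  have "(1 + a) * ((1 - a + a\<^sup>2) * mean_ln a) = (1 - a + a\<^sup>2) * ((2 * a - 1) * mean_ln1 a)"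
    unfolding mean_ln_mean_ln1[symmetric] by simp
  also have "\<dots> = (2 * a - 1) * ((1 + a) * lyap a)"
    unfolding lyap_mean_ln1 by simp
  also have "\<dots> = (1 + a) * ((2 * a - 1) * lyap a)" by simp
  finally show ?thesis using a by simp
qed

text \<open>After the letter A the variable exceeds 1, and after the letter B the logarithm is still
  nonnegative.\<close>

lemma mean_ln1_ge: "a * ln 2 \<le> mean_ln1 a"
proof -
  have "mean_ln1 a = a * stat a (\<lambda>x. ln (1 + (1 + 1 / x))) + (1 - a) * stat a (\<lambda>x. ln (1 + 1 / (1 + x)))"
    unfolding mean_ln1_def by (rule stat_step[OF a log_lipschitz_ln1])
  moreover have "ln 2 \<le> stat a (\<lambda>x. ln (1 + (1 + 1 / x)))"
    by (intro stat_ge a log_lipschitz_intros(6)[OF log_lipschitz_ln1] ln_mono) auto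
  moreover have "0 \<le> stat a (\<lambda>x. ln (1 + 1 / (1 + x)))"
    by (intro stat_ge a log_lipschitz_intros(7)[OF log_lipschitz_ln1]) simp
  ultimately show ?thesis using a convex_comb_mono[of a "ln 2" _ 0] by simp
qed

lemma mean_ln1_pos: "0 < mean_ln1 a"
proof -
  have "0 < a * ln 2" using a by simp
  then show ?thesis using mean_ln1_ge by linarith
qed

lemma lyap_pos: "0 < lyap a"
proof -
  have "0 < (1 + a) * lyap a"
    unfolding lyap_mean_ln1 using denom_pos mean_ln1_pos by simp
  then show ?thesis using a by (simp add: zero_less_mult_iff)
qed

end

text \<open>The arguments \<open>x + y + x y\<close> here and \<open>1 + x + y\<close> in
  \<open>pair_bot\<close> are the inner products of \<open>(1, y)\<close> with the images of
  \<open>(1, x)\<close> under A and B.\<close>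

definition pair_top :: "real \<Rightarrow> real \<Rightarrow> real" where
  "pair_top a b = stat a (\<lambda>x. stat b (\<lambda>y. ln (x + y + x * y)))"

definition pair_bot :: "real \<Rightarrow> real \<Rightarrow> real" where
  "pair_bot a b = stat a (\<lambda>x. stat b (\<lambda>y. ln (1 + x + y)))"

lemma log_lip_top: "0 < x \<Longrightarrow> log_lip 1 (\<lambda>y. ln (x + y + x * y))" "0 < y \<Longrightarrow> log_lip 1 (\<lambda>x. ln (x + y + x * y))"
  using log_lip_ln_affine[of x "1 + x"] log_lip_ln_affine[of y "1 + y"] by (simp_all add: algebra_simps)

lemma log_lip_bot: "0 < x \<Longrightarrow> log_lip 1 (\<lambda>y. ln (1 + x + y))" "0 < y \<Longrightarrow> log_lip 1 (\<lambda>x. ln (1 + x + y))"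
  using log_lip_ln_affine[of "1 + x" "1"] log_lip_ln_affine[of "1 + y" "1"] by (simp_all add: algebra_simps)

lemma log_lip_inner: "0 < x \<Longrightarrow> log_lip 1 (\<lambda>y. ln (1 + x * y))" "0 < y \<Longrightarrow> log_lip 1 (\<lambda>x. ln (1 + x * y))"
  using log_lip_ln_affine[of 1 x] log_lip_ln_affine[of 1 y] by (simp_all add: algebra_simps)

lemmas log_lipschitz_tb = log_lip_top[THEN log_lipschitzI] log_lip_bot[THEN log_lipschitzI]
  log_lip_inner[THEN log_lipschitzI]

text \<open>The letters act by symmetric matrices on directions \<open>(1, x)\<close>, so one step in either
  variable of \<open>ln (1 + x y)\<close>, the logarithm of an inner product, produces the same two
  functions.\<close>

lemma lyap_diff:
  assumes a: "1/2 \<le> a" "a \<le> 1" and b: "1/2 \<le> b" "b \<le> 1"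
  shows "lyap b - lyap a = (b - a) * (pair_top a b - pair_bot a b)"
proof -
  define k where "k = stat a (\<lambda>x. stat b (\<lambda>y. ln (1 + x * y)))"
  have llk: "log_lipschitz (\<lambda>x. stat b (\<lambda>y. ln (1 + x * y)))"
    by (rule log_lipschitz_stat[OF b log_lip_inner(2) log_lipschitz_tb(5)])
  have llt: "log_lipschitz (\<lambda>x. stat b (\<lambda>y. ln (x + y + x * y)))"
    by (rule log_lipschitz_stat[OF b log_lip_top(2) log_lipschitz_tb(1)])
  have llb: "log_lipschitz (\<lambda>x. stat b (\<lambda>y. ln (1 + x + y)))"
    by (rule log_lipschitz_stat[OF b log_lip_bot(2) log_lipschitz_tb(3)])
  have topx: "stat b (\<lambda>y. ln (1 + (1 + 1/x) * y)) = stat b (\<lambda>y. ln (x + y + x * y)) - ln x"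
    if x: "0 < x" for x
  proof -
    have "stat b (\<lambda>y. ln (1 + (1 + 1/x) * y)) = stat b (\<lambda>y. ln (x + y + x * y) - ln x)"
    proof (intro stat_cong b log_lipschitz_intros log_lipschitz_tb x)
      fix y :: real assume y: "0 < y"
      have "1 + (1 + 1/x) * y = (x + y + x * y) / x" using x by (simp add: field_simps)
      moreover have "0 < x + y + x * y" using x y by (simp add: add_pos_pos)
      ultimately show "ln (1 + (1 + 1/x) * y) = ln (x + y + x * y) - ln x"
        using x y by (simp add: ln_div)
    qed (use x in \<open>simp add: add_pos_pos\<close>)
    then show ?thesis using x by (simp add: stat_diff[OF b] stat_const[OF b] log_lipschitz_intros log_lipschitz_tb)
  qed
  have botx: "stat b (\<lambda>y. ln (1 + (1/(1+x)) * y)) = stat b (\<lambda>y. ln (1 + x + y)) - ln (1 + x)"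
    if x: "0 < x" for x
  proof -
    have "stat b (\<lambda>y. ln (1 + (1/(1+x)) * y)) = stat b (\<lambda>y. ln (1 + x + y) - ln (1 + x))"
    proof (intro stat_cong b log_lipschitz_intros log_lipschitz_tb x)
      fix y :: real assume y: "0 < y"
      have "1 + (1/(1+x)) * y = (1 + x + y) / (1 + x)" using x by (simp add: field_simps)
      then show "ln (1 + (1/(1+x)) * y) = ln (1 + x + y) - ln (1 + x)"
        using x y by (simp add: ln_div add_pos_pos)
    qed (use x in \<open>simp add: add_pos_pos\<close>)
    then show ?thesis using x by (simp add: stat_diff[OF b] stat_const[OF b] log_lipschitz_intros log_lipschitz_tb)
  qed
  \<comment> \<open>First evaluation of \<open>k\<close>, by one step in \<open>x\<close>. The
    logarithms split off by renormalisation add up to \<open>lyap a\<close>.\<close>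
  have "k = a * stat a (\<lambda>x. stat b (\<lambda>y. ln (1 + (1 + 1/x) * y)))
      + (1 - a) * stat a (\<lambda>x. stat b (\<lambda>y. ln (1 + (1/(1+x)) * y)))"
    unfolding k_def by (rule stat_step[OF a llk])
  also have "stat a (\<lambda>x. stat b (\<lambda>y. ln (1 + (1 + 1/x) * y)))
      = stat a (\<lambda>x. stat b (\<lambda>y. ln (x + y + x * y)) - ln x)"
    by (intro stat_cong[OF a] log_lipschitz_intros(6)[OF llk] log_lipschitz_intros(4)[OF llt log_lipschitz_intros(2)] topx)
  also have "\<dots> = pair_top a b - mean_ln a"
    unfolding pair_top_def mean_ln_def by (rule stat_diff[OF a llt log_lipschitz_intros(2)])
  also have "stat a (\<lambda>x. stat b (\<lambda>y. ln (1 + (1/(1+x)) * y)))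
      = stat a (\<lambda>x. stat b (\<lambda>y. ln (1 + x + y)) - ln (1 + x))"
    by (intro stat_cong[OF a] log_lipschitz_intros(7)[OF llk] log_lipschitz_intros(4)[OF llb log_lipschitz_ln1] botx)
  also have "\<dots> = pair_bot a b - mean_ln1 a"
    unfolding pair_bot_def mean_ln1_def by (rule stat_diff[OF a llb log_lipschitz_ln1])
  finally have 1: "k = a * pair_top a b + (1 - a) * pair_bot a b - lyap a"
    by (simp add: lyap_def algebra_simps)
  \<comment> \<open>Second evaluation, by one step in \<open>y\<close> for fixed \<open>x\<close>.
    Comparison of the two evaluations eliminates \<open>k\<close>.\<close>
  have inner: "stat b (\<lambda>y. ln (1 + x * y)) = b * stat b (\<lambda>y. ln (x + y + x * y))
      + (1 - b) * stat b (\<lambda>y. ln (1 + x + y)) - lyap b" if x: "0 < x" for x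
  proof -
    have "stat b (\<lambda>y. ln (1 + x * y)) = b * stat b (\<lambda>y. ln (1 + x * (1 + 1/y)))
        + (1 - b) * stat b (\<lambda>y. ln (1 + x * (1/(1+y))))"
      by (rule stat_step[OF b log_lipschitz_tb(5)[OF x]])
    also have "stat b (\<lambda>y. ln (1 + x * (1 + 1/y))) = stat b (\<lambda>y. ln (x + y + x * y) - ln y)"
    proof (rule stat_cong[OF b])
      show "log_lipschitz (\<lambda>y. ln (1 + x * (1 + 1/y)))"
        by (rule log_lipschitz_intros(6)[OF log_lipschitz_tb(5)[OF x]])
      fix y :: real assume y: "0 < y"
      have "1 + x * (1 + 1/y) = (x + y + x * y) / y" using y by (simp add: field_simps)
      moreover have "0 < x + y + x * y" using x y by (simp add: add_pos_pos)
      ultimately show "ln (1 + x * (1 + 1/y)) = ln (x + y + x * y) - ln y"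
        using x y by (simp add: ln_div)
    qed (intro log_lipschitz_intros log_lipschitz_tb x)
    also have "\<dots> = stat b (\<lambda>y. ln (x + y + x * y)) - mean_ln b"
      unfolding mean_ln_def by (intro stat_diff[OF b] log_lipschitz_intros log_lipschitz_tb x)
    also have "stat b (\<lambda>y. ln (1 + x * (1/(1+y)))) = stat b (\<lambda>y. ln (1 + x + y) - ln (1 + y))"
    proof (rule stat_cong[OF b])
      show "log_lipschitz (\<lambda>y. ln (1 + x * (1/(1+y))))"
        by (rule log_lipschitz_intros(7)[OF log_lipschitz_tb(5)[OF x]])
      fix y :: real assume y: "0 < y"
      have "1 + x * (1/(1+y)) = (1 + x + y) / (1 + y)" using y by (simp add: field_simps)
      then show "ln (1 + x * (1/(1+y))) = ln (1 + x + y) - ln (1 + y)"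
        using x y by (simp add: ln_div add_pos_pos)
    qed (intro log_lipschitz_intros log_lipschitz_tb log_lipschitz_ln1 x)
    also have "\<dots> = stat b (\<lambda>y. ln (1 + x + y)) - mean_ln1 b"
      unfolding mean_ln1_def by (intro stat_diff[OF b] log_lipschitz_ln1 log_lipschitz_tb x)
    finally show ?thesis by (simp add: lyap_def algebra_simps)
  qed
  have "k = stat a (\<lambda>x. b * stat b (\<lambda>y. ln (x + y + x * y))
      + (1 - b) * stat b (\<lambda>y. ln (1 + x + y)) - lyap b)"
    unfolding k_def by (intro stat_cong[OF a] inner log_lipschitz_intros(1,3-5) llk llt llb)
  also have "\<dots> = b * pair_top a b + (1 - b) * pair_bot a b - lyap b"
    unfolding pair_top_def pair_bot_def
    by (simp add: stat_diff[OF a] stat_add[OF a] stat_cmult[OF a] stat_const[OF a]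
          log_lipschitz_intros(1,3-5) llt llb)
  finally show ?thesis using 1 by (simp add: algebra_simps)
qed

text \<open>The last letter applied to each variable decides. Two letters A make both variables
  exceed 1 and the logarithm nonnegative; a single letter A costs at most \<open>ln 2\<close>; two
  letters B cost at most \<open>ln 2 + ln (1 + y)\<close>. The cost \<open>ln 2\<close> thus carries
  the total weight \<open>1 - a b\<close>.\<close>

lemma pair_diff_ge:
  assumes a: "1/2 \<le> a" "a \<le> 1" and b: "1/2 \<le> b" "b \<le> 1"
  shows "- ((1 - a * b) * ln 2 + (1 - a) * (1 - b) * mean_ln1 b) \<le> pair_top a b - pair_bot a b"
proof -
  define h where "h = (\<lambda>x y. ln (x + y + x * y) - ln (1 + x + y :: real))"
  define H where "H = (\<lambda>x. stat b (h x))"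
  have llh: "log_lipschitz (h x)" if "0 < x" for x
    unfolding h_def by (intro log_lipschitz_intros log_lipschitz_tb that)
  have llh': "log_lip (1 + 1) (\<lambda>x. h x y)" if "0 < y" for y
    unfolding h_def by (intro log_lip_diff log_lip_top log_lip_bot that)
  have llH: "log_lipschitz H" unfolding H_def by (rule log_lipschitz_stat[OF b llh' llh])
  have llt: "log_lipschitz (\<lambda>x. stat b (\<lambda>y. ln (x + y + x * y)))"
    by (rule log_lipschitz_stat[OF b log_lip_top(2) log_lipschitz_tb(1)])
  have llb: "log_lipschitz (\<lambda>x. stat b (\<lambda>y. ln (1 + x + y)))"
    by (rule log_lipschitz_stat[OF b log_lip_bot(2) log_lipschitz_tb(3)])
  have "stat a H = stat a (\<lambda>x. stat b (\<lambda>y. ln (x + y + x * y)) - stat b (\<lambda>y. ln (1 + x + y)))"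
    unfolding H_def h_def
    by (rule stat_cong[OF a llH[unfolded H_def h_def] log_lipschitz_intros(4)[OF llt llb]])
      (intro stat_diff[OF b] log_lipschitz_tb)
  also have "\<dots> = pair_top a b - pair_bot a b"
    unfolding pair_top_def pair_bot_def by (rule stat_diff[OF a llt llb])
  finally have eq: "pair_top a b - pair_bot a b = stat a H" by simp
  have ge: "ln (1/c) \<le> h x y" if "0 < x" "0 < y" "0 < c" "1 + x + y \<le> c * (x + y + x * y)" for x y c
  proof -
    have p: "0 < 1 + x + y" "0 < x + y + x * y" using that by (simp_all add: add_pos_pos)
    have "ln (1 + x + y) \<le> ln (c * (x + y + x * y))" using that p by (intro ln_mono) auto
    then show ?thesis using that p by (simp add: h_def ln_mult ln_div)
  qed
  have A: "- ((1 - b) * ln 2) \<le> H (1 + 1/x)" if x: "0 < x" for x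
  proof -
    have p: "0 < 1 + 1/x" using x by (simp add: add_pos_pos)
    have "H (1 + 1/x) = b * stat b (\<lambda>y. h (1 + 1/x) (1 + 1/y)) + (1 - b) * stat b (\<lambda>y. h (1 + 1/x) (1/(1+y)))"
      unfolding H_def by (rule stat_step[OF b llh[OF p]])
    moreover have "0 \<le> stat b (\<lambda>y. h (1 + 1/x) (1 + 1/y))"
    proof (rule stat_ge[OF b])
      show "log_lipschitz (\<lambda>y. h (1 + 1/x) (1 + 1/y))" by (rule log_lipschitz_intros(6)[OF llh[OF p]])
      fix y :: real assume "0 < y"
      have "1 + X + Y \<le> 1 * (X + Y + X * Y)" if "1 \<le> X" "1 \<le> Y" for X Y :: real
        using mult_mono[of 1 X 1 Y] that by simp
      from this[of "1 + 1/x" "1 + 1/y"] show "0 \<le> h (1 + 1/x) (1 + 1/y)"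
        using ge[of "1 + 1/x" "1 + 1/y" 1] x \<open>0 < y\<close> by (simp add: add_pos_pos)
    qed
    moreover have "- ln 2 \<le> stat b (\<lambda>y. h (1 + 1/x) (1/(1+y)))"
    proof (rule stat_ge[OF b])
      show "log_lipschitz (\<lambda>y. h (1 + 1/x) (1/(1+y)))" by (rule log_lipschitz_intros(7)[OF llh[OF p]])
      fix y :: real assume y: "0 < y"
      have "1 + X + Y \<le> 2 * (X + Y + X * Y)" if "X \<ge> 1" "Y > 0" for X Y :: real
        using that mult_pos_pos[of X Y] unfolding distrib_left by linarith
      from this[of "1 + 1/x" "1/(1+y)"] show "- ln 2 \<le> h (1 + 1/x) (1/(1+y))"
        using ge[of "1 + 1/x" "1/(1+y)" 2] x y by (simp add: add_pos_pos ln_div)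
    qed
    ultimately show ?thesis using b convex_comb_mono[of b 0 _ "- ln 2"] by simp
  qed
  have B: "- ln 2 - (1 - b) * mean_ln1 b \<le> H (1/(1+x))" if x: "0 < x" for x
  proof -
    have p: "0 < 1/(1+x)" using x by simp
    have "H (1/(1+x)) = b * stat b (\<lambda>y. h (1/(1+x)) (1 + 1/y)) + (1 - b) * stat b (\<lambda>y. h (1/(1+x)) (1/(1+y)))"
      unfolding H_def by (rule stat_step[OF b llh[OF p]])
    moreover have "- ln 2 \<le> stat b (\<lambda>y. h (1/(1+x)) (1 + 1/y))"
    proof (rule stat_ge[OF b])
      show "log_lipschitz (\<lambda>y. h (1/(1+x)) (1 + 1/y))" by (rule log_lipschitz_intros(6)[OF llh[OF p]])
      fix y :: real assume y: "0 < y"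
      have "1 + X + Y \<le> 2 * (X + Y + X * Y)" if "Y \<ge> 1" "X > 0" for X Y :: real
        using that mult_pos_pos[of X Y] unfolding distrib_left by linarith
      from this[of "1 + 1/y" "1/(1+x)"] show "- ln 2 \<le> h (1/(1+x)) (1 + 1/y)"
        using ge[of "1/(1+x)" "1 + 1/y" 2] x y by (simp add: add_pos_pos ln_div)
    qed
    moreover have "- ln 2 - mean_ln1 b \<le> stat b (\<lambda>y. h (1/(1+x)) (1/(1+y)))"
    proof -
      have "stat b (\<lambda>y. - ln 2 - ln (1 + y)) \<le> stat b (\<lambda>y. h (1/(1+x)) (1/(1+y)))"
      proof (intro stat_mono[OF b] log_lipschitz_intros(7)[OF llh[OF p]] log_lipschitz_intros log_lipschitz_ln1)
        fix y :: real assume y: "0 < y"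
        \<comment> \<open>Here \<open>Y\<close> is the reciprocal of \<open>1 + y\<close>, so the
          factor \<open>1 + y\<close> restores a term of order 1 on the right-hand side.\<close>
        have "1 + X + Y \<le> 2 * (1 + y) * (X + Y + X * Y)" if "0 < X" "X \<le> 1" "(1 + y) * Y = 1" "Y > 0" for X Y
        proof -
          have "2 * (1 + y) * (X + Y + X * Y) = 2 * (1 + y) * X + 2 * (1 + X) * ((1 + y) * Y)"
            by (simp add: algebra_simps)
          moreover have "Y \<le> 1" using that mult_pos_pos[of y Y] y unfolding distrib_right by linarith
          moreover have "0 \<le> 2 * (1 + y) * X" using that y by simp
          ultimately show ?thesis using that by simp
        qed
        from this[of "1/(1+x)" "1/(1+y)"] show "- ln 2 - ln (1 + y) \<le> h (1/(1+x)) (1/(1+y))"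
          using ge[of "1/(1+x)" "1/(1+y)" "2 * (1 + y)"] x y
          by (simp add: add_pos_pos ln_div ln_mult del: distrib_left_numeral)
      qed
      then show ?thesis
        by (simp add: stat_diff[OF b] stat_const[OF b] log_lipschitz_intros log_lipschitz_ln1 mean_ln1_def)
    qed
    ultimately have "b * (- ln 2) + (1 - b) * (- ln 2 - mean_ln1 b) \<le> H (1/(1+x))"
      using b convex_comb_mono[of b "- ln 2" _ "- ln 2 - mean_ln1 b"] by simp
    then show ?thesis by (simp add: algebra_simps)
  qed
  have "stat a H = a * stat a (\<lambda>x. H (1 + 1/x)) + (1 - a) * stat a (\<lambda>x. H (1/(1+x)))"
    by (rule stat_step[OF a llH])
  moreover have "- ((1 - b) * ln 2) \<le> stat a (\<lambda>x. H (1 + 1/x))"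
    by (intro stat_ge[OF a] log_lipschitz_intros(6)[OF llH] A)
  moreover have "- ln 2 - (1 - b) * mean_ln1 b \<le> stat a (\<lambda>x. H (1/(1+x)))"
    by (intro stat_ge[OF a] log_lipschitz_intros(7)[OF llH] B)
  ultimately have "a * (- ((1 - b) * ln 2)) + (1 - a) * (- ln 2 - (1 - b) * mean_ln1 b) \<le> stat a H"
    using a convex_comb_mono[of a "- ((1 - b) * ln 2)" _ "- ln 2 - (1 - b) * mean_ln1 b"] by simp
  then show ?thesis unfolding eq by (simp add: algebra_simps)
qed

text \<open>\<open>mean_ln_lyap\<close> reduces the claim to \<open>lyap\<close> with explicit
  factors. The factors gain by the identity \<open>(2 b - 1) (1 - a + a^2) - (2 a - 1) (1 - b + b^2)
  = (b - a) (1 + a + b - 2 a b)\<close>, whereas \<open>lyap\<close> can drop by at most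
  \<open>(b - a) R\<close>. The inequality \<open>key\<close> says that the gain outweighs the
  drop.\<close>

lemma mean_ln_strict_mono:
  assumes ab: "1/2 \<le> a" "a < b" "b \<le> 1"
  shows "mean_ln a < mean_ln b"
proof -
  have a: "1/2 \<le> a" "a \<le> 1" and b: "1/2 \<le> b" "b \<le> 1" using ab by auto
  define J where "J = mean_ln1 b"
  define R where "R = (1 - a * b) * ln 2 + (1 - a) * (1 - b) * J"
  have J: "b * ln 2 \<le> J" "0 < J" using mean_ln1_ge[OF b] mean_ln1_pos[OF b] by (simp_all add: J_def)
  have "lyap a - lyap b \<le> (b - a) * R"
  proof -
    have "(b - a) * (- R) \<le> (b - a) * (pair_top a b - pair_bot a b)"
      using pair_diff_ge[OF a b] ab by (intro mult_left_mono) (auto simp: R_def J_def)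
    then show ?thesis using lyap_diff[OF a b] by simp
  qed
  then have La: "(2 * a - 1) * lyap a \<le> (2 * a - 1) * (lyap b + (b - a) * R)"
    using a by (intro mult_left_mono) auto
  \<comment> \<open>The part of \<open>R\<close> with \<open>J\<close> is moved to the right, where
    at least \<open>1 - 3/32\<close>, hence \<open>9/10\<close>, of \<open>J\<close> remains. The
    part with \<open>ln 2\<close> is then absorbed through \<open>b * ln 2 \<le> J\<close>, with a
    strict margin from \<open>c2\<close>.\<close>
  have key: "(1 + b) * (2 * a - 1) * R < (1 + a + b - 2 * a * b) * J"
  proof -
    have u: "(2 * a - 1) * (1 - a) \<le> 1/8"
      using zero_le_power2[of "4 * a - 3"] by (simp add: power2_eq_square algebra_simps)
    have "1 - b\<^sup>2 \<le> 3/4" using power_mono[of "1/2" b 2] b by (simp add: power2_eq_square)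
    then have "(1 - b\<^sup>2) * ((2 * a - 1) * (1 - a)) \<le> 3/4 * (1/8)"
      using u a b by (intro mult_mono) (auto simp: power_le_one)
    moreover have "1 \<le> 1 + a + b - 2 * a * b"
    proof -
      have "0 \<le> a * (1 - b) + b * (1 - a)" using a b by (intro add_nonneg_nonneg mult_nonneg_nonneg) auto
      then show ?thesis by (simp add: algebra_simps)
    qed
    ultimately have c1: "9/10 \<le> (1 + a + b - 2 * a * b) - (1 + b) * (2 * a - 1) * ((1 - a) * (1 - b))"
      by (simp add: algebra_simps power2_eq_square)
    have "(1 + b) * (2 * a - 1) * (1 - a * b) = (1 + b) * ((2 * a - 1) * (1 - a * b))"
      by simp
    also have "\<dots> \<le> (1 + b) * ((2 * a - 1) * (1 - a * a))"
      using a b ab by (intro mult_left_mono) auto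
    also have "\<dots> \<le> (1 + b) * (1/4)"
    proof (rule mult_left_mono)
      \<comment> \<open>A certificate for the cubic bound: a square centred at 3/4, close to the
        maximum, plus a linear remainder.\<close>
      have "0 \<le> (a - 3/4)\<^sup>2 * (2 * a + 2) + (1 - a) / 8" using a by simp
      also have "\<dots> = 1/4 - (2 * a - 1) * (1 - a * a)"
        by (simp add: power2_eq_square field_simps)
      finally show "(2 * a - 1) * (1 - a * a) \<le> 1/4" by simp
    qed (use b in simp)
    also have "\<dots> < 9/10 * b" using b by simp
    finally have c2: "(1 + b) * (2 * a - 1) * (1 - a * b) < 9/10 * b" .
    have "(1 + b) * (2 * a - 1) * (1 - a * b) * ln 2 < 9/10 * b * ln 2"
      using c2 by (intro mult_strict_right_mono) auto
    also have "\<dots> \<le> 9/10 * J" using J by simp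
    also have "\<dots> \<le> ((1 + a + b - 2 * a * b) - (1 + b) * (2 * a - 1) * ((1 - a) * (1 - b))) * J"
      using c1 J by (intro mult_right_mono) auto
    finally show ?thesis unfolding R_def by (simp add: algebra_simps)
  qed
  have "(1 + b) * ((1 - a + a\<^sup>2) * (1 - b + b\<^sup>2) * mean_ln a)
      = (1 + b) * (1 - b + b\<^sup>2) * ((2 * a - 1) * lyap a)"
    unfolding mean_ln_lyap[OF a, symmetric] by simp
  also have "\<dots> \<le> (1 + b) * (1 - b + b\<^sup>2) * ((2 * a - 1) * (lyap b + (b - a) * R))"
    using b denom_pos[of b] by (intro mult_left_mono[OF La]) simp
  also have "\<dots> = (1 - b + b\<^sup>2) * ((2 * a - 1) * ((1 + b) * lyap b) + (b - a) * ((1 + b) * (2 * a - 1) * R))"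
    by (simp add: algebra_simps)
  also have "\<dots> < (1 - b + b\<^sup>2) * ((2 * a - 1) * ((1 + b) * lyap b) + (b - a) * ((1 + a + b - 2 * a * b) * J))"
    using key ab denom_pos[of b] by (intro mult_strict_left_mono add_strict_left_mono) auto
  also have "\<dots> = (1 - b + b\<^sup>2) * ((1 - a + a\<^sup>2) * ((2 * b - 1) * J))"
    unfolding lyap_mean_ln1[OF b] J_def by (simp add: algebra_simps power2_eq_square)
  also have "\<dots> = (1 + b) * ((1 - a + a\<^sup>2) * (1 - b + b\<^sup>2) * mean_ln b)"
    unfolding J_def mean_ln_mean_ln1[OF b, symmetric] by simp
  finally show ?thesis using b denom_pos[of a] denom_pos[of b]
    by (simp add: mult_less_cancel_left_pos)
qed

section \<open>Derivative at one and the parameters\<close>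

lemma mean_ln_one: "mean_ln 1 = ln golden"
  unfolding mean_ln_def by (rule stat_one) (rule log_lipschitz_intros)

lemma lyap_one: "lyap 1 = ln golden"
  by (simp add: lyap_def mean_ln_one)

lemma mean_ln_half: "mean_ln (1/2) = 0"
  using mean_ln_mean_ln1[of "1/2"] by simp

lemma continuous_on_mean_ln: "continuous_on {1/2..1} mean_ln"
  unfolding mean_ln_def by (rule continuous_on_stat) (rule log_lipschitz_intros)

text \<open>For \<open>b = 1\<close> in \<open>lyap_diff\<close> the second variable becomes the
  constant \<open>golden\<close>. The difference quotient is then exactly the average of a fixed
  function, which is continuous in \<open>a\<close>.\<close>

lemma lyap_derivative_one:
  "(lyap has_real_derivative ln (3 * golden + 1) - ln (2 * golden + 1)) (at 1 within {1/2..1})"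
proof -
  define h where "h = (\<lambda>x. ln (x + golden + x * golden) - ln (1 + x + golden))"
  have llh: "log_lipschitz h"
    unfolding h_def by (intro log_lipschitz_intros log_lipschitz_tb golden)
  have quot: "(lyap a - lyap 1) / (a - 1) = stat a h" if a: "1/2 \<le> a" "a \<le> 1" "a \<noteq> 1" for a
  proof -
    have llt: "log_lipschitz (\<lambda>x. stat 1 (\<lambda>y. ln (x + y + x * y)))"
      by (rule log_lipschitz_stat[OF _ _ log_lip_top(2) log_lipschitz_tb(1)]) auto
    have llb: "log_lipschitz (\<lambda>x. stat 1 (\<lambda>y. ln (1 + x + y)))"
      by (rule log_lipschitz_stat[OF _ _ log_lip_bot(2) log_lipschitz_tb(3)]) auto
    have "pair_top a 1 = stat a (\<lambda>x. ln (x + golden + x * golden))"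
      unfolding pair_top_def
      by (rule stat_cong[OF a(1,2) llt log_lipschitz_tb(2)[OF golden(1)]]) (intro stat_one log_lipschitz_tb)
    moreover have "pair_bot a 1 = stat a (\<lambda>x. ln (1 + x + golden))"
      unfolding pair_bot_def
      by (rule stat_cong[OF a(1,2) llb log_lipschitz_tb(4)[OF golden(1)]]) (intro stat_one log_lipschitz_tb)
    ultimately have "pair_top a 1 - pair_bot a 1 = stat a h"
      unfolding h_def by (simp add: stat_diff[OF a(1,2)] log_lipschitz_tb golden)
    then have "lyap a - lyap 1 = stat a h * (a - 1)"
      using lyap_diff[OF a(1,2), of 1] by (simp add: algebra_simps)
    then show ?thesis using a by (simp add: field_simps)
  qed
  have "((\<lambda>a. stat a h) \<longlongrightarrow> stat 1 h) (at 1 within {1/2..1})"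
    using continuous_on_stat[OF llh] by (auto simp: continuous_on_def)
  also have "stat 1 h = h golden" by (rule stat_one[OF llh])
  also have "h golden = ln (3 * golden + 1) - ln (2 * golden + 1)"
  proof -
    have "golden + golden + golden * golden = 3 * golden + 1" "1 + golden + golden = 2 * golden + 1"
      using golden(2) by (simp_all add: power2_eq_square)
    then show ?thesis unfolding h_def by simp
  qed
  finally have lim: "((\<lambda>a. stat a h) \<longlongrightarrow> ln (3 * golden + 1) - ln (2 * golden + 1)) (at 1 within {1/2..1})" .
  show ?thesis unfolding has_field_derivative_iff
  proof (rule Lim_transform_eventually[OF lim])
    show "\<forall>\<^sub>F a in at 1 within {1/2..1}. stat a h = (lyap a - lyap 1) / (a - 1)"
      unfolding eventually_at_filter using quot by (intro always_eventually) auto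
  qed
qed

lemma mean_ln_derivative_one:
  "(mean_ln has_real_derivative ln 5 / 2) (at 1 within {1/2..1})"
proof -
  \<comment> \<open>The rational factor has value 1 and derivative 1 at
    \<open>a = 1\<close>.\<close>
  have "((\<lambda>a. (2 * a - 1) / (1 - a + a\<^sup>2) * lyap a) has_real_derivative
     1 * lyap 1 + 1 * (ln (3 * golden + 1) - ln (2 * golden + 1))) (at 1 within {1/2..1})"
    by (rule lyap_derivative_one derivative_eq_intros refl | simp)+
  \<comment> \<open>The three logarithms combine because
    \<open>golden (3 golden + 1) = sqrt 5 (2 golden + 1)\<close>.\<close>
  moreover have "1 * lyap 1 + 1 * (ln (3 * golden + 1) - ln (2 * golden + 1)) = ln 5 / 2"
  proof -
    have g: "0 < golden" by (rule golden)
    have "golden * (3 * golden + 1) = 4 * golden + 3"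
      using golden(2) by (simp add: power2_eq_square algebra_simps)
    also have "\<dots> = sqrt 5 * (2 * golden + 1)" by (simp add: golden_def field_simps)
    finally have "ln (golden * (3 * golden + 1)) = ln (sqrt 5 * (2 * golden + 1))" by simp
    then have "ln golden + ln (3 * golden + 1) = ln (sqrt 5) + ln (2 * golden + 1)"
      using g by (simp add: ln_mult)
    then show ?thesis by (simp add: lyap_one ln_sqrt)
  qed
  ultimately have "((\<lambda>a. (2 * a - 1) / (1 - a + a\<^sup>2) * lyap a) has_real_derivative ln 5 / 2) (at 1 within {1/2..1})"
    by (simp only:)
  then show ?thesis
  proof (rule has_field_derivative_transform_within[OF _ zero_less_one])
    fix a :: real assume "a \<in> {1/2..1}"
    then show "(2 * a - 1) / (1 - a + a\<^sup>2) * lyap a = mean_ln a"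
      using mean_ln_lyap[of a] denom_pos[of a] by (simp add: field_simps)
  qed simp
qed

text \<open>The root in \<open>(1/2, 1]\<close> of \<open>(1/p - 1) (2 a - 1) = a - a^2\<close>, the
  condition under which \<open>lin_pot\<close> has constant drift.\<close>

definition alpha_lin :: "real \<Rightarrow> real" where
  "alpha_lin p = 1/2 - (1/p - 1) + sqrt ((1/p - 1)\<^sup>2 + 1/4)"

text \<open>In terms of \<open>t = (1 - a) / a\<close> this solves
  \<open>p t (1 + t) = 1 - p\<close>. The value 1/2 at \<open>p = 1/3\<close> corresponds to
  \<open>t = 1\<close>, where the weights \<open>t ^ k\<close> of the later potential stop being
  summable.\<close>

definition alpha_nonlin :: "real \<Rightarrow> real" where
  "alpha_nonlin p = 2 / (1 + sqrt (4/p - 3))"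

text \<open>Collects what \<open>alpha_lin\<close> requires in terms of \<open>q = 1/p - 1\<close>.
  The decrease follows from the conjugate form \<open>(1/4) / (sqrt (q^2 + 1/4) + q)\<close>, the
  decay as \<open>q\<close> grows from completing the square.\<close>

lemma sqrt_quarter_minus:
  fixes q :: real
  assumes "0 \<le> q"
  shows "0 < sqrt (q\<^sup>2 + 1/4) - q" "sqrt (q\<^sup>2 + 1/4) - q \<le> 1/2"
    and "0 < q \<Longrightarrow> sqrt (q\<^sup>2 + 1/4) - q \<le> 1 / (8 * q)"
    and "q < r \<Longrightarrow> sqrt (r\<^sup>2 + 1/4) - r < sqrt (q\<^sup>2 + 1/4) - q"
proof -
  have "q < sqrt (q\<^sup>2 + 1/4)" by (rule real_less_rsqrt) simp
  then show "0 < sqrt (q\<^sup>2 + 1/4) - q" by simp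
  have "sqrt (q\<^sup>2 + 1/4) \<le> q + 1/2"
    using assms by (intro real_le_lsqrt) (auto simp: power2_eq_square algebra_simps)
  then show "sqrt (q\<^sup>2 + 1/4) - q \<le> 1/2" by simp
  show "sqrt (q\<^sup>2 + 1/4) - q \<le> 1 / (8 * q)" if "0 < q"
  proof -
    have "sqrt (q\<^sup>2 + 1/4) \<le> q + 1 / (8 * q)"
      using that by (intro real_le_lsqrt) (auto simp: power2_eq_square field_simps)
    then show ?thesis by simp
  qed
  show "sqrt (r\<^sup>2 + 1/4) - r < sqrt (q\<^sup>2 + 1/4) - q" if "q < r"
  proof -
    have *: "sqrt (s\<^sup>2 + 1/4) - s = (1/4) / (sqrt (s\<^sup>2 + 1/4) + s)" if "0 \<le> s" for s :: real
    proof -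
      have "(sqrt (s\<^sup>2 + 1/4) - s) * (sqrt (s\<^sup>2 + 1/4) + s) = 1/4"
        by (simp add: algebra_simps power2_eq_square)
      moreover have "0 < sqrt (s\<^sup>2 + 1/4) + s"
        using that by (intro add_pos_nonneg) (simp_all add: add_nonneg_pos)
      ultimately show ?thesis by (simp add: field_simps)
    qed
    have "sqrt (q\<^sup>2 + 1/4) < sqrt (r\<^sup>2 + 1/4)"
      using assms that by (simp add: power_strict_mono)
    moreover have "0 < sqrt (q\<^sup>2 + 1/4)" by (simp add: add_nonneg_pos)
    ultimately have "0 < sqrt (q\<^sup>2 + 1/4) + q" "sqrt (q\<^sup>2 + 1/4) + q < sqrt (r\<^sup>2 + 1/4) + r"
      using assms that by linarith+
    moreover have "0 \<le> r" using assms that by simp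
    ultimately show ?thesis unfolding *[OF assms] *[OF \<open>0 \<le> r\<close>]
      by (intro divide_strict_left_mono mult_pos_pos) auto
  qed
qed

lemma inverse_minus_one:
  assumes "p \<in> {0<..1}"
  shows "0 \<le> 1 / p - (1::real)"
  using assms by simp

lemma alpha_lin_bounds:
  assumes "p \<in> {0<..1}"
  shows "1/2 < alpha_lin p" "alpha_lin p \<le> 1"
  using sqrt_quarter_minus(1,2)[OF inverse_minus_one[OF assms]] by (simp_all add: alpha_lin_def)

lemma alpha_lin_one: "alpha_lin 1 = 1"
  by (simp add: alpha_lin_def real_sqrt_divide)

lemma alpha_lin_strict_mono:
  assumes "0 < p" "p < r" "r \<le> 1"
  shows "alpha_lin p < alpha_lin r"
proof -
  have "1 / r - 1 < 1 / p - 1" using assms by (simp add: frac_less2)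
  from sqrt_quarter_minus(4)[OF inverse_minus_one this] assms show ?thesis by (simp add: alpha_lin_def)
qed

text \<open>Two forms of the quadratic equation for \<open>a\<close>. They are the matching
  conditions for the coefficients of \<open>pot\<close> and \<open>signed_pot\<close> in
  \<open>lin_pot_drift\<close>.\<close>

lemma alpha_lin_eq:
  assumes p: "p \<in> {0<..1}" and a: "a = alpha_lin p"
  shows "p * a + (1 - p) * (1 - a)\<^sup>2 = a\<^sup>2" "p * (1 - a)\<^sup>2 + (1 - p) * a = 1 - a"
proof -
  define q where "q = 1 / p - 1"
  have "a - 1/2 + q = sqrt (q\<^sup>2 + 1/4)" by (simp add: a alpha_lin_def q_def)
  then have "(a - 1/2 + q)\<^sup>2 = q\<^sup>2 + 1/4" by (simp add: add_nonneg_nonneg)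
  then have q: "q * (2 * a - 1) = a - a\<^sup>2" by (simp add: power2_eq_square algebra_simps)
  have pq: "p * q = 1 - p" using p by (simp add: q_def algebra_simps)
  have *: "(1 - p) * (2 * a - 1) = p * (a - a\<^sup>2)"
    unfolding q[symmetric] pq[symmetric] by simp
  show "p * a + (1 - p) * (1 - a)\<^sup>2 = a\<^sup>2" "p * (1 - a)\<^sup>2 + (1 - p) * a = 1 - a"
    using * by (simp_all add: power2_eq_square algebra_simps)
qed

text \<open>At \<open>p = 1\<close> the square root is stationary, as \<open>1/p - 1\<close>
  vanishes there, so only \<open>- 1/p\<close> contributes. The derivative agrees with that of
  \<open>alpha_nonlin\<close>, hence the equal slopes of both growth rates.\<close>

lemma alpha_lin_derivative: "(alpha_lin has_real_derivative 1) (at 1 within S)"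
  unfolding alpha_lin_def
  by (auto intro!: derivative_eq_intros simp: real_sqrt_divide)

lemma alpha_lin_tendsto: "(alpha_lin \<longlongrightarrow> 1/2) (at_right 0)"
proof (rule tendsto_sandwich)
  show "\<forall>\<^sub>F p in at_right 0. 1/2 \<le> alpha_lin p"
    using eventually_at_right_real[of 0 1, OF zero_less_one]
    by eventually_elim (rule less_imp_le, rule alpha_lin_bounds, auto)
  show "\<forall>\<^sub>F p in at_right 0. alpha_lin p \<le> 1/2 + p / (8 * (1 - p))"
    using eventually_at_right_real[of 0 1, OF zero_less_one]
  proof eventually_elim
    case (elim p)
    then have "sqrt ((1 / p - 1)\<^sup>2 + 1/4) - (1 / p - 1) \<le> 1 / (8 * (1 / p - 1))"
      by (intro sqrt_quarter_minus(3)) auto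
    also have "1 / (8 * (1 / p - 1)) = p / (8 * (1 - p))" using elim by (simp add: field_simps)
    finally show ?case by (simp add: alpha_lin_def)
  qed
  have "((\<lambda>p. 1/2 + p / (8 * (1 - p))) \<longlongrightarrow> 1/2 + 0 / (8 * (1 - 0::real))) (at_right 0)"
    by (intro tendsto_intros) auto
  then show "((\<lambda>p. 1/2 + p / (8 * (1 - p))) \<longlongrightarrow> 1/2) (at_right (0::real))" by simp
qed simp

lemma alpha_nonlin_bounds:
  assumes "1/3 \<le> p" "p \<le> 1"
  shows "1/2 \<le> alpha_nonlin p" "alpha_nonlin p \<le> 1"
proof -
  have "1 \<le> 4/p - 3" "4/p - 3 \<le> 9" using assms by (simp_all add: field_simps)
  then have "1 \<le> sqrt (4/p - 3)" "sqrt (4/p - 3) \<le> 3"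
    by (simp_all add: real_le_lsqrt)
  moreover define s where "s = sqrt (4/p - 3)"
  ultimately show "1/2 \<le> alpha_nonlin p" "alpha_nonlin p \<le> 1"
    unfolding alpha_nonlin_def s_def[symmetric] by (simp_all add: field_simps)
qed

lemma alpha_nonlin_strict_mono:
  assumes "0 < p" "p < r" "r \<le> 1"
  shows "alpha_nonlin p < alpha_nonlin r"
proof -
  have "1 \<le> 4/r - 3" "4/r - 3 < 4/p - 3" using assms by (simp_all add: field_simps)
  then have "1 \<le> sqrt (4/r - 3)" "sqrt (4/r - 3) < sqrt (4/p - 3)" by simp_all
  moreover from this have "0 < (1 + sqrt (4/p - 3)) * (1 + sqrt (4/r - 3))"
    by (intro mult_pos_pos) linarith+
  ultimately show ?thesis unfolding alpha_nonlin_def by (intro divide_strict_left_mono) auto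
qed

lemma alpha_nonlin_special: "alpha_nonlin 1 = 1" "alpha_nonlin (1/3) = 1/2"
proof -
  have "sqrt 9 = (3::real)" by (rule real_sqrt_unique) auto
  then show "alpha_nonlin 1 = 1" "alpha_nonlin (1/3) = 1/2" by (simp_all add: alpha_nonlin_def)
qed

lemma continuous_on_alpha_nonlin: "continuous_on {0<..1} alpha_nonlin"
  unfolding alpha_nonlin_def
proof (intro continuous_intros)
  show "\<forall>p\<in>{0<..1}. 1 + sqrt (4 / p - 3) \<noteq> (0::real)"
  proof
    fix p :: real assume "p \<in> {0<..1}"
    then have "0 \<le> 4/p - 3" by (simp add: field_simps)
    then have "0 < 1 + sqrt (4/p - 3)" by (simp add: add_pos_nonneg)
    then show "1 + sqrt (4 / p - 3) \<noteq> 0" by simp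
  qed
qed auto

lemma alpha_nonlin_derivative: "(alpha_nonlin has_real_derivative 1) (at 1 within S)"
  unfolding alpha_nonlin_def
  by (auto intro!: derivative_eq_intros)

lemma alpha_nonlin_eq:
  assumes p: "0 < p" "p \<le> 1" and t: "t = (1 - alpha_nonlin p) / alpha_nonlin p"
  shows "p * t * (1 + t) = 1 - p" "alpha_nonlin p = 1 / (1 + t)" "0 \<le> t" "1/3 < p \<Longrightarrow> t < 1"
proof -
  define s where "s = sqrt (4/p - 3)"
  have ge: "1 \<le> 4/p - 3" using p by (simp add: field_simps)
  then have s: "1 \<le> s" by (simp add: s_def)
  have s2: "s\<^sup>2 = 4/p - 3" unfolding s_def using ge by simp
  have al: "alpha_nonlin p = 2 / (1 + s)" by (simp add: alpha_nonlin_def s_def)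
  have ts: "t = (s - 1) / 2" using s by (simp add: t al field_simps)
  have "t * (1 + t) = (s\<^sup>2 - 1) / 4" by (simp add: ts power2_eq_square field_simps)
  also have "\<dots> = 1/p - 1" by (simp add: s2)
  finally have "p * (t * (1 + t)) = p * (1/p - 1)" by simp
  then show "p * t * (1 + t) = 1 - p" using p by (simp add: algebra_simps)
  show "alpha_nonlin p = 1 / (1 + t)" unfolding al ts using s by (simp add: field_simps)
  show "0 \<le> t" using s by (simp add: ts)
  show "t < 1" if "1/3 < p"
  proof -
    have "s < 3" unfolding s_def using that p by (intro real_less_lsqrt) (auto simp: field_simps)
    then show ?thesis by (simp add: ts)
  qed
qed

section \<open>Random walks driven by the sign sequence\<close>

primrec walk :: "('s \<Rightarrow> bool \<Rightarrow> 's) \<Rightarrow> 's \<Rightarrow> (nat \<Rightarrow> bool) \<Rightarrow> nat \<Rightarrow> 's" where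
  "walk f x s 0 = x"
| "walk f x s (Suc n) = f (walk f x s n) (s n)"

text \<open>The expectation after \<open>n\<close> steps as a finite recursion. Moments can be
  estimated on it by induction; \<open>nn_integral_walk\<close> links it to the measure.\<close>

primrec walk_mean :: "real \<Rightarrow> ('s \<Rightarrow> bool \<Rightarrow> 's) \<Rightarrow> nat \<Rightarrow> ('s \<Rightarrow> real) \<Rightarrow> 's \<Rightarrow> real" where
  "walk_mean p f 0 g x = g x"
| "walk_mean p f (Suc n) g x = p * walk_mean p f n g (f x True) + (1 - p) * walk_mean p f n g (f x False)"

lemma walk_front: "walk f x s (Suc n) = walk f (f x (s 0)) (\<lambda>k. s (Suc k)) n"
  by (induction n) simp_all

lemma walk_mean_mono:
  assumes "0 \<le> p" "p \<le> 1" "\<And>y b. y \<in> S \<Longrightarrow> f y b \<in> S" "\<And>y. y \<in> S \<Longrightarrow> g y \<le> h y" "x \<in> S"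
  shows "walk_mean p f n g x \<le> walk_mean p f n h x"
  using assms(5)
proof (induction n arbitrary: x)
  case (Suc n)
  then show ?case using assms(1-3) by (auto intro!: add_mono mult_left_mono)
qed (use assms in auto)

lemma walk_mean_cmult: "walk_mean p f n (\<lambda>y. c * g y) x = c * walk_mean p f n g x"
  by (induction n arbitrary: x) (auto simp: algebra_simps)

lemma walk_mean_nonneg:
  assumes "0 \<le> p" "p \<le> 1" "\<And>y. 0 \<le> g y"
  shows "0 \<le> walk_mean p f n g x"
  using assms by (induction n arbitrary: x) auto

lemma walk_mean_growth:
  assumes p: "0 \<le> p" "p \<le> 1" and S: "x \<in> S" "\<And>y b. y \<in> S \<Longrightarrow> f y b \<in> S"
    and step: "\<And>y. y \<in> S \<Longrightarrow> p * g (f y True) + (1 - p) * g (f y False) \<le> r * g y + c"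
    and r: "0 \<le> r" and c: "c = 0 \<or> 0 \<le> c \<and> 1 \<le> r"
  shows "walk_mean p f n g x \<le> (g x + n * c) * r ^ n"
proof -
  \<comment> \<open>The recursion splits off the first step, whereas the induction has to act on the
    last one.\<close>
  have comm: "walk_mean p f (Suc n) g x = walk_mean p f n (\<lambda>y. p * g (f y True) + (1 - p) * g (f y False)) x"
    for n x by (induction n arbitrary: x) auto
  have const: "walk_mean p f n (\<lambda>y. r * g y + c) x = r * walk_mean p f n g x + c" for n x
    by (induction n arbitrary: x) (auto simp: algebra_simps)
  show ?thesis
  proof (induction n)
    case (Suc n)
    have "walk_mean p f (Suc n) g x \<le> walk_mean p f n (\<lambda>y. r * g y + c) x"
      unfolding comm by (rule walk_mean_mono[OF p S(2) step S(1)])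
    also have "\<dots> \<le> r * ((g x + n * c) * r ^ n) + c"
      unfolding const using Suc.IH r by (intro add_mono mult_left_mono) auto
    also have "\<dots> \<le> (g x + Suc n * c) * r ^ Suc n"
    proof (cases "c = 0")
      case False
      with c have "c * 1 \<le> c * r ^ Suc n" by (intro mult_left_mono one_le_power) auto
      then show ?thesis by (simp add: algebra_simps)
    qed simp
    finally show ?case .
  qed simp
qed

lemma sequence_space_signs: "sequence_space (measure_pmf (bernoulli_pmf p))"
  by unfold_locales

lemma prob_space_signs: "prob_space (signs p)"
  unfolding signs_def by (intro prob_space_PiM prob_space_measure_pmf)

lemma space_signs [simp]: "space (signs p) = UNIV"
  by (auto simp: signs_def space_PiM)

lemma distr_signs: "distr (measure_pmf (bernoulli_pmf p) \<Otimes>\<^sub>M signs p) (signs p) (\<lambda>(b, s). case_nat b s) = signs p"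
  unfolding signs_def by (rule sequence_space.PiM_iter[OF sequence_space_signs])

lemma measurable_signs_component: "(\<lambda>s. s i) \<in> measurable (signs p) (count_space UNIV)"
proof -
  have "(\<lambda>s. s i) \<in> measurable (signs p) (measure_pmf (bernoulli_pmf p))"
    unfolding signs_def by (rule measurable_component_singleton) simp
  also have "measurable (signs p) (measure_pmf (bernoulli_pmf p)) = measurable (signs p) (count_space UNIV)"
    by (rule measurable_cong_sets) simp_all
  finally show ?thesis .
qed

lemma measurable_signs_shift: "(\<lambda>s k. s (Suc k)) \<in> measurable (signs p) (signs p)"
proof -
  have "(\<lambda>s. s i) \<in> measurable (signs p) (measure_pmf (bernoulli_pmf p))" for i
    unfolding signs_def by (rule measurable_component_singleton) simp
  then show ?thesis
    by (subst (2) signs_def) (rule measurable_abs_UNIV)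
qed

text \<open>Splitting by the first sign turns the walk into a case distinction between two shorter
  walks on the shifted signs.\<close>

lemma measurable_walk: "(\<lambda>s. walk f x s n) \<in> measurable (signs p) (count_space UNIV)"
proof (induction n arbitrary: x)
  case (Suc n)
  have "(\<lambda>s. if s 0 then walk f (f x True) (\<lambda>k. s (Suc k)) n else walk f (f x False) (\<lambda>k. s (Suc k)) n)
      \<in> measurable (signs p) (count_space UNIV)"
  proof (rule measurable_If)
    show "{s \<in> space (signs p). s 0} \<in> sets (signs p)"
      using measurable_sets[OF measurable_signs_component[of 0 p], of "{True}"] by (simp add: vimage_def)
  qed (rule measurable_compose[OF measurable_signs_shift Suc])+
  also have "(\<lambda>s. if s 0 then walk f (f x True) (\<lambda>k. s (Suc k)) n else walk f (f x False) (\<lambda>k. s (Suc k)) n)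
      = (\<lambda>s. walk f x s (Suc n))"
    unfolding walk_front by (auto simp: fun_eq_iff)
  finally show ?case .
qed simp

lemma nn_integral_walk:
  assumes p: "0 \<le> p" "p \<le> 1" and g: "\<And>y. 0 \<le> g y"
  shows "(\<integral>\<^sup>+ s. ennreal (g (walk f x s n)) \<partial>signs p) = ennreal (walk_mean p f n g x)"
proof (induction n arbitrary: x)
  case 0
  show ?case using prob_space.emeasure_space_1[OF prob_space_signs] by simp
next
  case (Suc n)
  interpret S: prob_space "signs p" by (rule prob_space_signs)
  have meas: "(\<lambda>s. ennreal (g (walk f x s n))) \<in> borel_measurable (signs p)" for x n
    by (rule measurable_compose[OF measurable_walk]) simp
  have m: "(\<lambda>(b, s). case_nat b s) \<in> measurable (measure_pmf (bernoulli_pmf p) \<Otimes>\<^sub>M signs p) (signs p)"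
    unfolding signs_def by measurable
  have "(\<integral>\<^sup>+ s. ennreal (g (walk f x s (Suc n))) \<partial>signs p)
      = (\<integral>\<^sup>+ z. ennreal (g (walk f x ((\<lambda>(b, s). case_nat b s) z) (Suc n))) \<partial>(measure_pmf (bernoulli_pmf p) \<Otimes>\<^sub>M signs p))"
    by (subst distr_signs[symmetric], subst nn_integral_distr[OF m]) (simp_all only: measurable_distr_eq1 meas)
  also have "\<dots> = (\<integral>\<^sup>+ b. (\<integral>\<^sup>+ s. ennreal (g (walk f x (case_nat b s) (Suc n))) \<partial>signs p) \<partial>measure_pmf (bernoulli_pmf p))"
    by (subst S.nn_integral_fst[symmetric]) (use measurable_compose[OF m meas] in \<open>auto simp: case_prod_beta simp del: walk.simps\<close>)
  also have "\<dots> = (\<integral>\<^sup>+ b. ennreal (walk_mean p f n g (f x b)) \<partial>measure_pmf (bernoulli_pmf p))"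
    unfolding walk_front by (simp add: Suc)
  also have "\<dots> = ennreal (walk_mean p f n g (f x True)) * ennreal p + ennreal (walk_mean p f n g (f x False)) * ennreal (1 - p)"
    using p by simp
  also have "\<dots> = ennreal (walk_mean p f (Suc n) g x)"
    using p walk_mean_nonneg[where g = g, OF p g]
    by (simp add: ennreal_mult'[symmetric] ennreal_plus[symmetric] mult.commute del: ennreal_plus)
  finally show ?case .
qed

text \<open>The shift preserves the law because it undoes the measure-preserving prepending of an
  independent sign. It reconciles the walks, which consume signs from index 0 on, with the
  sequences, which start at index 1.\<close>

lemma AE_signs_shift:
  assumes "AE s in signs p. Q s"
  shows "AE s in signs p. Q (\<lambda>k. s (Suc k))"
proof -
  interpret S: prob_space "signs p" by (rule prob_space_signs)
  have m: "(\<lambda>(b, s). case_nat b s) \<in> measurable (measure_pmf (bernoulli_pmf p) \<Otimes>\<^sub>M signs p) (signs p)"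
    unfolding signs_def by measurable
  have e: "distr (signs p) (signs p) (\<lambda>s k. s (Suc k)) = signs p"
  proof -
    have "distr (signs p) (signs p) (\<lambda>s k. s (Suc k))
        = distr (distr (measure_pmf (bernoulli_pmf p) \<Otimes>\<^sub>M signs p) (signs p) (\<lambda>(b, s). case_nat b s)) (signs p) (\<lambda>s k. s (Suc k))"
      by (simp add: distr_signs)
    also have "\<dots> = distr (measure_pmf (bernoulli_pmf p) \<Otimes>\<^sub>M signs p) (signs p) snd"
      by (subst distr_distr[OF measurable_signs_shift m]) (auto simp: comp_def case_prod_beta intro!: distr_cong)
    also have "\<dots> = signs p"
    proof (rule measure_eqI)
      fix A assume "A \<in> sets (distr (measure_pmf (bernoulli_pmf p) \<Otimes>\<^sub>M signs p) (signs p) snd)"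
      then have A: "A \<in> sets (signs p)" by simp
      have "snd -` A \<inter> space (measure_pmf (bernoulli_pmf p) \<Otimes>\<^sub>M signs p) = UNIV \<times> A"
        by (auto simp: space_pair_measure)
      then show "emeasure (distr (measure_pmf (bernoulli_pmf p) \<Otimes>\<^sub>M signs p) (signs p) snd) A = emeasure (signs p) A"
        using A S.emeasure_pair_measure_Times[of UNIV "measure_pmf (bernoulli_pmf p)" A] measure_pmf.emeasure_space_1
        by (simp add: emeasure_distr)
    qed simp
    finally show ?thesis .
  qed
  have "AE s in distr (signs p) (signs p) (\<lambda>s k. s (Suc k)). Q s" using assms unfolding e .
  then show ?thesis by (rule AE_distrD[OF measurable_signs_shift])
qed

text \<open>Markov's inequality for an exponential moment, followed by Borel--Cantelli.\<close>

lemma walk_eventually_le: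
  assumes p: "0 \<le> p" "p \<le> 1" and l: "0 < l" and r: "0 < r" "r < exp (l * c)"
    and bound: "\<And>n. walk_mean p f n (\<lambda>y. exp (l * g y)) x \<le> K * (real n + 1) * r ^ n"
  shows "AE s in signs p. \<forall>\<^sub>F n in sequentially. g (walk f x s n) \<le> c * real n"
proof -
  interpret S: prob_space "signs p" by (rule prob_space_signs)
  define B where "B = (\<lambda>n. {s \<in> space (signs p). c * real n < g (walk f x s n)})"
  define q where "q = r / exp (l * c)"
  have q: "0 < q" "q < 1" using r by (auto simp: q_def)
  have sets: "B n \<in> sets (signs p)" for n
    unfolding B_def using measurable_sets[OF measurable_walk[of f x n p], of "{y. c * real n < g y}"]
    by (simp add: vimage_def)
  have le: "measure (signs p) (B n) \<le> K * (real n + 1) * q ^ n" for n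
  proof -
    have K: "0 \<le> K * (real n + 1) * q ^ n"
    proof -
      have "0 \<le> K * (real 0 + 1) * r ^ 0"
        using bound[of 0] order_trans[OF exp_ge_zero[of "l * g x"]] by simp
      then show ?thesis using q by simp
    qed
    have "emeasure (signs p) (B n) = (\<integral>\<^sup>+ s. indicator (B n) s \<partial>signs p)"
      using sets by simp
    also have "\<dots> \<le> (\<integral>\<^sup>+ s. ennreal (exp (- (l * c * n)) * exp (l * g (walk f x s n))) \<partial>signs p)"
    proof (rule nn_integral_mono)
      fix s
      have "1 \<le> exp (- (l * c * n)) * exp (l * g (walk f x s n))" if "s \<in> B n"
      proof -
        have "l * (c * n) \<le> l * g (walk f x s n)" using that l by (simp add: B_def)
        then show ?thesis by (simp add: exp_add[symmetric] algebra_simps)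
      qed
      then show "indicator (B n) s \<le> ennreal (exp (- (l * c * n)) * exp (l * g (walk f x s n)))"
        by (auto simp: indicator_def simp del: ennreal_1 simp flip: ennreal_1)
    qed
    also have "\<dots> = ennreal (walk_mean p f n (\<lambda>y. exp (- (l * c * n)) * exp (l * g y)) x)"
      by (rule nn_integral_walk[OF p]) simp
    also have "\<dots> \<le> ennreal (K * (real n + 1) * q ^ n)"
    proof (rule ennreal_leI)
      have "walk_mean p f n (\<lambda>y. exp (- (l * c * n)) * exp (l * g y)) x
          \<le> exp (- (l * c * n)) * (K * (real n + 1) * r ^ n)"
        unfolding walk_mean_cmult by (intro mult_left_mono bound) simp
      also have "exp (- (l * c * n)) * (K * (real n + 1) * r ^ n) = K * (real n + 1) * q ^ n"
        by (simp add: q_def exp_minus power_divide exp_of_nat_mult[symmetric] field_simps)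
      finally show "walk_mean p f n (\<lambda>y. exp (- (l * c * n)) * exp (l * g y)) x \<le> K * (real n + 1) * q ^ n" .
    qed
    finally show ?thesis using K by (simp add: S.emeasure_eq_measure)
  qed
  have "summable (\<lambda>n. K * (real n + 1) * q ^ n)"
  proof -
    have "(\<lambda>n. of_nat (Suc n) * q ^ n) sums (1 / (1 - q)\<^sup>2)" by (rule geometric_deriv_sums) (use q in simp)
    then have "summable (\<lambda>n. K * (of_nat (Suc n) * q ^ n))" by (intro summable_mult) (rule sums_summable)
    then show ?thesis by (simp add: mult.assoc add.commute)
  qed
  then have sum: "summable (\<lambda>n. measure (signs p) (B n))"
  proof (rule summable_comparison_test'[where N = 0])
    show "norm (measure (signs p) (B n)) \<le> K * (real n + 1) * q ^ n" for n
      using le[of n] measure_nonneg[of "signs p" "B n"] by (simp only: real_norm_def abs_of_nonneg)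
  qed
  have "emeasure (signs p) (B n) < \<infinity>" for n
    using S.emeasure_finite[of "B n"] by (simp add: less_top[symmetric])
  from borel_cantelli_AE1[OF sets this sum]
  have "AE s in signs p. \<forall>\<^sub>F n in sequentially. s \<in> space (signs p) - B n" .
  then show ?thesis
    by eventually_elim (auto simp: B_def not_less elim: eventually_mono)
qed

text \<open>For negative \<open>y\<close> the bound \<open>exp y \<le> 1 / (1 - y)\<close> is
  combined with \<open>(1 - y) (1 + y + y^2) = 1 - y^3 \<ge> 1\<close>.\<close>

lemma exp_le_quadratic:
  fixes y :: real
  assumes "\<bar>y\<bar> \<le> 1"
  shows "exp y \<le> 1 + y + y\<^sup>2"
proof (cases "0 \<le> y")
  case True
  then show ?thesis using assms by (intro exp_bound) auto
next
  case False
  have "(1 - y) * (1 + y + y\<^sup>2) = 1 - y ^ 3" by (simp add: power2_eq_square power3_eq_cube algebra_simps)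
  also have "1 \<le> 1 - y ^ 3" using False by (simp add: power3_eq_cube mult_nonneg_nonpos mult_nonpos_nonpos)
  finally have "1 / (1 - y) \<le> 1 + y + y\<^sup>2" using False by (simp add: field_simps)
  moreover have "exp y \<le> 1 / (1 - y)"
  proof -
    have "1 - y \<le> exp (- y)" using exp_ge_add_one_self[of "- y"] by simp
    then show ?thesis using False by (simp add: exp_minus field_simps)
  qed
  ultimately show ?thesis by simp
qed

text \<open>A Chernoff bound. The increments minus the drift have mean zero, so the first-order term
  of the exponential moment cancels and each step costs only a factor with the exponent
  \<open>(l D)^2\<close>.\<close>

lemma walk_upper_bound:
  assumes p: "0 \<le> p" "p \<le> 1" and S: "x \<in> S" "\<And>y b. y \<in> S \<Longrightarrow> f y b \<in> S"
    and drift: "\<And>y. y \<in> S \<Longrightarrow> p * g (f y True) + (1 - p) * g (f y False) = g y + \<gamma>"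
    and incr: "\<And>y b. y \<in> S \<Longrightarrow> \<bar>g (f y b) - g y\<bar> \<le> C"
    and e: "0 < e"
  shows "AE s in signs p. \<forall>\<^sub>F n in sequentially. g (walk f x s n) \<le> (\<gamma> + e) * real n"
proof -
  define D where "D = 1 + C + \<bar>\<gamma>\<bar>"
  have D: "1 \<le> D" using incr[OF S(1), of True] by (simp add: D_def)
  \<comment> \<open>The first term makes \<open>exp_le_quadratic\<close> applicable; the second
    keeps the quadratic cost below half of the allowed excess \<open>l e\<close>. The summand 1 in
    \<open>D\<close> keeps both quotients meaningful.\<close>
  define l where "l = min (1 / D) (e / (2 * D\<^sup>2))"
  have l: "0 < l" "l * D \<le> 1" "l * D\<^sup>2 \<le> e / 2"
  proof -
    show "0 < l" using D e by (simp add: l_def)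
    have "l * D \<le> 1 / D * D" using D by (intro mult_right_mono) (auto simp: l_def)
    then show "l * D \<le> 1" using D by simp
    have "l * D\<^sup>2 \<le> e / (2 * D\<^sup>2) * D\<^sup>2" by (intro mult_right_mono) (auto simp: l_def)
    then show "l * D\<^sup>2 \<le> e / 2" using D by simp
  qed
  define r where "r = exp (l * \<gamma>) * exp ((l * D)\<^sup>2)"
  have step: "p * exp (l * g (f y True)) + (1 - p) * exp (l * g (f y False)) \<le> r * exp (l * g y) + 0"
    if y: "y \<in> S" for y
  proof -
    define d where "d = (\<lambda>b. g (f y b) - g y - \<gamma>)"
    have zero: "p * d True + (1 - p) * d False = 0"
      using drift[OF y] by (simp add: d_def algebra_simps)
    have small: "\<bar>l * d b\<bar> \<le> l * D" for b
    proof -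
      have "\<bar>d b\<bar> \<le> D" using incr[OF y, of b] by (simp add: d_def D_def)
      then show ?thesis using l by (simp add: abs_mult)
    qed
    have exp_d: "exp (l * d b) \<le> 1 + l * d b + (l * D)\<^sup>2" for b
    proof -
      have "exp (l * d b) \<le> 1 + l * d b + (l * d b)\<^sup>2"
        using small[of b] l by (intro exp_le_quadratic) linarith
      also have "(l * d b)\<^sup>2 \<le> (l * D)\<^sup>2" using small[of b] by (metis abs_ge_zero power2_abs power_mono)
      finally show ?thesis by simp
    qed
    have "p * exp (l * d True) + (1 - p) * exp (l * d False)
        \<le> p * (1 + l * d True + (l * D)\<^sup>2) + (1 - p) * (1 + l * d False + (l * D)\<^sup>2)"
      using p by (intro add_mono mult_left_mono exp_d) auto
    also have "\<dots> = 1 + (l * D)\<^sup>2 + l * (p * d True + (1 - p) * d False)" by (simp add: algebra_simps)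
    also have "\<dots> \<le> exp ((l * D)\<^sup>2)" unfolding zero by simp
    finally have le: "p * exp (l * d True) + (1 - p) * exp (l * d False) \<le> exp ((l * D)\<^sup>2)" .
    have split: "exp (l * g (f y b)) = exp (l * \<gamma>) * exp (l * g y) * exp (l * d b)" for b
      by (simp add: d_def exp_add[symmetric] algebra_simps)
    have "p * exp (l * g (f y True)) + (1 - p) * exp (l * g (f y False))
        = exp (l * \<gamma>) * exp (l * g y) * (p * exp (l * d True) + (1 - p) * exp (l * d False))"
      unfolding split by (simp add: algebra_simps)
    also have "\<dots> \<le> exp (l * \<gamma>) * exp (l * g y) * exp ((l * D)\<^sup>2)"
      using le by (intro mult_left_mono) auto
    finally show ?thesis by (simp add: r_def algebra_simps)
  qed
  have "walk_mean p f n (\<lambda>y. exp (l * g y)) x \<le> exp (l * g x) * (real n + 1) * r ^ n" for n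
  proof -
    have "walk_mean p f n (\<lambda>y. exp (l * g y)) x \<le> (exp (l * g x) + real n * 0) * r ^ n"
      by (rule walk_mean_growth[OF p S step]) (auto simp: r_def)
    also have "\<dots> \<le> (exp (l * g x) * (real n + 1)) * r ^ n"
      by (intro mult_right_mono) (auto simp: r_def)
    finally show ?thesis .
  qed
  moreover have "r < exp (l * (\<gamma> + e))"
  proof -
    have "l * (l * D\<^sup>2) \<le> l * (e / 2)" using l by (intro mult_left_mono) auto
    also have "\<dots> < l * e" using l e by simp
    finally show ?thesis by (simp add: r_def exp_add[symmetric] power2_eq_square algebra_simps)
  qed
  ultimately show ?thesis using l by (intro walk_eventually_le[OF p l(1)]) (auto simp: r_def)
qed

text \<open>The one-sided bound is used for \<open>g\<close> and for \<open>- g\<close>, with errors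
  \<open>1 / real (Suc k)\<close>, so that only countably many null sets are removed.\<close>

lemma walk_law_of_large_numbers:
  assumes p: "0 \<le> p" "p \<le> 1" and S: "x \<in> S" "\<And>y b. y \<in> S \<Longrightarrow> f y b \<in> S"
    and drift: "\<And>y. y \<in> S \<Longrightarrow> p * g (f y True) + (1 - p) * g (f y False) = g y + \<gamma>"
    and incr: "\<And>y b. y \<in> S \<Longrightarrow> \<bar>g (f y b) - g y\<bar> \<le> C"
  shows "AE s in signs p. (\<lambda>n. g (walk f x s n) / real n) \<longlonglongrightarrow> \<gamma>"
proof -
  have up: "AE s in signs p. \<forall>k. \<forall>\<^sub>F n in sequentially. g (walk f x s n) \<le> (\<gamma> + 1 / real (Suc k)) * real n"
    unfolding AE_all_countable
    by (rule allI, rule walk_upper_bound[where S = S and f = f and g = g and x = x and C = C, OF p S drift incr]) simp_all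
  have neg_drift: "p * (- g (f y True)) + (1 - p) * (- g (f y False)) = - g y + (- \<gamma>)" if "y \<in> S" for y
    using drift[OF that] by (simp add: algebra_simps)
  have neg_incr: "\<bar>- g (f y b) - - g y\<bar> \<le> C" if "y \<in> S" for y b
    using incr[OF that, of b] by simp
  have low: "AE s in signs p. \<forall>k. \<forall>\<^sub>F n in sequentially. - g (walk f x s n) \<le> (- \<gamma> + 1 / real (Suc k)) * real n"
    unfolding AE_all_countable
    by (rule allI, rule walk_upper_bound[where S = S and f = f and g = "\<lambda>y. - g y" and x = x and C = C,
          OF p S neg_drift neg_incr]) simp_all
  from up low show ?thesis
  proof eventually_elim
    case (elim s)
    show ?case
    proof (rule tendstoI)
      fix e :: real assume "0 < e"
      then obtain k where k: "1 / real (Suc k) < e" by (rule nat_approx_posE)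
      from elim have "\<forall>\<^sub>F n in sequentially. g (walk f x s n) \<le> (\<gamma> + 1 / real (Suc k)) * real n"
        "\<forall>\<^sub>F n in sequentially. - g (walk f x s n) \<le> (- \<gamma> + 1 / real (Suc k)) * real n" by blast+
      then show "\<forall>\<^sub>F n in sequentially. dist (g (walk f x s n) / real n) \<gamma> < e"
        using eventually_gt_at_top[of 0]
      proof eventually_elim
        case (elim n)
        then have "g (walk f x s n) / real n \<le> \<gamma> + 1 / real (Suc k)"
          "(- g (walk f x s n)) / real n \<le> - \<gamma> + 1 / real (Suc k)"
          by (simp_all only: pos_divide_le_eq of_nat_0_less_iff)
        moreover have "(- g (walk f x s n)) / real n = - (g (walk f x s n) / real n)" by simp
        ultimately show ?case using k unfolding dist_real_def by linarith
      qed
    qed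
  qed
qed

section \<open>Pairs of consecutive terms\<close>

text \<open>The subtractive Euclidean algorithm, each subtraction weighted by the number of minus
  steps that realise it: two lead from \<open>(a, b)\<close> to \<open>(b - a, a)\<close> if
  \<open>a \<le> b\<close>, one leads to \<open>(b, a - b)\<close> otherwise.\<close>

function weight :: "nat \<Rightarrow> nat \<Rightarrow> nat" where
  "weight a b = (if a = 0 \<or> b = 0 then 0
     else if a \<le> b then 2 + weight (b - a) a else 1 + weight b (a - b))"

  by auto
termination by (relation "Wellfounded.measure (\<lambda>(a, b). a + b)") auto

declare weight.simps [simp del]

fun nat_step :: "nat \<times> nat \<Rightarrow> bool \<Rightarrow> nat \<times> nat" where
  "nat_step (a, b) True = (b, a + b)"
| "nat_step (a, b) False = (b, if a \<le> b then b - a else a - b)"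

lemma weight_zero [simp]: "weight 0 b = 0" "weight a 0 = 0"
  by (simp_all add: weight.simps)

lemma weight_plus: "weight b (a + b) \<le> weight a b + 2"
  by (cases "b = 0") (simp_all add: weight.simps[of b "a + b"])

lemma weight_minus:
  assumes "weight a b > 0"
  shows "weight b (if a \<le> b then b - a else a - b) < weight a b"
proof -
  have ab: "a > 0" "b > 0" using assms by (auto intro: Suc_leI gr0I)
  show ?thesis
  proof (cases "a < b")
    case True
    then have "weight a b = 2 + weight (b - a) a" using ab by (simp add: weight.simps[of a b])
    moreover have "weight b (b - a) = 1 + weight (b - a) a" using ab True by (simp add: weight.simps[of b "b - a"])
    ultimately show ?thesis using True by simp
  next
    case False
    then show ?thesis using ab assms by (cases "a = b") (simp_all add: weight.simps[of a b])
  qed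
qed

text \<open>At a zero entry a minus may lead upwards: it sends \<open>(0, b)\<close> to
  \<open>(b, b)\<close>, whose weight is 2 for positive \<open>b\<close>.\<close>

lemma weight_minus_zero:
  assumes "weight a b = 0"
  shows "weight b (if a \<le> b then b - a else a - b) \<le> 2"
proof -
  have "a = 0 \<or> b = 0" using assms by (auto simp: weight.simps[of a b] split: if_splits)
  then show ?thesis by (auto simp: weight.simps[of b b])
qed

lemma weight_nat_step: "case_prod weight (nat_step v s) \<le> case_prod weight v + 2"
proof (cases v)
  case (Pair a b)
  then show ?thesis
    using weight_plus[of b a] weight_minus[of a b] weight_minus_zero[of a b]
    by (cases s; cases "weight a b = 0") auto
qed

text \<open>A quotient in the Euclidean algorithm is the number of repeated subtractions, each of
  which adds at least 1 to the weight. This later keeps the two entries comparable up to a factor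
  linear in time.\<close>

lemma ratio_le_weight:
  assumes "a > 0" "b > 0"
  shows "b \<le> (weight a b + 1) * a \<and> a \<le> (weight a b + 1) * b"
  using assms
proof (induction a b rule: weight.induct)
  case (1 a b)
  show ?case
  proof (cases "a \<le> b")
    case True
    show ?thesis
    proof (cases "a = b")
      case False
      with True 1 have "b - a \<le> (weight (b - a) a + 1) * a" by simp
      moreover have "weight a b = 2 + weight (b - a) a" using 1 True by (simp add: weight.simps[of a b])
      ultimately show ?thesis using True 1 by (auto simp: algebra_simps trans_le_add1)
    qed simp
  next
    case False
    with 1 have "a - b \<le> (weight b (a - b) + 1) * b" by simp
    moreover have "weight a b = 1 + weight b (a - b)" using 1 False by (simp add: weight.simps[of a b])
    ultimately show ?thesis using False by (auto simp: algebra_simps trans_le_add1)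
  qed
qed

text \<open>Undoing one subtraction at most doubles the sum, and a pair with a zero entry has its
  gcd as sum.\<close>

lemma sum_le_weight: "a + b \<le> gcd a b * 2 ^ weight a b"
proof (induction a b rule: weight.induct)
  case (1 a b)
  consider "a = 0 \<or> b = 0" | "0 < a" "a \<le> b" | "0 < b" "b < a" by linarith
  then show ?case
  proof cases
    case 2
    then have "gcd (b - a) a = gcd a b" by (metis gcd.commute gcd_diff1_nat)
    moreover have "b - a + a \<le> gcd (b - a) a * 2 ^ weight (b - a) a" using 1 2 by auto
    moreover have "weight a b = 2 + weight (b - a) a" using 2 by (simp add: weight.simps[of a b])
    ultimately show ?thesis using 2 by simp
  next
    case 3
    then have "gcd b (a - b) = gcd a b" by (metis gcd.commute gcd_diff1_nat less_imp_le)
    moreover have "b + (a - b) \<le> gcd b (a - b) * 2 ^ weight b (a - b)" using 1 3 by auto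
    moreover have "weight a b = 1 + weight b (a - b)" using 3 by (simp add: weight.simps[of a b])
    ultimately show ?thesis using 3 by simp
  qed auto
qed

lemma coprime_nat_step:
  assumes "case_prod coprime v" shows "case_prod coprime (nat_step v s)"
proof (cases v)
  case (Pair a b)
  have "gcd b (b - a) = gcd a b" if "a \<le> b" using that by (metis gcd.commute gcd_diff1_nat gcd_diff2_nat)
  moreover have "gcd b (a - b) = gcd a b" if "\<not> a \<le> b" using that by (metis gcd.commute gcd_diff1_nat nat_le_linear)
  moreover have "gcd b (a + b) = gcd a b" by (metis add.commute gcd.commute gcd_add2)
  ultimately show ?thesis using assms Pair
    by (cases s) (auto simp: coprime_iff_gcd_eq_1 gcd.commute)
qed

definition ln_size :: "nat \<times> nat \<Rightarrow> real" where
  "ln_size v = ln (real (fst v + snd v))"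

lemma ln_ratio_le:
  fixes m n :: nat
  assumes "0 < m" "0 < n" "m \<le> 2 * n" "n \<le> 2 * m"
  shows "\<bar>ln (real m) - ln (real n)\<bar> \<le> ln 2"
proof -
  have "ln (real m) \<le> ln (2 * real n)" "ln (real n) \<le> ln (2 * real m)"
    using assms by (auto intro!: ln_mono)
  then show ?thesis using assms by (simp add: ln_mult abs_le_iff)
qed

lemma ln_size_nat_step:
  assumes "v \<noteq> (0, 0)"
  shows "\<bar>ln_size (nat_step v s) - ln_size v\<bar> \<le> ln 2"
proof -
  obtain a b where "v = (a, b)" by fastforce
  then show ?thesis using assms unfolding ln_size_def
    by (intro ln_ratio_le) (cases s; auto)+
qed

lemma nat_step_nonzero: "v \<noteq> (0, 0) \<Longrightarrow> nat_step v s \<noteq> (0, 0)"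
  by (cases v; cases s) auto

text \<open>The weight grows at most linearly, so \<open>ratio_le_weight\<close> bounds the total by
  a linear multiple of the first entry, and the logarithm of that multiple is negligible. The sign
  of each step is left existential so that the absolute values of the linear sequence are covered
  too.\<close>

lemma component_growth:
  assumes u0: "u 0 = (1, 1)" and u: "\<And>n. \<exists>b. u (Suc n) = nat_step (u n) b"
    and lim: "(\<lambda>n. ln_size (u n) / real n) \<longlonglongrightarrow> \<gamma>" and "0 < \<gamma>"
  shows "(\<lambda>n. ln (real (fst (u n))) / real n) \<longlonglongrightarrow> \<gamma>"
proof -
  have wt: "case_prod weight (u n) \<le> 2 * n + 2" for n
  proof (induction n)
    case 0
    then show ?case by (simp add: u0 weight.simps[of "Suc 0" "Suc 0"])
  next
    case (Suc n)
    obtain b where "u (Suc n) = nat_step (u n) b" using u by blast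
    then show ?case using Suc weight_nat_step[of "u n" b] by simp
  qed
  have cop: "case_prod coprime (u n)" for n
  proof (induction n)
    case (Suc n)
    obtain b where "u (Suc n) = nat_step (u n) b" using u by blast
    then show ?case using Suc coprime_nat_step by simp
  qed (simp add: u0)
  have "\<forall>\<^sub>F n in sequentially. 0 < ln_size (u n) / real n"
    using lim \<open>0 < \<gamma>\<close> by (rule order_tendstoD)
  then have close: "\<forall>\<^sub>F n in sequentially. norm (ln_size (u n) / real n - ln (real (fst (u n))) / real n)
      \<le> ln 6 / real n + ln (real n) / real n"
    using eventually_gt_at_top[of 0]
  proof eventually_elim
    case (elim n)
    obtain a b where ab: "u n = (a, b)" by fastforce
    have pos: "0 < ln (real (a + b))" using elim by (simp add: ab ln_size_def zero_less_divide_iff)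
    \<comment> \<open>Here the default \<open>ln 0 = 0\<close> has to be excluded: a coprime pair
      with first entry 0 is \<open>(0, 1)\<close>, whose \<open>ln_size\<close> is 0.\<close>
    have a: "a > 0"
    proof (rule gr0I)
      assume "a = 0"
      then have "b = 1" using cop[of n] ab by simp
      then show False using pos \<open>a = 0\<close> by simp
    qed
    have "b \<le> (2 * n + 3) * a"
    proof (cases "b = 0")
      case False
      then have "b \<le> (weight a b + 1) * a" using ratio_le_weight[OF a] by blast
      also have "\<dots> \<le> (2 * n + 3) * a" using wt[of n] by (intro mult_right_mono) (auto simp: ab)
      finally show ?thesis .
    qed simp
    then have "a + b \<le> (2 * n + 4) * a" by (simp add: algebra_simps)
    then have "real (a + b) \<le> (2 * real n + 4) * real a"
      by (metis (no_types, opaque_lifting) of_nat_add of_nat_le_iff of_nat_mult of_nat_numeral)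
    then have "ln (real (a + b)) \<le> ln ((2 * real n + 4) * real a)"
      using a by (intro ln_mono) auto
    then have "ln (real (a + b)) \<le> ln (2 * real n + 4) + ln (real a)"
      using a by (subst (asm) ln_mult) auto
    moreover have "ln (real a) \<le> ln (real (a + b))" using a by (intro ln_mono) auto
    ultimately have "\<bar>ln_size (u n) - ln (real (fst (u n)))\<bar> \<le> ln (2 * real n + 4)"
      by (simp add: ab ln_size_def)
    also have "\<dots> \<le> ln (6 * real n)" using elim by (intro ln_mono) auto
    also have "\<dots> = ln 6 + ln (real n)" using elim by (simp add: ln_mult)
    finally have "\<bar>ln_size (u n) - ln (real (fst (u n)))\<bar> / real n \<le> (ln 6 + ln (real n)) / real n"
      by (intro divide_right_mono) auto
    then show ?case by (simp add: diff_divide_distrib[symmetric] add_divide_distrib)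
  qed
  have "(\<lambda>n. ln 6 / real n + ln (real n) / real n) \<longlonglongrightarrow> 0 + 0"
    by (intro tendsto_add lim_const_over_n lim_ln_over_n)
  then have "(\<lambda>n. ln 6 / real n + ln (real n) / real n) \<longlonglongrightarrow> 0" by simp
  from tendsto_diff[OF lim Lim_null_comparison[OF close this]] show ?thesis by simp
qed

definition pot :: "real \<Rightarrow> nat \<Rightarrow> nat \<Rightarrow> real" where
  "pot a u v = stat a (\<lambda>y. ln (real u + real v * y))"

context
  fixes a :: real
  assumes a: "1/2 \<le> a" "a \<le> 1"
begin

text \<open>At \<open>y = 1\<close> the averaged function equals \<open>ln_size (u, v)\<close>, and
  it is Lipschitz with constant 1 in \<open>ln y\<close>.\<close>

lemma pot_near: 
  assumes "u \<noteq> 0 \<or> v \<noteq> 0"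
  shows "\<bar>pot a u v - ln_size (u, v)\<bar> \<le> 8 * ln 2"
  using stat_near_1[OF a log_lip_ln_affine[of u v]] assms
  by (auto simp: pot_def ln_size_def)

text \<open>The averaged function is the logarithm of the inner product of \<open>(u, v)\<close> and
  \<open>(1, y)\<close>. The matrices of A and B are symmetric, so a step in \<open>y\<close> moves
  over to \<open>(u, v)\<close>, and the potential is harmonic up to the constant
  \<open>lyap a\<close>.\<close>

lemma pot_step:
  assumes uv: "u \<noteq> 0 \<or> v \<noteq> 0"
  shows "a * pot a v (u + v) + (1 - a) * pot a (u + v) u = pot a u v + lyap a"
proof -
  have ll: "log_lipschitz (\<lambda>y. ln (real u + real v * y))" "log_lipschitz (\<lambda>y. ln (real v + real (u + v) * y))"
    "log_lipschitz (\<lambda>y. ln (real (u + v) + real u * y))"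
    using uv by (auto intro!: log_lipschitz_ln_affine)
  have pos: "0 < real m + real n * y" if "m \<noteq> 0 \<or> n \<noteq> 0" "0 < y" for m n :: nat and y :: real
    using that by (auto intro: add_pos_nonneg add_nonneg_pos)
  have "pot a u v = a * stat a (\<lambda>y. ln (real u + real v * (1 + 1/y))) + (1 - a) * stat a (\<lambda>y. ln (real u + real v * (1/(1+y))))"
    unfolding pot_def by (rule stat_step[OF a ll(1)])
  also have "stat a (\<lambda>y. ln (real u + real v * (1 + 1/y))) = stat a (\<lambda>y. ln (real v + real (u + v) * y) - ln y)"
  proof (rule stat_cong[OF a log_lipschitz_intros(6)[OF ll(1)] log_lipschitz_intros(4)[OF ll(2) log_lipschitz_intros(2)]])
    fix y :: real assume y: "0 < y"
    have "real u + real v * (1 + 1/y) = (real v + real (u + v) * y) / y" using y by (simp add: field_simps)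
    then show "ln (real u + real v * (1 + 1/y)) = ln (real v + real (u + v) * y) - ln y"
      using pos[of v "u + v" y] uv y by (simp add: ln_div del: of_nat_add)
  qed
  also have "\<dots> = pot a v (u + v) - mean_ln a"
    unfolding pot_def mean_ln_def by (rule stat_diff[OF a ll(2) log_lipschitz_intros(2)])
  also have "stat a (\<lambda>y. ln (real u + real v * (1/(1+y)))) = stat a (\<lambda>y. ln (real (u + v) + real u * y) - ln (1 + y))"
  proof (rule stat_cong[OF a log_lipschitz_intros(7)[OF ll(1)] log_lipschitz_intros(4)[OF ll(3) log_lipschitz_ln1]])
    fix y :: real assume y: "0 < y"
    have "real u + real v * (1/(1+y)) = (real (u + v) + real u * y) / (1 + y)" using y by (simp add: field_simps)
    moreover have "0 < real (u + v) + real u * y" using pos[of "u + v" u y] uv y by auto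
    ultimately show "ln (real u + real v * (1/(1+y))) = ln (real (u + v) + real u * y) - ln (1 + y)"
      using y by (simp add: ln_div del: of_nat_add)
  qed
  also have "\<dots> = pot a (u + v) u - mean_ln1 a"
    unfolding pot_def mean_ln1_def by (rule stat_diff[OF a ll(3) log_lipschitz_ln1])
  finally show ?thesis by (simp add: lyap_def algebra_simps)
qed

lemma pot_special:
  shows "pot a u 0 = ln u"
    and "0 < v \<Longrightarrow> pot a 0 v = ln v + mean_ln a"
    and "0 < v \<Longrightarrow> pot a v v = ln v + mean_ln1 a"
proof -
  show "pot a u 0 = ln u" by (simp add: pot_def stat_const[OF a])
  assume v: "0 < v"
  have "pot a 0 v = stat a (\<lambda>y. ln v + ln y)"
    unfolding pot_def using v log_lipschitz_ln_affine[of 0 v]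
    by (intro stat_cong[OF a] log_lipschitz_intros) (auto simp: ln_mult)
  then show "pot a 0 v = ln v + mean_ln a"
    by (simp add: stat_add[OF a] stat_const[OF a] log_lipschitz_intros mean_ln_def)
  have "pot a v v = stat a (\<lambda>y. ln v + ln (1 + y))"
    unfolding pot_def
  proof (rule stat_cong[OF a])
    show "log_lipschitz (\<lambda>y. ln (real v + real v * y))" using log_lipschitz_ln_affine[of v v] v by simp
    show "log_lipschitz (\<lambda>y. ln (real v) + ln (1 + y))" by (intro log_lipschitz_intros log_lipschitz_ln1)
    fix y :: real assume "0 < y"
    moreover have "real v + real v * y = real v * (1 + y)" by (simp add: algebra_simps)
    ultimately show "ln (real v + real v * y) = ln (real v) + ln (1 + y)" using v by (simp only: ln_mult) (simp add: ln_mult)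
  qed
  then show "pot a v v = ln v + mean_ln1 a"
    by (simp add: stat_add[OF a] stat_const[OF a] log_lipschitz_intros log_lipschitz_ln1 mean_ln1_def)
qed

end

section \<open>The non-linear case\<close>

text \<open>The third term uses the sign of index 1, hence the shifted signs on the right.\<close>

lemma nonlin_fib_walk:
  "nonlin_fib s (Suc n) = int (fst (walk nat_step (1, 1) (\<lambda>k. s (Suc k)) n)) \<and>
   nonlin_fib s (Suc (Suc n)) = int (snd (walk nat_step (1, 1) (\<lambda>k. s (Suc k)) n))"
proof (induction n)
  case (Suc n)
  obtain a b where "walk nat_step (1, 1) (\<lambda>k. s (Suc k)) n = (a, b)" by fastforce
  with Suc show ?case by (cases "s (Suc n)") (auto simp: of_nat_diff)
qed simp

lemma LIMSEQ_shift_average: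
  fixes f :: "nat \<Rightarrow> real"
  assumes "(\<lambda>n. f (Suc n) / real n) \<longlonglongrightarrow> c"
  shows "(\<lambda>n. (1 / real n) * f n) \<longlonglongrightarrow> c"
proof (rule LIMSEQ_imp_Suc)
  have "(\<lambda>n. f (Suc n) / real n * (real n / real (Suc n))) \<longlonglongrightarrow> c * 1"
    by (intro tendsto_mult assms LIMSEQ_n_over_Suc_n)
  then have lim: "(\<lambda>n. f (Suc n) / real n * (real n / real (Suc n))) \<longlonglongrightarrow> c" by simp
  have "\<forall>\<^sub>F n in sequentially. f (Suc n) / real n * (real n / real (Suc n)) = (1 / real (Suc n)) * f (Suc n)"
    using eventually_gt_at_top[of 0] by eventually_elim simp
  from Lim_transform_eventually[OF lim this]
  show "(\<lambda>n. (1 / real (Suc n)) * f (Suc n)) \<longlonglongrightarrow> c" .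
qed

lemma has_growth_rate_nonlinI:
  assumes "AE s in signs p. (\<lambda>n. ln (real (fst (walk nat_step (1, 1) s n))) / real n) \<longlonglongrightarrow> c"
  shows "has_growth_rate p nonlin_fib c"
  unfolding has_growth_rate_def using AE_signs_shift[OF assms]
proof eventually_elim
  case (elim s)
  then have "(\<lambda>n. ln (real_of_int (nonlin_fib s (Suc n))) / real n) \<longlonglongrightarrow> c"
    by (simp add: nonlin_fib_walk)
  then show ?case by (rule LIMSEQ_shift_average)
qed

lemma LIMSEQ_bounded_diff_average:
  fixes f g :: "nat \<Rightarrow> real"
  assumes "\<And>n. \<bar>f n - g n\<bar> \<le> C" "(\<lambda>n. f n / real n) \<longlonglongrightarrow> c"
  shows "(\<lambda>n. g n / real n) \<longlonglongrightarrow> c"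
proof -
  have "(\<lambda>n. f n / real n - g n / real n) \<longlonglongrightarrow> 0"
  proof (rule Lim_null_comparison)
    show "\<forall>\<^sub>F n in sequentially. norm (f n / real n - g n / real n) \<le> C / real n"
      using assms(1) by (intro always_eventually) (auto simp: diff_divide_distrib[symmetric] divide_right_mono)
    show "(\<lambda>n. C / real n) \<longlonglongrightarrow> 0" by (rule lim_const_over_n)
  qed
  from tendsto_diff[OF assms(2) this] show ?thesis by simp
qed

text \<open>Away from weight zero the mean increment is at most \<open>3 p - 1 \<le> 0\<close>, so the exponential moments of
  the weight grow at an arbitrarily small rate.\<close>

lemma weight_sublinear:
  assumes p: "0 \<le> p" "p \<le> 1/3" and e: "0 < e"
  shows "AE s in signs p. \<forall>\<^sub>F n in sequentially. real (case_prod weight (walk nat_step v s n)) \<le> e * real n"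
proof -
  \<comment> \<open>The bound 1/2 keeps \<open>2 * l\<close> within the range of
    \<open>exp_le_quadratic\<close>, and \<open>4 * l < e\<close> places the growth exponent
    \<open>4 l^2\<close> below \<open>l e\<close>.\<close>
  define l where "l = min (1/2) (e / 8)"
  have l: "0 < l" "l \<le> 1/2" "4 * l < e" using e by (auto simp: l_def)
  define r where "r = 1 + 4 * l\<^sup>2"
  \<comment> \<open>Accounts for pairs of weight zero, where a minus need not lower the
    weight.\<close>
  define c where "c = exp (2 * l)"
  define g where "g = (\<lambda>v. real (case_prod weight v))"
  have step: "p * exp (l * g (nat_step v True)) + (1 - p) * exp (l * g (nat_step v False)) \<le> r * exp (l * g v) + c" for v
  proof -
    obtain a b where v: "v = (a, b)" by fastforce
    have up: "exp (l * g (nat_step v s)) \<le> exp (2 * l) * exp (l * g v)" for s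
    proof -
      have "g (nat_step v s) \<le> g v + 2" using weight_nat_step[of v s] by (simp add: g_def)
      then have "l * g (nat_step v s) \<le> l * (g v + 2)" using l by (intro mult_left_mono) auto
      then show ?thesis by (simp add: exp_add[symmetric] algebra_simps)
    qed
    show ?thesis
    proof (cases "weight a b = 0")
      case True
      then have "exp (l * g (nat_step v s)) \<le> c" for s using up[of s] by (simp add: g_def v c_def)
      then have "p * exp (l * g (nat_step v True)) + (1 - p) * exp (l * g (nat_step v False)) \<le> p * c + (1 - p) * c"
        using p by (intro add_mono mult_left_mono) auto
      also have "\<dots> \<le> r * exp (l * g v) + c" by (simp add: r_def algebra_simps)
      finally show ?thesis .
    next
      case False
      have down: "exp (l * g (nat_step v False)) \<le> exp (- l) * exp (l * g v)"
      proof -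
        have "g (nat_step v False) \<le> g v - 1" using weight_minus[of a b] False by (simp add: g_def v)
        then have "l * g (nat_step v False) \<le> l * (g v - 1)" using l by (intro mult_left_mono) auto
        then show ?thesis by (simp add: exp_add[symmetric] algebra_simps)
      qed
      have "p * exp (l * g (nat_step v True)) + (1 - p) * exp (l * g (nat_step v False))
          \<le> p * (exp (2 * l) * exp (l * g v)) + (1 - p) * (exp (- l) * exp (l * g v))"
        using p up[of True] down by (intro add_mono mult_left_mono) auto
      also have "\<dots> = (p * exp (2 * l) + (1 - p) * exp (- l)) * exp (l * g v)" by (simp add: algebra_simps)
      also have "\<dots> \<le> r * exp (l * g v)"
      proof (rule mult_right_mono)
        have "p * exp (2 * l) + (1 - p) * exp (- l) \<le> p * (1 + 2 * l + (2 * l)\<^sup>2) + (1 - p) * (1 + - l + (- l)\<^sup>2)"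
          using p l by (intro add_mono mult_left_mono exp_le_quadratic) auto
        also have "\<dots> = 1 + (3 * p - 1) * l + (1 + 3 * p) * l\<^sup>2" by (simp add: power2_eq_square algebra_simps)
        also have "\<dots> \<le> 1 + 0 + 4 * l\<^sup>2"
          using p l by (intro add_mono mult_right_mono) (auto simp: mult_nonpos_nonneg)
        finally show "p * exp (2 * l) + (1 - p) * exp (- l) \<le> r" by (simp add: r_def)
      qed simp
      also have "\<dots> \<le> r * exp (l * g v) + c" by (simp add: c_def)
      finally show ?thesis .
    qed
  qed
  have "walk_mean p nat_step n (\<lambda>v. exp (l * g v)) v \<le> (exp (l * g v) + c) * (real n + 1) * r ^ n" for n
  proof -
    have "walk_mean p nat_step n (\<lambda>v. exp (l * g v)) v \<le> (exp (l * g v) + real n * c) * r ^ n"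
      by (rule walk_mean_growth[where S = UNIV and g = "\<lambda>v. exp (l * g v)"]) (use p step in \<open>auto simp: r_def c_def\<close>)
    also have "\<dots> \<le> ((exp (l * g v) + c) * (real n + 1)) * r ^ n"
      by (intro mult_right_mono) (auto simp: r_def c_def algebra_simps)
    finally show ?thesis .
  qed
  moreover have "r < exp (l * e)"
  proof -
    have "r \<le> exp (4 * l\<^sup>2)" unfolding r_def by (rule exp_ge_add_one_self)
    also have "4 * l\<^sup>2 < l * e" using l mult_strict_left_mono[of "4 * l" e l] by (simp add: power2_eq_square)
    finally show ?thesis by simp
  qed
  moreover have "0 < r" by (simp add: r_def add_pos_nonneg)
  ultimately have "AE s in signs p. \<forall>\<^sub>F n in sequentially. g (walk nat_step v s n) \<le> e * real n"
    using p l by (intro walk_eventually_le[where l = l and r = r and K = "exp (l * g v) + c"]) auto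
  then show ?thesis by (simp add: g_def)
qed

text \<open>Consecutive terms are coprime, so by \<open>sum_le_weight\<close> the logarithm of a
  term is at most the weight, which is sublinear. Vanishing terms satisfy the same bounds through
  \<open>ln 0 = 0\<close>.\<close>

lemma nonlin_growth_rate_small:
  assumes p: "0 < p" "p \<le> 1/3"
  shows "has_growth_rate p nonlin_fib 0"
proof (rule has_growth_rate_nonlinI)
  have "AE s in signs p. \<forall>k. \<forall>\<^sub>F n in sequentially.
      real (case_prod weight (walk nat_step (1, 1) s n)) \<le> 1 / real (Suc k) * real n"
    unfolding AE_all_countable by (intro allI weight_sublinear) (use p in auto)
  then show "AE s in signs p. (\<lambda>n. ln (real (fst (walk nat_step (1, 1) s n))) / real n) \<longlonglongrightarrow> 0"
  proof eventually_elim
    case (elim s)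
    have bound: "0 \<le> ln (real (fst (walk nat_step (1, 1) s n)))
        \<and> ln (real (fst (walk nat_step (1, 1) s n))) \<le> real (case_prod weight (walk nat_step (1, 1) s n))" for n
    proof -
      obtain a b where ab: "walk nat_step (1, 1) s n = (a, b)" by fastforce
      have "case_prod coprime (walk nat_step (1, 1) s n)"
      proof (induction n)
        case (Suc n)
        show ?case using coprime_nat_step[OF Suc] by simp
      qed simp
      then have "gcd a b = 1" unfolding ab by simp
      then have le: "a \<le> 2 ^ weight a b" using sum_le_weight[of a b] by simp
      have "ln (real a) \<le> real (weight a b)"
      proof (cases "a = 0")
        case False
        have "real a \<le> 2 ^ weight a b" using le by (metis of_nat_le_iff of_nat_numeral of_nat_power)
        then have "ln (real a) \<le> ln (2 ^ weight a b)" using False by (intro ln_mono) auto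
        also have "\<dots> = real (weight a b) * ln 2" by (simp add: ln_realpow)
        also have "\<dots> \<le> real (weight a b) * 1" using ln_le_minus_one[of 2] by (intro mult_left_mono) auto
        finally show ?thesis by simp
      qed simp
      moreover have "0 \<le> ln (real a)" by (cases "a = 0") auto
      ultimately show ?thesis unfolding ab by simp
    qed
    show ?case
    proof (rule tendstoI)
      fix e :: real assume "0 < e"
      then obtain k where k: "1 / real (Suc k) < e" by (rule nat_approx_posE)
      from elim have "\<forall>\<^sub>F n in sequentially.
          real (case_prod weight (walk nat_step (1, 1) s n)) \<le> 1 / real (Suc k) * real n" by blast
      then show "\<forall>\<^sub>F n in sequentially. dist (ln (real (fst (walk nat_step (1, 1) s n))) / real n) 0 < e"
        using eventually_gt_at_top[of 0]
      proof eventually_elim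
        case (elim n)
        then have "ln (real (fst (walk nat_step (1, 1) s n))) \<le> 1 / real (Suc k) * real n"
          using bound[of n] by linarith
        then have "ln (real (fst (walk nat_step (1, 1) s n))) / real n \<le> 1 / real (Suc k)"
          using elim by (simp only: pos_divide_le_eq of_nat_0_less_iff)
        moreover have "0 \<le> ln (real (fst (walk nat_step (1, 1) s n))) / real n"
          using bound[of n] by simp
        ultimately show ?case using k by (simp only: dist_real_def diff_0_right abs_of_nonneg)
      qed
    qed
  qed
qed

section \<open>A potential with constant drift for the non-linear recursion\<close>

abbreviation nat_minus :: "nat \<times> nat \<Rightarrow> nat \<times> nat" where
  "nat_minus v \<equiv> nat_step v False"

text \<open>The mean of the potential after a geometrically distributed number of minus
  steps.\<close>

definition resolvent :: "real \<Rightarrow> real \<Rightarrow> nat \<times> nat \<Rightarrow> real" where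
  "resolvent a t v = (1 - t) * (\<Sum>k. t ^ k * case_prod (pot a) ((nat_minus ^^ k) v))"

context
  fixes a t :: real
  assumes a: "1/2 \<le> a" "a \<le> 1" and t: "0 \<le> t" "t < 1"
begin

text \<open>Each minus step moves \<open>ln_size\<close> by at most \<open>ln 2\<close>. The
  resulting linear growth in \<open>k\<close> is harmless against the weights
  \<open>t ^ k\<close>.\<close>

lemma pot_iterate_near:
  assumes "v \<noteq> (0, 0)"
  shows "\<bar>case_prod (pot a) ((nat_minus ^^ k) v) - ln_size v\<bar> \<le> (8 + real k) * ln 2"
proof -
  have nz: "(nat_minus ^^ k) v \<noteq> (0, 0)" for k
    by (induction k) (use assms nat_step_nonzero in auto)
  have "\<bar>ln_size ((nat_minus ^^ k) v) - ln_size v\<bar> \<le> real k * ln 2"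
  proof (induction k)
    case (Suc k)
    have "\<bar>ln_size (nat_minus ((nat_minus ^^ k) v)) - ln_size ((nat_minus ^^ k) v)\<bar> \<le> ln 2"
      by (rule ln_size_nat_step[OF nz])
    then show ?case using Suc by (simp add: algebra_simps)
  qed simp
  moreover have "\<bar>case_prod (pot a) w - ln_size w\<bar> \<le> 8 * ln 2" if "w \<noteq> (0, 0)" for w
    using pot_near[OF a, of "fst w" "snd w"] that by (cases w) auto
  from this[OF nz[of k]] have "\<bar>case_prod (pot a) ((nat_minus ^^ k) v) - ln_size ((nat_minus ^^ k) v)\<bar> \<le> 8 * ln 2" .
  ultimately show ?thesis by (simp add: algebra_simps)
qed

lemma summable_weights: "summable (\<lambda>k. t ^ k * ((8 + real k) * ln 2))"
proof -
  have "summable (\<lambda>k. of_nat (Suc k) * t ^ k)"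
    by (rule sums_summable[OF geometric_deriv_sums]) (use t in simp)
  moreover have "summable (\<lambda>k. t ^ k)" using t by (intro summable_geometric) simp
  ultimately have "summable (\<lambda>k. ln 2 * (of_nat (Suc k) * t ^ k) + 7 * ln 2 * t ^ k)"
    by (intro summable_add summable_mult)
  then show ?thesis by (simp add: algebra_simps)
qed

lemma summable_resolvent:
  assumes "v \<noteq> (0, 0)"
  shows "summable (\<lambda>k. t ^ k * (case_prod (pot a) ((nat_minus ^^ k) v) - ln_size v))"
    and "summable (\<lambda>k. t ^ k * case_prod (pot a) ((nat_minus ^^ k) v))"
proof -
  show 1: "summable (\<lambda>k. t ^ k * (case_prod (pot a) ((nat_minus ^^ k) v) - ln_size v))"
  proof (rule summable_comparison_test'[OF summable_weights, of 0])
    show "norm (t ^ k * (case_prod (pot a) ((nat_minus ^^ k) v) - ln_size v)) \<le> t ^ k * ((8 + real k) * ln 2)" for k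
      using pot_iterate_near[OF assms, of k] t by (simp add: abs_mult mult_left_mono)
  qed
  have "summable (\<lambda>k. t ^ k * ln_size v)" using t by (intro summable_mult2 summable_geometric) simp
  from summable_add[OF 1 this] show "summable (\<lambda>k. t ^ k * case_prod (pot a) ((nat_minus ^^ k) v))"
    by (simp add: algebra_simps)
qed

lemma resolvent_near:
  assumes "v \<noteq> (0, 0)"
  shows "\<bar>resolvent a t v - ln_size v\<bar> \<le> (1 - t) * (\<Sum>k. t ^ k * ((8 + real k) * ln 2))"
proof -
  have geo: "(\<Sum>k. t ^ k * ln_size v) = ln_size v / (1 - t)"
    using t by (subst suminf_mult2[symmetric]) (auto simp: suminf_geometric summable_geometric)
  have "(\<Sum>k. t ^ k * (case_prod (pot a) ((nat_minus ^^ k) v) - ln_size v))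
      = (\<Sum>k. t ^ k * case_prod (pot a) ((nat_minus ^^ k) v)) - (\<Sum>k. t ^ k * ln_size v)"
    using summable_resolvent(2)[OF assms] t
    by (subst suminf_diff) (auto intro!: summable_mult2 summable_geometric simp: algebra_simps)
  then have "resolvent a t v - ln_size v
      = (1 - t) * (\<Sum>k. t ^ k * (case_prod (pot a) ((nat_minus ^^ k) v) - ln_size v))"
    using t by (simp add: resolvent_def geo right_diff_distrib)
  moreover have "norm (\<Sum>k. t ^ k * (case_prod (pot a) ((nat_minus ^^ k) v) - ln_size v))
      \<le> (\<Sum>k. t ^ k * ((8 + real k) * ln 2))"
    using pot_iterate_near[OF assms] t
    by (intro norm_suminf_le summable_weights) (simp add: abs_mult mult_left_mono)
  ultimately show ?thesis using t by (simp add: abs_mult mult_left_mono)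
qed

lemma resolvent_rec:
  assumes "v \<noteq> (0, 0)"
  shows "resolvent a t v = (1 - t) * case_prod (pot a) v + t * resolvent a t (nat_minus v)"
proof -
  have s: "summable (\<lambda>k. t ^ k * case_prod (pot a) ((nat_minus ^^ k) (nat_minus v)))"
    by (rule summable_resolvent(2)[OF nat_step_nonzero[OF assms]])
  have "(\<Sum>k. t ^ k * case_prod (pot a) ((nat_minus ^^ k) v))
      = case_prod (pot a) v + (\<Sum>k. t ^ Suc k * case_prod (pot a) ((nat_minus ^^ Suc k) v))"
    using suminf_split_head[OF summable_resolvent(2)[OF assms]] by simp
  also have "(\<Sum>k. t ^ Suc k * case_prod (pot a) ((nat_minus ^^ Suc k) v))
      = (\<Sum>k. t * (t ^ k * case_prod (pot a) ((nat_minus ^^ k) (nat_minus v))))"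
    by (simp only: funpow_Suc_right comp_def power_Suc mult.assoc)
  also have "\<dots> = t * (\<Sum>k. t ^ k * case_prod (pot a) ((nat_minus ^^ k) (nat_minus v)))"
    by (rule suminf_mult[OF s])
  finally show ?thesis by (simp add: resolvent_def algebra_simps)
qed

text \<open>The drift is constant because a plus followed by two minuses is the identity.\<close>

lemma resolvent_drift:
  assumes v: "v \<noteq> (0, 0)" and at: "a = 1 / (1 + t)" and pt: "p * t * (1 + t) = 1 - p"
  shows "p * resolvent a t (nat_step v True) + (1 - p) * resolvent a t (nat_step v False)
    = resolvent a t v + mean_ln a"
proof -
  obtain x y where xy: "v = (x, y)" by fastforce
  define P where "P = case_prod (pot a)"
  define R where "R = resolvent a t"
  have nz: "(y, x + y) \<noteq> (0, 0)" "(x + y, x) \<noteq> (0, 0)" using v xy by auto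
  \<comment> \<open>After a plus, the first minus leads to \<open>(x + y, x)\<close> and the second
    one back to \<open>v\<close>, so two applications of \<open>resolvent_rec\<close> return to
    \<open>R v\<close>.\<close>
  have R1: "R (y, x + y) = (1 - t) * P (y, x + y) + t * R (x + y, x)"
    using resolvent_rec[OF nz(1)] by (simp add: R_def P_def)
  have R2: "R (x + y, x) = (1 - t) * P (x + y, x) + t * R v"
    using resolvent_rec[OF nz(2)] by (cases "y = 0") (simp_all add: R_def P_def xy)
  have R3: "R v = (1 - t) * P v + t * R (nat_minus v)"
    using resolvent_rec[OF v] by (simp add: R_def P_def)
  have "a * P (y, x + y) + (1 - a) * P (x + y, x) = P v + lyap a"
    using pot_step[OF a, of x y] v by (auto simp: P_def xy)
  moreover have "1 - a = t / (1 + t)" using at t by (simp add: field_simps)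
  ultimately have "(P (y, x + y) + t * P (x + y, x)) / (1 + t) = P v + lyap a"
    by (simp add: at add_divide_distrib)
  then have PP: "P (y, x + y) + t * P (x + y, x) = (1 + t) * (P v + lyap a)"
    using t by (simp add: field_simps)
  have "R (y, x + y) = (1 - t) * (P (y, x + y) + t * P (x + y, x)) + t\<^sup>2 * R v"
    unfolding R1 R2 by (simp add: power2_eq_square algebra_simps)
  then have plus: "R (y, x + y) = (1 - t\<^sup>2) * (P v + lyap a) + t\<^sup>2 * R v"
    unfolding PP by (simp add: power2_eq_square algebra_simps)
  \<comment> \<open>Writing \<open>1 - p\<close> as \<open>p * t * (1 + t)\<close> supplies the
    factor \<open>t\<close> that occurs in \<open>R3\<close>. There is no division by
    \<open>t\<close>, so \<open>t = 0\<close> is included.\<close>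
  have minus: "(1 - p) * R (nat_minus v) = p * (1 + t) * (R v - (1 - t) * P v)"
    using R3 unfolding pt[symmetric] by simp
  have one: "p * (1 + t + t\<^sup>2) = 1" using pt by (simp add: power2_eq_square algebra_simps)
  have "p * R (y, x + y) + (1 - p) * R (nat_minus v) = p * (1 + t + t\<^sup>2) * R v + p * (1 - t\<^sup>2) * lyap a"
    unfolding plus minus by (simp add: power2_eq_square algebra_simps)
  moreover have "p * (1 - t\<^sup>2) * lyap a = mean_ln a"
  proof -
    \<comment> \<open>Multiplication by \<open>(1 + t)^2\<close> turns the factors in
      \<open>mean_ln_lyap\<close> into \<open>1 + t + t^2\<close> and
      \<open>1 - t^2\<close>.\<close>
    have ta: "(1 + t) * a = 1" using at t by simp
    have "(1 + t)\<^sup>2 * (1 - a + a\<^sup>2) = (1 + t)\<^sup>2 - (1 + t) * ((1 + t) * a) + ((1 + t) * a)\<^sup>2"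
      by (simp add: power2_eq_square algebra_simps)
    then have e1: "(1 + t)\<^sup>2 * (1 - a + a\<^sup>2) = 1 + t + t\<^sup>2" unfolding ta by (simp add: power2_eq_square algebra_simps)
    have "(1 + t)\<^sup>2 * (2 * a - 1) = (1 + t) * (2 * ((1 + t) * a) - (1 + t))"
      by (simp add: power2_eq_square algebra_simps)
    then have e2: "(1 + t)\<^sup>2 * (2 * a - 1) = 1 - t\<^sup>2" unfolding ta by (simp add: power2_eq_square algebra_simps)
    have "(1 + t + t\<^sup>2) * mean_ln a = (1 + t)\<^sup>2 * ((1 - a + a\<^sup>2) * mean_ln a)" unfolding e1[symmetric] by simp
    also have "\<dots> = (1 - t\<^sup>2) * lyap a" unfolding mean_ln_lyap[OF a] e2[symmetric] by simp
    finally have "p * (1 + t + t\<^sup>2) * mean_ln a = p * (1 - t\<^sup>2) * lyap a" by simp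
    then show ?thesis unfolding one by simp
  qed
  ultimately show ?thesis unfolding one by (simp add: R_def xy)
qed

end

text \<open>The law of large numbers is applied to \<open>resolvent\<close> and transferred to
  \<open>ln_size\<close>. The condition \<open>1/3 < p\<close> enters twice: it gives
  \<open>t < 1\<close>, for summability, and a positive \<open>mean_ln a\<close>, for
  \<open>component_growth\<close>.\<close>

lemma nonlin_growth_rate_large:
  assumes p: "1/3 < p" "p \<le> 1"
  shows "has_growth_rate p nonlin_fib (mean_ln (alpha_nonlin p))"
proof (rule has_growth_rate_nonlinI)
  define a where "a = alpha_nonlin p"
  define t where "t = (1 - a) / a"
  define C where "C = (1 - t) * (\<Sum>k. t ^ k * ((8 + real k) * ln 2))"
  have a: "1/2 \<le> a" "a \<le> 1" using alpha_nonlin_bounds p by (auto simp: a_def)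
  have t: "p * t * (1 + t) = 1 - p" "a = 1 / (1 + t)" "0 \<le> t" "t < 1"
    using alpha_nonlin_eq[of p t] p by (auto simp: a_def t_def)
  note near = resolvent_near[OF a t(3,4), folded C_def]
  have "0 < mean_ln a"
    using alpha_nonlin_strict_mono[of "1/3" p] p mean_ln_strict_mono[of "1/2" a] a
    by (simp add: a_def alpha_nonlin_special mean_ln_half)
  moreover have "AE s in signs p. (\<lambda>n. resolvent a t (walk nat_step (1, 1) s n) / real n) \<longlonglongrightarrow> mean_ln a"
  proof (rule walk_law_of_large_numbers[where S = "- {(0, 0)}" and C = "2 * C + ln 2"])
    show "\<bar>resolvent a t (nat_step v b) - resolvent a t v\<bar> \<le> 2 * C + ln 2" if "v \<in> - {(0, 0)}" for v b
    proof -
      have "v \<noteq> (0, 0)" using that by simp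
      from near[OF this] near[OF nat_step_nonzero[OF this]] ln_size_nat_step[OF this, of b]
      show ?thesis by (smt (verit))
    qed
  qed (use p nat_step_nonzero resolvent_drift[OF a t(3,4) _ t(2,1)] in auto)
  ultimately show "AE s in signs p. (\<lambda>n. ln (real (fst (walk nat_step (1, 1) s n))) / real n) \<longlonglongrightarrow> mean_ln (alpha_nonlin p)"
    unfolding a_def[symmetric]
  proof (elim AE_mp, intro AE_I2 impI)
    fix s assume pos: "0 < mean_ln a"
      and lim: "(\<lambda>n. resolvent a t (walk nat_step (1, 1) s n) / real n) \<longlonglongrightarrow> mean_ln a"
    have nz: "walk nat_step (1, 1) s n \<noteq> (0, 0)" for n
      by (induction n) (simp_all add: nat_step_nonzero)
    have "(\<lambda>n. ln_size (walk nat_step (1, 1) s n) / real n) \<longlonglongrightarrow> mean_ln a"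
      by (rule LIMSEQ_bounded_diff_average[OF near[OF nz] lim])
    then show "(\<lambda>n. ln (real (fst (walk nat_step (1, 1) s n))) / real n) \<longlonglongrightarrow> mean_ln a"
      using pos by (intro component_growth[where u = "walk nat_step (1, 1) s"]) auto
  qed
qed

section \<open>The linear case\<close>

text \<open>The average of \<open>ln \<bar>u - v y\<bar>\<close>, which the linear recursion needs besides
  \<^const>\<open>pot\<close>. It is defined through the relations it must satisfy; this avoids
  integrating the singularity.\<close>

function signed_pot :: "real \<Rightarrow> nat \<Rightarrow> nat \<Rightarrow> real" where
  "signed_pot a u v = (if u = 0 \<or> v = 0 then pot a u v
     else if u \<le> v then a * pot a v (v - u) + (1 - a) * signed_pot a (v - u) u - lyap a
     else (1 - a) * pot a (u - v) u + a * signed_pot a v (u - v) - lyap a)"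
  by auto
termination by (relation "Wellfounded.measure (\<lambda>(a, u, v). u + v)") auto

declare signed_pot.simps [simp del]

lemma signed_pot_zero [simp]: "signed_pot a 0 v = pot a 0 v" "signed_pot a u 0 = pot a u 0"
  by (simp_all add: signed_pot.simps)

text \<open>The potential of two terms of equal sign, before normalisation. For opposite signs the
  weights \<open>a^2\<close> and \<open>1 - a\<close> are exchanged, which is
  \<open>pot_odd\<close>.\<close>

definition pot_even :: "real \<Rightarrow> nat \<Rightarrow> nat \<Rightarrow> real" where
  "pot_even a u v = a\<^sup>2 * pot a u v + (1 - a) * signed_pot a u v"

definition pot_odd :: "real \<Rightarrow> nat \<Rightarrow> nat \<Rightarrow> real" where
  "pot_odd a u v = (1 - a) * pot a u v + a\<^sup>2 * signed_pot a u v"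

text \<open>The potential of \<open>(v, v - u)\<close>, the pair that a minus reaches from
  \<open>(u, v)\<close>; its second entry is negative when \<open>v < u\<close>.\<close>

definition pot_minus :: "real \<Rightarrow> nat \<Rightarrow> nat \<Rightarrow> real" where
  "pot_minus a u v = (if u \<le> v then pot_even a v (v - u) else pot_odd a v (u - v))"

context
  fixes a :: real
  assumes a: "1/2 \<le> a" "a \<le> 1"
begin

text \<open>Formally a stationarity step: for \<open>u = d\<close> and \<open>v = c + d\<close>,
  substituting \<open>1 + 1/y\<close> and \<open>1/(1 + y)\<close> for \<open>y\<close> in
  \<open>u - v y\<close> gives, up to sign, \<open>(c + d + c y) / y\<close> and
  \<open>(c - d y) / (1 + y)\<close>. At \<open>d = 0\<close> the prescribed base value obeys the
  same relation, by \<open>mean_ln_mean_ln1\<close>.\<close>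

lemma signed_pot_A:
  assumes "c \<noteq> 0 \<or> d \<noteq> 0"
  shows "signed_pot a d (c + d) = a * pot a (c + d) c + (1 - a) * signed_pot a c d - lyap a"
proof (cases "d = 0")
  case True
  then show ?thesis
    using assms mean_ln_mean_ln1[OF a] by (simp add: pot_special[OF a] lyap_def algebra_simps)
next
  case False
  then show ?thesis by (simp add: signed_pot.simps[of a d "c + d"])
qed

text \<open>The companion relation for a first entry that is at least the second. Equal entries fall
  under the other branch of the recursion, but fit here because \<open>signed_pot\<close> equals
  \<open>pot\<close> at zero entries.\<close>

lemma signed_pot_B:
  assumes "c \<noteq> 0 \<or> d \<noteq> 0"
  shows "signed_pot a (c + d) c = (1 - a) * pot a d (c + d) + a * signed_pot a c d - lyap a"
proof -
  consider "c = 0" | "0 < c" "d = 0" | "0 < c" "0 < d" by blast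
  then show ?thesis
  proof cases
    case 1
    then show ?thesis
      using assms mean_ln_mean_ln1[OF a] by (simp add: pot_special[OF a] lyap_def algebra_simps)
  next
    case 2
    then have "signed_pot a c c = a * pot a c 0 + (1 - a) * pot a 0 c - lyap a"
      by (simp add: signed_pot.simps[of a c c])
    then show ?thesis using 2 by (simp add: pot_special[OF a] algebra_simps)
  next
    case 3
    then show ?thesis by (simp add: signed_pot.simps[of a "c + d" c])
  qed
qed

text \<open>Once \<open>signed_pot_A\<close> is inserted, the two terms with \<open>pot\<close> are
  \<open>a\<close> times the left-hand side of \<open>pot_step\<close>.\<close>

lemma pot_even_plus:
  assumes "x \<noteq> 0 \<or> y \<noteq> 0"
  shows "pot_even a y (x + y) = a * pot a x y + (1 - a)\<^sup>2 * signed_pot a x y + (2 * a - 1) * lyap a"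
proof -
  have "pot_even a y (x + y) = a * (a * pot a y (x + y) + (1 - a) * pot a (x + y) x)
      + (1 - a)\<^sup>2 * signed_pot a x y - (1 - a) * lyap a"
    unfolding pot_even_def signed_pot_A[OF assms] by (simp add: power2_eq_square algebra_simps)
  then show ?thesis unfolding pot_step[OF a assms] by (simp add: algebra_simps)
qed

text \<open>The counterpart of \<open>pot_even_plus\<close> with \<open>pot\<close> and
  \<open>signed_pot\<close> exchanged on the right. The same formula results for both orders of
  \<open>x\<close> and \<open>y\<close>, although the pair after the minus has different
  signs.\<close>

lemma pot_minus_eq:
  assumes "x \<noteq> 0 \<or> y \<noteq> 0"
  shows "pot_minus a x y = a * signed_pot a x y + (1 - a)\<^sup>2 * pot a x y + (2 * a - 1) * lyap a"
proof (cases "x \<le> y")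
  case True
  define c where "c = y - x"
  have y: "y = c + x" using True by (simp add: c_def)
  have cx: "c \<noteq> 0 \<or> x \<noteq> 0" using assms by (auto simp: y)
  have m: "pot_minus a x (c + x) = pot_even a (c + x) c" by (simp add: pot_minus_def)
  have "pot_even a (c + x) c = a * (a * pot a (c + x) c + (1 - a) * signed_pot a c x)
      + (1 - a)\<^sup>2 * pot a x (c + x) - (1 - a) * lyap a"
    unfolding pot_even_def signed_pot_B[OF cx] by (simp add: power2_eq_square algebra_simps)
  also have "a * pot a (c + x) c + (1 - a) * signed_pot a c x = signed_pot a x (c + x) + lyap a"
    unfolding signed_pot_A[OF cx] by simp
  finally show ?thesis unfolding y m by (simp add: algebra_simps)
next
  case False
  define d where "d = x - y"
  have x: "x = y + d" and d: "0 < d" using False by (auto simp: d_def)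
  then have yd: "y \<noteq> 0 \<or> d \<noteq> 0" by simp
  have m: "pot_minus a (y + d) y = pot_odd a y d" using d by (simp add: pot_minus_def)
  have "a * signed_pot a y d = signed_pot a (y + d) y - (1 - a) * pot a d (y + d) + lyap a"
    unfolding signed_pot_B[OF yd] by simp
  then have "pot_odd a y d = (1 - a) * pot a y d + a * (signed_pot a (y + d) y - (1 - a) * pot a d (y + d) + lyap a)"
    by (simp add: pot_odd_def power2_eq_square)
  also have "pot a y d = a * pot a d (y + d) + (1 - a) * pot a (y + d) y - lyap a"
    using pot_step[OF a yd] by simp
  finally show ?thesis unfolding x m by (simp add: power2_eq_square algebra_simps)
qed

text \<open>Errors contract along the recursion, because the recursive call has a weight of at most
  \<open>a < 1\<close>. \<open>M\<close> collects \<open>8 * ln 2\<close> from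
  \<open>pot_near\<close>, \<open>ln 2\<close> for the change of size and \<open>lyap a\<close>; the
  bound \<open>K\<close> is the solution of \<open>M + a * K = K\<close>.\<close>

lemma signed_pot_near:
  assumes a1: "a < 1"
  shows "u \<noteq> 0 \<or> v \<noteq> 0 \<Longrightarrow> \<bar>signed_pot a u v - ln_size (u, v)\<bar> \<le> (9 * ln 2 + lyap a) / (1 - a)"
proof (induction "u + v" arbitrary: u v rule: less_induct)
  case less
  define M where "M = 9 * ln 2 + lyap a"
  define K where "K = M / (1 - a)"
  have M: "0 \<le> M" using lyap_pos[OF a] by (simp add: M_def add_nonneg_nonneg)
  have "M = (1 - a) * K" using a1 by (simp add: K_def)
  then have KA: "M + a * K = K" by (simp add: algebra_simps)
  have K0: "0 \<le> K" using M a1 by (simp add: K_def)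
  have "(1 - a) * K \<le> a * K" using a K0 by (intro mult_right_mono) auto
  then have KB: "M + (1 - a) * K \<le> K" using KA by simp
  have near: "\<bar>pot a m n - ln_size (u, v)\<bar> \<le> 9 * ln 2"
    if "m + n \<le> 2 * (u + v)" "u + v \<le> 2 * (m + n)" "0 < m + n" for m n
  proof -
    have "\<bar>ln_size (m, n) - ln_size (u, v)\<bar> \<le> ln 2"
      unfolding ln_size_def using that less.prems by (intro ln_ratio_le) auto
    then show ?thesis using pot_near[OF a, of m n] that by auto
  qed
  have IH: "\<bar>signed_pot a m n - ln_size (u, v)\<bar> \<le> K + ln 2"
    if "m + n < u + v" "u + v \<le> 2 * (m + n)" "0 < m + n" for m n
  proof -
    have "\<bar>ln_size (m, n) - ln_size (u, v)\<bar> \<le> ln 2"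
      unfolding ln_size_def using that less.prems by (intro ln_ratio_le) auto
    moreover have "\<bar>signed_pot a m n - ln_size (m, n)\<bar> \<le> K"
      using less.hyps[of m n] that by (auto simp: K_def M_def)
    ultimately show ?thesis by linarith
  qed
  have comb: "\<bar>c * X + (1 - c) * Y - lyap a - z\<bar> \<le> M + (1 - c) * K"
    if "0 \<le> c" "c \<le> 1" "\<bar>X - z\<bar> \<le> 9 * ln 2" "\<bar>Y - z\<bar> \<le> K + ln 2" for c X Y z
  proof -
    have "c * X + (1 - c) * Y - lyap a - z = c * (X - z) + (1 - c) * (Y - z) - lyap a"
      by (simp add: algebra_simps)
    moreover have "\<bar>c * (X - z)\<bar> \<le> c * (9 * ln 2)" "\<bar>(1 - c) * (Y - z)\<bar> \<le> (1 - c) * (K + ln 2)"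
      using that by (simp_all add: abs_mult mult_left_mono)
    moreover have "c * (9 * ln 2) + (1 - c) * (K + ln 2) \<le> 9 * ln 2 + (1 - c) * K"
      using that mult_right_mono[of 0 "1 - c" "8 * ln 2"] by (simp add: algebra_simps)
    ultimately show ?thesis using lyap_pos[OF a] unfolding M_def by linarith
  qed
  consider "u = 0 \<or> v = 0" | "0 < u" "u \<le> v" | "0 < v" "v < u" by linarith
  then have "\<bar>signed_pot a u v - ln_size (u, v)\<bar> \<le> K"
  proof cases
    case 1
    then have "\<bar>signed_pot a u v - ln_size (u, v)\<bar> \<le> 8 * ln 2"
      using pot_near[OF a less.prems] by auto
    moreover have "8 * ln 2 \<le> M" using lyap_pos[OF a] by (simp add: M_def)
    moreover have "M \<le> K" using KA a mult_nonneg_nonneg[OF _ K0, of a] by linarith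
    ultimately show ?thesis by linarith
  next
    case 2
    then have "signed_pot a u v = a * pot a v (v - u) + (1 - a) * signed_pot a (v - u) u - lyap a"
      by (simp add: signed_pot.simps[of a u v])
    moreover have "\<bar>a * pot a v (v - u) + (1 - a) * signed_pot a (v - u) u - lyap a - ln_size (u, v)\<bar>
        \<le> M + (1 - a) * K"
      using a 2 by (intro comb near IH) auto
    ultimately show ?thesis using KB by simp
  next
    case 3
    then have "signed_pot a u v = (1 - a) * pot a (u - v) u + (1 - (1 - a)) * signed_pot a v (u - v) - lyap a"
      by (simp add: signed_pot.simps[of a u v])
    moreover have "\<bar>(1 - a) * pot a (u - v) u + (1 - (1 - a)) * signed_pot a v (u - v) - lyap a - ln_size (u, v)\<bar>
        \<le> M + (1 - (1 - a)) * K"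
      using a 3 by (intro comb near IH) auto
    ultimately show ?thesis using KA by simp
  qed
  then show ?case by (simp add: K_def M_def)
qed

end

section \<open>A potential with constant drift for the linear recursion\<close>

fun lin_step :: "int \<times> int \<Rightarrow> bool \<Rightarrow> int \<times> int" where
  "lin_step (a, b) s = (b, if s then b + a else b - a)"

definition nat_abs :: "int \<times> int \<Rightarrow> nat \<times> nat" where
  "nat_abs v = (nat \<bar>fst v\<bar>, nat \<bar>snd v\<bar>)"

lemma nat_abs_eq_zero [simp]: "nat_abs v = (0, 0) \<longleftrightarrow> v = (0, 0)"
  by (cases v) (auto simp: nat_abs_def)

lemma lin_step_nonzero: "v \<noteq> (0, 0) \<Longrightarrow> lin_step v s \<noteq> (0, 0)"
  by (cases v) auto

lemma nat_abs_same_sign: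
  fixes x y :: int
  assumes "0 \<le> x * y"
  shows "nat \<bar>y + x\<bar> = nat \<bar>x\<bar> + nat \<bar>y\<bar>"
    and "nat \<bar>y - x\<bar> = (if nat \<bar>x\<bar> \<le> nat \<bar>y\<bar> then nat \<bar>y\<bar> - nat \<bar>x\<bar> else nat \<bar>x\<bar> - nat \<bar>y\<bar>)"
proof -
  have "0 \<le> x \<and> 0 \<le> y \<or> x \<le> 0 \<and> y \<le> 0" using assms by (simp add: zero_le_mult_iff)
  then show "nat \<bar>y + x\<bar> = nat \<bar>x\<bar> + nat \<bar>y\<bar>"
    "nat \<bar>y - x\<bar> = (if nat \<bar>x\<bar> \<le> nat \<bar>y\<bar> then nat \<bar>y\<bar> - nat \<bar>x\<bar> else nat \<bar>x\<bar> - nat \<bar>y\<bar>)"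
    by auto
qed

text \<open>For entries of opposite signs plus and minus exchange their effect on the absolute
  values. These therefore follow \<open>nat_step\<close> along some other sign sequence, as
  \<open>component_growth\<close> allows.\<close>

lemma nat_abs_lin_step: "\<exists>b. nat_abs (lin_step v s) = nat_step (nat_abs v) b"
proof -
  obtain x y where v: "v = (x, y)" by fastforce
  show ?thesis
  proof (cases "0 \<le> x * y")
    case True
    then show ?thesis
      using nat_abs_same_sign[OF True] by (intro exI[of _ s]) (cases s; simp add: v nat_abs_def)
  next
    case False
    then have "0 \<le> - x * y" by simp
    from nat_abs_same_sign[OF this] show ?thesis
      by (intro exI[of _ "\<not> s"]) (cases s; simp add: v nat_abs_def)
  qed
qed

lemma lin_fib_walk:
  "walk lin_step (1, 1) (\<lambda>k. s (Suc k)) n = (lin_fib s (Suc n), lin_fib s (Suc (Suc n)))"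
  by (induction n) auto

definition lin_pot :: "real \<Rightarrow> int \<times> int \<Rightarrow> real" where
  "lin_pot a v = (if 0 \<le> fst v * snd v then case_prod (pot_even a) (nat_abs v)
     else case_prod (pot_odd a) (nat_abs v)) / (1 - a + a\<^sup>2)"

lemma lin_pot_plus:
  assumes "0 \<le> x * y"
  shows "lin_pot a (y, y + x) = pot_even a (nat \<bar>y\<bar>) (nat \<bar>x\<bar> + nat \<bar>y\<bar>) / (1 - a + a\<^sup>2)"
proof -
  have "0 \<le> y * (y + x)" using assms by (simp add: algebra_simps)
  then show ?thesis using nat_abs_same_sign(1)[OF assms] by (simp add: lin_pot_def nat_abs_def)
qed

lemma lin_pot_minus:
  assumes "0 \<le> x * y"
  shows "lin_pot a (y, y - x) = pot_minus a (nat \<bar>x\<bar>) (nat \<bar>y\<bar>) / (1 - a + a\<^sup>2)"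
proof -
  consider "y = 0" | "\<bar>x\<bar> \<le> \<bar>y\<bar>" "y \<noteq> 0" | "\<bar>y\<bar> < \<bar>x\<bar>" "y \<noteq> 0" by linarith
  then show ?thesis
  proof cases
    case 1
    \<comment> \<open>The sign convention for a zero entry does not matter: there
      \<open>signed_pot\<close> equals \<open>pot\<close>, so exchanging the weights changes
      nothing.\<close>
    have "pot_odd a 0 n = pot_even a 0 n" for n by (simp add: pot_odd_def pot_even_def)
    with 1 show ?thesis by (simp add: lin_pot_def nat_abs_def pot_minus_def)
  next
    case 2
    then have "0 \<le> y * (y - x)" using assms by (auto simp: zero_le_mult_iff)
    moreover have "nat \<bar>y - x\<bar> = nat \<bar>y\<bar> - nat \<bar>x\<bar>" using assms 2 by (auto simp: zero_le_mult_iff)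
    ultimately show ?thesis using 2 by (simp add: lin_pot_def nat_abs_def pot_minus_def nat_le_eq_zle)
  next
    case 3
    then have "y * (y - x) < 0" using assms by (auto simp: zero_le_mult_iff mult_less_0_iff)
    moreover have "nat \<bar>y - x\<bar> = nat \<bar>x\<bar> - nat \<bar>y\<bar>" using assms 3 by (auto simp: zero_le_mult_iff)
    ultimately show ?thesis using 3 by (simp add: lin_pot_def nat_abs_def pot_minus_def nat_le_eq_zle)
  qed
qed

context
  fixes a :: real
  assumes a: "1/2 \<le> a" "a \<le> 1"
begin

text \<open>Both successors are combinations of the same \<open>P\<close> and \<open>Q\<close>. The
  two hypotheses on \<open>p\<close> say that their mean has again the weights of the current
  pair.\<close>

lemma lin_pot_drift:
  assumes v: "v \<noteq> (0, 0)"
    and p: "p * a + (1 - p) * (1 - a)\<^sup>2 = a\<^sup>2" "p * (1 - a)\<^sup>2 + (1 - p) * a = 1 - a"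
  shows "p * lin_pot a (lin_step v True) + (1 - p) * lin_pot a (lin_step v False) = lin_pot a v + mean_ln a"
proof -
  obtain x y where xy: "v = (x, y)" by fastforce
  define D where "D = 1 - a + a\<^sup>2"
  have D: "0 < D" using denom_pos by (simp add: D_def)
  define P Q where "P = pot a (nat \<bar>x\<bar>) (nat \<bar>y\<bar>)" and "Q = signed_pot a (nat \<bar>x\<bar>) (nat \<bar>y\<bar>)"
  have nz: "nat \<bar>x\<bar> \<noteq> 0 \<or> nat \<bar>y\<bar> \<noteq> 0" using v xy by auto
  have G: "mean_ln a = (2 * a - 1) * lyap a / D"
    using mean_ln_lyap[OF a] D by (simp add: D_def field_simps)
  note plus = pot_even_plus[OF a nz, folded P_def Q_def]
  note minus = pot_minus_eq[OF a nz, folded P_def Q_def]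
  show ?thesis
  proof (cases "0 \<le> x * y")
    case True
    have l: "lin_pot a (lin_step v True) = (a * P + (1 - a)\<^sup>2 * Q + (2 * a - 1) * lyap a) / D"
      "lin_pot a (lin_step v False) = (a * Q + (1 - a)\<^sup>2 * P + (2 * a - 1) * lyap a) / D"
      using lin_pot_plus[OF True, of a] lin_pot_minus[OF True, of a]
      unfolding plus minus D_def[symmetric] by (simp_all add: xy)
    have "p * lin_pot a (lin_step v True) + (1 - p) * lin_pot a (lin_step v False)
        = ((p * a + (1 - p) * (1 - a)\<^sup>2) * P + (p * (1 - a)\<^sup>2 + (1 - p) * a) * Q + (2 * a - 1) * lyap a) / D"
      unfolding l times_divide_eq_right add_divide_distrib[symmetric]
      by (rule arg_cong[where f = "\<lambda>z. z / D"]) (simp add: algebra_simps)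
    also have "\<dots> = lin_pot a v + mean_ln a"
      unfolding p G using True
      by (simp add: lin_pot_def nat_abs_def xy pot_even_def P_def Q_def D_def[symmetric] add_divide_distrib)
    finally show ?thesis .
  next
    case False
    \<comment> \<open>Replacing \<open>x\<close> by \<open>- x\<close> exchanges plus and minus and
      leads back to the lemmas for equal signs.\<close>
    then have neg: "0 \<le> - x * y" by simp
    have l: "lin_pot a (lin_step v False) = (a * P + (1 - a)\<^sup>2 * Q + (2 * a - 1) * lyap a) / D"
      "lin_pot a (lin_step v True) = (a * Q + (1 - a)\<^sup>2 * P + (2 * a - 1) * lyap a) / D"
      using lin_pot_plus[OF neg, of a] lin_pot_minus[OF neg, of a]
      unfolding abs_minus_cancel plus minus D_def[symmetric] by (simp_all add: xy)
    have "p * lin_pot a (lin_step v True) + (1 - p) * lin_pot a (lin_step v False)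
        = ((p * (1 - a)\<^sup>2 + (1 - p) * a) * P + (p * a + (1 - p) * (1 - a)\<^sup>2) * Q + (2 * a - 1) * lyap a) / D"
      unfolding l times_divide_eq_right add_divide_distrib[symmetric]
      by (rule arg_cong[where f = "\<lambda>z. z / D"]) (simp add: algebra_simps)
    also have "\<dots> = lin_pot a v + mean_ln a"
      unfolding p G using False
      by (simp add: lin_pot_def nat_abs_def xy pot_odd_def P_def Q_def D_def[symmetric] add_divide_distrib)
    finally show ?thesis .
  qed
qed

text \<open>The weights \<open>a^2\<close> and \<open>1 - a\<close> add up to the denominator, so
  \<open>lin_pot\<close> is a weighted mean of \<open>pot\<close> and \<open>signed_pot\<close>,
  both close to \<open>ln_size\<close>.\<close>

lemma lin_pot_near:
  assumes a1: "a < 1" and v: "v \<noteq> (0, 0)"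
  shows "\<bar>lin_pot a v - ln_size (nat_abs v)\<bar> \<le> 8 * ln 2 + (9 * ln 2 + lyap a) / (1 - a)"
proof -
  obtain x y where xy: "nat_abs v = (x, y)" by fastforce
  have nz: "x \<noteq> 0 \<or> y \<noteq> 0" using v xy nat_abs_eq_zero[of v] by auto
  define D where "D = 1 - a + a\<^sup>2"
  have D: "0 < D" using denom_pos by (simp add: D_def)
  define K where "K = (9 * ln 2 + lyap a) / (1 - a)"
  have K: "0 \<le> K" using lyap_pos[OF a] a1 by (simp add: K_def)
  have comb: "\<bar>(c * pot a x y + (D - c) * signed_pot a x y) / D - ln_size (x, y)\<bar> \<le> 8 * ln 2 + K"
    if "0 \<le> c" "c \<le> D" for c
  proof -
    have eq: "(c * pot a x y + (D - c) * signed_pot a x y) / D - ln_size (x, y)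
        = (c * (pot a x y - ln_size (x, y)) + (D - c) * (signed_pot a x y - ln_size (x, y))) / D"
      using D by (simp add: field_simps)
    have "\<bar>c * (pot a x y - ln_size (x, y))\<bar> \<le> D * (8 * ln 2)"
      "\<bar>(D - c) * (signed_pot a x y - ln_size (x, y))\<bar> \<le> D * K"
      unfolding abs_mult using that pot_near[OF a nz] signed_pot_near[OF a a1 nz, folded K_def] K
      by (auto intro!: mult_mono)
    then have "\<bar>c * (pot a x y - ln_size (x, y)) + (D - c) * (signed_pot a x y - ln_size (x, y))\<bar> \<le> D * (8 * ln 2 + K)"
      by (simp add: algebra_simps abs_le_iff)
    then show ?thesis unfolding eq using D by (simp add: abs_divide pos_divide_le_eq mult.commute)
  qed
  have "lin_pot a v = (a\<^sup>2 * pot a x y + (D - a\<^sup>2) * signed_pot a x y) / D \<or>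
    lin_pot a v = ((1 - a) * pot a x y + (D - (1 - a)) * signed_pot a x y) / D"
    by (simp add: lin_pot_def xy pot_even_def pot_odd_def D_def)
  then show ?thesis using comb[of "a\<^sup>2"] comb[of "1 - a"] a by (auto simp: xy D_def K_def)
qed

end

lemma alpha_lin_less_one:
  assumes "0 < p" "p < 1" shows "alpha_lin p < 1"
  using alpha_lin_strict_mono[of p 1] assms by (simp add: alpha_lin_one)

lemma mean_ln_alpha_lin_pos:
  assumes "0 < p" "p \<le> 1" shows "0 < mean_ln (alpha_lin p)"
  using alpha_lin_bounds[of p] assms mean_ln_strict_mono[of "1/2" "alpha_lin p"] by (simp add: mean_ln_half)

lemma lin_growth_rate_less_one:
  assumes p: "0 < p" "p < 1"
  shows "has_growth_rate p (\<lambda>s n. \<bar>lin_fib s n\<bar>) (mean_ln (alpha_lin p))"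
proof -
  define a where "a = alpha_lin p"
  define C where "C = 8 * ln 2 + (9 * ln 2 + lyap a) / (1 - a)"
  have a: "1/2 \<le> a" "a \<le> 1" "a < 1"
    using alpha_lin_bounds[of p] alpha_lin_less_one[of p] p by (auto simp: a_def)
  note near = lin_pot_near[OF a, folded C_def]
  have pa: "p * a + (1 - p) * (1 - a)\<^sup>2 = a\<^sup>2" "p * (1 - a)\<^sup>2 + (1 - p) * a = 1 - a"
    using alpha_lin_eq[of p a] p by (auto simp: a_def)
  have lim: "AE s in signs p. (\<lambda>n. lin_pot a (walk lin_step (1, 1) s n) / real n) \<longlonglongrightarrow> mean_ln a"
  proof (rule walk_law_of_large_numbers[where S = "- {(0, 0)}" and C = "2 * C + ln 2"])
    show "\<bar>lin_pot a (lin_step v b) - lin_pot a v\<bar> \<le> 2 * C + ln 2" if "v \<in> - {(0, 0)}" for v b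
    proof -
      have v: "v \<noteq> (0, 0)" using that by simp
      obtain c where c: "nat_abs (lin_step v b) = nat_step (nat_abs v) c" using nat_abs_lin_step by blast
      have "\<bar>ln_size (nat_abs (lin_step v b)) - ln_size (nat_abs v)\<bar> \<le> ln 2"
        unfolding c using v by (intro ln_size_nat_step) simp
      with near[OF v] near[OF lin_step_nonzero[OF v], of b] show ?thesis by (smt (verit))
    qed
  qed (use p lin_step_nonzero lin_pot_drift[OF a(1,2) _ pa] in auto)
  have "AE s in signs p. (\<lambda>n. ln (real (fst (nat_abs (walk lin_step (1, 1) s n)))) / real n) \<longlonglongrightarrow> mean_ln a"
    using lim
  proof eventually_elim
    case (elim s)
    have nz: "walk lin_step (1, 1) s n \<noteq> (0, 0)" for n
    proof (induction n)
      case (Suc n)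
      show ?case using lin_step_nonzero[OF Suc] by simp
    qed simp
    have "(\<lambda>n. ln_size (nat_abs (walk lin_step (1, 1) s n)) / real n) \<longlonglongrightarrow> mean_ln a"
      by (rule LIMSEQ_bounded_diff_average[OF near[OF nz] elim])
    then show ?case
      using nat_abs_lin_step mean_ln_alpha_lin_pos[of p] p
      by (intro component_growth[where u = "\<lambda>n. nat_abs (walk lin_step (1, 1) s n)"]) (auto simp: nat_abs_def[of "(1, 1)"] a_def)
  qed
  from AE_signs_shift[OF this] show ?thesis
    unfolding has_growth_rate_def a_def[symmetric]
  proof eventually_elim
    case (elim s)
    then have "(\<lambda>n. ln (real_of_int \<bar>lin_fib s (Suc n)\<bar>) / real n) \<longlonglongrightarrow> mean_ln a"
      by (simp add: lin_fib_walk nat_abs_def)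
    then show ?case by (rule LIMSEQ_shift_average)
  qed
qed

text \<open>Here \<open>alpha_lin\<close> is 1, outside the range of \<open>signed_pot_near\<close>.
  Almost surely every sign is plus, so the two sequences coincide and the non-linear result
  applies.\<close>

lemma lin_growth_rate_one: "has_growth_rate 1 (\<lambda>s n. \<bar>lin_fib s n\<bar>) (mean_ln (alpha_lin 1))"
proof -
  have "AE s in signs 1. s n" for n
  proof -
    have "b" if "b \<in> set_pmf (bernoulli_pmf 1)" for b
      using that by (cases b) (auto simp: set_pmf_iff)
    then have "AE b in measure_pmf (bernoulli_pmf 1). b" unfolding AE_measure_pmf_iff by blast
    then show ?thesis unfolding signs_def
      by (intro AE_PiM_component) (simp_all add: prob_space_measure_pmf)
  qed
  then have all: "AE s in signs 1. \<forall>n. s n" unfolding AE_all_countable by blast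
  have eq: "\<bar>lin_fib s n\<bar> = nonlin_fib s n" if "\<forall>n. s n" for s n
  proof -
    have "lin_fib s n = nonlin_fib s n \<and> 0 \<le> nonlin_fib s n"
      using that by (induction s n rule: lin_fib.induct) auto
    then show ?thesis by simp
  qed
  have "has_growth_rate 1 nonlin_fib (mean_ln (alpha_nonlin 1))"
    by (rule nonlin_growth_rate_large) auto
  then have "AE s in signs 1. (\<lambda>n. (1 / real n) * ln (real_of_int (nonlin_fib s n))) \<longlonglongrightarrow> mean_ln (alpha_nonlin 1)"
    unfolding has_growth_rate_def .
  with all show ?thesis unfolding has_growth_rate_def
    by eventually_elim (simp add: eq alpha_nonlin_special alpha_lin_one)
qed

section \<open>Identification of the growth rates\<close>

lemma has_growth_rate_unique:
  assumes "has_growth_rate p X c" "has_growth_rate p X d"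
  shows "c = d"
proof -
  interpret prob_space "signs p" by (rule prob_space_signs)
  have "AE s in signs p. c = d"
    using assms unfolding has_growth_rate_def
    by eventually_elim (rule LIMSEQ_unique)
  then show ?thesis by simp
qed

lemma lin_growth:
  assumes "p \<in> {0<..1}"
  shows "has_growth_rate p (\<lambda>s n. \<bar>lin_fib s n\<bar>) (lin_growth p)" "lin_growth p = mean_ln (alpha_lin p)"
proof -
  have h: "has_growth_rate p (\<lambda>s n. \<bar>lin_fib s n\<bar>) (mean_ln (alpha_lin p))"
    using assms lin_growth_rate_less_one lin_growth_rate_one by (cases "p = 1") auto
  then show e: "lin_growth p = mean_ln (alpha_lin p)"
    unfolding lin_growth_def by (intro the_equality) (auto dest: has_growth_rate_unique)
  show "has_growth_rate p (\<lambda>s n. \<bar>lin_fib s n\<bar>) (lin_growth p)" unfolding e by (rule h)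
qed

text \<open>The maximum with 1/2 joins the two regimes into one formula, since
  \<open>mean_ln (1/2) = 0\<close>. Continuity across \<open>p = 1/3\<close> then follows by
  composition.\<close>

lemma nonlin_growth:
  assumes "p \<in> {0<..1}"
  shows "has_growth_rate p nonlin_fib (nonlin_growth p)"
    and "nonlin_growth p = mean_ln (max (1/2) (alpha_nonlin p))"
proof -
  have h: "has_growth_rate p nonlin_fib (mean_ln (max (1/2) (alpha_nonlin p)))"
  proof (cases "p \<le> 1/3")
    case True
    have "alpha_nonlin p \<le> 1/2"
    proof (cases "p = 1/3")
      case False
      then show ?thesis
        using alpha_nonlin_strict_mono[of p "1/3"] True assms by (simp add: alpha_nonlin_special)
    qed (simp only: alpha_nonlin_special)
    then have "max (1/2) (alpha_nonlin p) = 1/2" by simp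
    then show ?thesis using nonlin_growth_rate_small[of p] True assms by (simp only: mean_ln_half) simp
  next
    case False
    then show ?thesis
      using nonlin_growth_rate_large[of p] alpha_nonlin_bounds(1)[of p] assms by (simp add: max_absorb2)
  qed
  then show e: "nonlin_growth p = mean_ln (max (1/2) (alpha_nonlin p))"
    unfolding nonlin_growth_def by (intro the_equality) (auto dest: has_growth_rate_unique)
  show "has_growth_rate p nonlin_fib (nonlin_growth p)" unfolding e by (rule h)
qed

text \<open>The derivative at 1 is local, so it suffices to work for \<open>p > 1/2\<close>, where
  the formula for the growth rate also holds in the non-linear case.\<close>

lemma mean_ln_comp_derivative:
  assumes f: "(f has_real_derivative 1) (at 1 within {0<..1})" "f 1 = 1"
    and g: "\<And>p. p \<in> {0<..1} \<Longrightarrow> 1/2 < p \<Longrightarrow> g p = mean_ln (f p) \<and> f p \<in> {1/2..1}"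
  shows "(g has_real_derivative ln 5 / 2) (at 1 within {0<..1})"
proof -
  have "((\<lambda>p. mean_ln (f p)) has_real_derivative ln 5 / 2 * 1) (at 1 within {1/2<..1})"
  proof (rule DERIV_image_chain[where f = mean_ln and g = f, unfolded comp_def])
    show "(f has_real_derivative 1) (at 1 within {1/2<..1})"
      by (rule DERIV_subset[OF f(1)]) auto
    show "(mean_ln has_real_derivative ln 5 / 2) (at (f 1) within f ` {1/2<..1})"
      unfolding f(2) by (rule DERIV_subset[OF mean_ln_derivative_one]) (use g in auto)
  qed
  then have "((\<lambda>p. mean_ln (f p)) has_real_derivative ln 5 / 2) (at 1 within {1/2<..1})" by simp
  then have "(g has_real_derivative ln 5 / 2) (at 1 within {1/2<..1})"
  proof (rule has_field_derivative_transform_within[OF _ zero_less_one])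
    show "mean_ln (f p) = g p" if "p \<in> {1/2<..1}" for p using g[of p] that by simp
  qed simp
  moreover have "at (1::real) within {0<..1} = at 1 within {1/2<..1}"
    by (rule at_within_nhd[where S = "{1/2<..}"]) auto
  ultimately show ?thesis by simp
qed

theorem theorem1p3:
  fixes \<phi> :: real
  defines "\<phi> \<equiv> (1 + sqrt 5) / 2"
  shows
    "(\<forall>p\<in>{0<..1}. has_growth_rate p (\<lambda>s n. \<bar>lin_fib s n\<bar>) (lin_growth p)) \<and>
     strict_mono_on {0<..1} lin_growth \<and>
     (lin_growth \<longlongrightarrow> 0) (at_right 0) \<and>
     lin_growth 1 = ln \<phi> \<and>
     (lin_growth has_real_derivative ln 5 / 2) (at 1 within {0<..1}) \<and>
     (\<forall>p\<in>{0<..1}. has_growth_rate p nonlin_fib (nonlin_growth p)) \<and>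
     continuous_on {0<..1} nonlin_growth \<and>
     strict_mono_on {1/3<..1} nonlin_growth \<and>
     (\<forall>p. 0 < p \<and> p \<le> 1/3 \<longrightarrow> nonlin_growth p = 0) \<and>
     nonlin_growth 1 = ln \<phi> \<and>
     (nonlin_growth has_real_derivative ln 5 / 2) (at 1 within {0<..1})"
proof (intro conjI ballI allI impI)
  show "has_growth_rate p (\<lambda>s n. \<bar>lin_fib s n\<bar>) (lin_growth p)" if "p \<in> {0<..1}" for p
    by (rule lin_growth(1)[OF that])
  show "strict_mono_on {0<..1} lin_growth"
  proof (rule strict_mono_onI)
    fix p r :: real assume pr: "p \<in> {0<..1}" "r \<in> {0<..1}" "p < r"
    show "lin_growth p < lin_growth r"
      unfolding lin_growth(2)[OF pr(1)] lin_growth(2)[OF pr(2)]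
      by (intro mean_ln_strict_mono alpha_lin_strict_mono less_imp_le[OF alpha_lin_bounds(1)] alpha_lin_bounds(2))
        (use pr in auto)
  qed
  show "(lin_growth \<longlongrightarrow> 0) (at_right 0)"
  proof -
    have ev: "\<forall>\<^sub>F p in at_right 0. p \<in> {0<..1::real}"
      using eventually_at_right_real[of 0 1, OF zero_less_one] by eventually_elim auto
    have "((\<lambda>p. mean_ln (alpha_lin p)) \<longlongrightarrow> mean_ln (1/2)) (at_right 0)"
    proof (rule continuous_on_tendsto_compose[OF continuous_on_mean_ln alpha_lin_tendsto])
      show "\<forall>\<^sub>F p in at_right 0. alpha_lin p \<in> {1/2..1}"
        using ev by eventually_elim (use alpha_lin_bounds less_imp_le in auto)
    qed simp
    then have "((\<lambda>p. mean_ln (alpha_lin p)) \<longlongrightarrow> 0) (at_right 0)" by (simp add: mean_ln_half)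
    then show ?thesis
      by (rule Lim_transform_eventually) (use ev in \<open>eventually_elim, simp add: lin_growth(2)\<close>)
  qed
  show "lin_growth 1 = ln \<phi>"
    by (simp add: lin_growth(2) alpha_lin_one mean_ln_one \<phi>_def golden_def)
  show "(lin_growth has_real_derivative ln 5 / 2) (at 1 within {0<..1})"
    by (rule mean_ln_comp_derivative[OF alpha_lin_derivative alpha_lin_one])
      (use lin_growth(2) alpha_lin_bounds(1)[THEN less_imp_le] alpha_lin_bounds(2) in auto)
  show "has_growth_rate p nonlin_fib (nonlin_growth p)" if "p \<in> {0<..1}" for p
    by (rule nonlin_growth(1)[OF that])
  show "continuous_on {0<..1} nonlin_growth"
  proof -
    have "continuous_on {0<..1} (\<lambda>p. mean_ln (max (1/2) (alpha_nonlin p)))"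
    proof (rule continuous_on_compose2[OF continuous_on_mean_ln])
      show "continuous_on {0<..1} (\<lambda>p. max (1/2) (alpha_nonlin p))"
        by (intro continuous_intros continuous_on_alpha_nonlin)
      show "(\<lambda>p. max (1/2) (alpha_nonlin p)) ` {0<..1} \<subseteq> {1/2..1}"
      proof safe
        fix p :: real assume p: "p \<in> {0<..1}"
        then have "alpha_nonlin p \<le> 1"
          using alpha_nonlin_strict_mono[of p 1] by (cases "p = 1") (auto simp: alpha_nonlin_special)
        then show "max (1/2) (alpha_nonlin p) \<in> {1/2..1}" by simp
      qed
    qed
    then show ?thesis by (rule continuous_on_eq) (simp add: nonlin_growth(2))
  qed
  have large: "nonlin_growth p = mean_ln (alpha_nonlin p)" if "1/3 < p" "p \<le> 1" for p
    using nonlin_growth(2)[of p] alpha_nonlin_bounds(1)[of p] that by (simp add: max_absorb2)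
  show "strict_mono_on {1/3<..1} nonlin_growth"
  proof (rule strict_mono_onI)
    fix p r :: real assume pr: "p \<in> {1/3<..1}" "r \<in> {1/3<..1}" "p < r"
    then have "mean_ln (alpha_nonlin p) < mean_ln (alpha_nonlin r)"
      by (intro mean_ln_strict_mono alpha_nonlin_strict_mono alpha_nonlin_bounds) auto
    then show "nonlin_growth p < nonlin_growth r" using pr by (simp add: large)
  qed
  show "nonlin_growth p = 0" if "0 < p \<and> p \<le> 1/3" for p
  proof -
    have "has_growth_rate p nonlin_fib 0" using that by (intro nonlin_growth_rate_small) auto
    then show ?thesis using that by (intro has_growth_rate_unique[OF nonlin_growth(1)]) auto
  qed
  show "nonlin_growth 1 = ln \<phi>"
    by (simp add: large alpha_nonlin_special mean_ln_one \<phi>_def golden_def)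
  show "(nonlin_growth has_real_derivative ln 5 / 2) (at 1 within {0<..1})"
    by (rule mean_ln_comp_derivative[OF alpha_nonlin_derivative alpha_nonlin_special(1)])
      (use large alpha_nonlin_bounds in auto)
qed

end
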